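(* Let $F:[0,T]\times X\to\mathbb{R}$ satisfy (F0)–(F3), and assume that $\nabla_x F(t,0)=0$ for all $t\in[0,T]$. Let $A(t):=\nabla_x^2F(t,0)$, let $\lambda_1(t)$ be the minimum eigenvalue of $A(t)$, assume that $\lambda_1(0)>0$ and $\int_0^T\lambda_1(s)\,\mathrm{d}s<0$, and define $$t^*:=\min\left\{t\in(0,T):\ \int_0^t\lambda_1(s)\,\mathrm{d}s=0\right\}.$$ Assume moreover: (A1) there exists $\rho>0$ such that $\lambda_1(t)$ is a simple eigenvalue of $A(t)$ for all $t\in[0,t^*+\rho]\subset[0,T]$ and its eigenspace is a fixed line $L=\mathrm{span}(e_1)$ independent of $t\in[0,t^*+\rho]$; (A2) $\det(A(t^* ))\neq0$. Let $(u_\varepsilon)_\varepsilon$ be a sequence of solutions to $\varepsilon\dot u_\varepsilon(t)=-\nabla_xF(t,u_\varepsilon(t))$ on $[0,T]$ such that $$\lim_{\varepsilon\to0}u_\varepsilon(0)=0,\qquad \liminf_{\varepsilon\to0}\frac{\|u_\varepsilon(0)\|}{\varepsilon^\alpha}>0\ \text{ for some }\alpha>0,\qquad \liminf_{\varepsilon\to0}\frac{|\langle u_\varepsilon(0),e_1\rangle|^2}{\|u_\varepsilon(0)\|^2}>0 ,$$ and let $u:[0,T]\to X$ be the pointwise limit of $(u_\varepsilon)_\varepsilon$ (along a subsequence, not relabelled) provided by the compactness theorem recalled in the context. Then there exists a sequence $t_\varepsilon\to t^*$ such that, setting $w_\varepsilon(s):=u_\varepsilon(t_\varepsilon+\varepsilon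 s)$, $(w_\varepsilon)_\varepsilon$ has a subsequence converging uniformly on compact subsets of $\mathbb{R}$ to a solution $w:\mathbb{R}\to X$ of $$\dot w(s)=-\nabla_xF(t^*,w(s))\ \ (s\in\mathbb{R}),\qquad \lim_{s\to-\infty}w(s)=0 .$$ Furthermore, if $\langle u_\varepsilon(0),e_1\rangle>0$ for all $\varepsilon$, then $$\liminf_{s\to-\infty}\frac{\langle w(s),e_1\rangle}{\|w(s)\|}>0,$$ while if $\langle u_\varepsilon(0),e_1\rangle<0$ for all $\varepsilon$, then $$\limsup_{s\to-\infty}\frac{\langle w(s),e_1\rangle}{\|w(s)\|}<0 .$$
   Context: $T>0$ is fixed and $(X,\|\cdot\|)$ is an $n$-dimensional real Hilbert space, $n\ge1$, with scalar product $\langle\cdot,\cdot\rangle$. $\nabla_xF$ and $\nabla_x^2F$ denote the gradient and Hessian of $F(t,x)$ with respect to $x$; $\partial_tF$ is the partial derivative in $t$. The parameter $\varepsilon>0$ ranges over a sequence converging to $0$; solutions $u_\varepsilon:[0,T]\to X$ satisfy the equation for a.e. $t\in[0,T]$ (being absolutely continuous, hence $C^1$ and for all $t$). The function $w_\varepsilon$ is defined for $s\in[-t_\varepsilon/\varepsilon,(T-t_\varepsilon)/\varepsilon]$, which contains any given compact subset of $\mathbb{R}$ for $\varepsilon$ small, since $0<t^*<T$. Assumptions: (F0) $F\in C^2([0,T]\times X)$. (F1) With $\mathcal{F}(u):=\sup_{t\in[0,T]}|F(t,u)|$, for every $\rho>0$ the set $\{u\in X:\mathcal{F}(u)\le\rho\}$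 is bounded. (F2) There exist $C_1,C_2>0$ such that $|\partial_tF(t,u)|\le C_1F(t,u)+C_2$ for all $(t,u)\in[0,T]\times X$. (F3) For every $t\in[0,T]$ the set of critical points $C(t):=\{u\in X:\nabla_xF(t,u)=0\}$ consists of isolated points. Compactness theorem (Agostiniani–Rossi): under (F0)–(F3), along a subsequence independent of $t$, the solutions $u_\varepsilon$ converge pointwise on $[0,T]$ as $\varepsilon\to0$ to a function $u:[0,T]\to X$ such that: (i) the jump set $J$ of $u$ (its set of discontinuity points) is at most countable; (ii) $u$ is continuous on $[0,T]\setminus J$ and $\nabla_xF(t,u(t))=0$ for every $t\in[0,T]\setminus J$; (iii) the left and right limits $u_-(t)$, $u_+(t)$ exist at every $t\in(0,T)$, and so do $u_+(0)$ and $u_-(T)$. *)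

theory Defs
  imports "HOL-Analysis.Analysis"
begin

text \<open>
  The ambient space is a type of class \<open>euclidean_space\<close>, i.e. a real Hilbert space of finite
  dimension \<open>DIM('a) \<ge> 1\<close>. The energy is \<open>F :: real \<Rightarrow> 'a \<Rightarrow> real\<close>, and only
  its values for times in \<open>{0..T}\<close> matter.
\<close>

subsection \<open>Derivatives of the energy\<close>

text \<open>
  The derivatives are taken relative to \<open>S\<close>, hence one-sided at boundary points. They are unique
  for \<open>S = {0..T} \<times> UNIV\<close> with \<open>T > 0\<close>.
\<close>

definition C2_on :: "('b::real_normed_vector \<Rightarrow> real) \<Rightarrow> 'b set \<Rightarrow> bool" where
  "C2_on f S \<longleftrightarrow>
     (\<exists>(D1 :: 'b \<Rightarrow> 'b \<Rightarrow>\<^sub>L real) (D2 :: 'b \<Rightarrow> 'b \<Rightarrow>\<^sub>L ('b \<Rightarrow>\<^sub>L real)).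
        (\<forall>p\<in>S. (f has_derivative blinfun_apply (D1 p)) (at p within S)) \<and>
        (\<forall>p\<in>S. (D1 has_derivative blinfun_apply (D2 p)) (at p within S)) \<and>
        continuous_on S D2)"

definition gradx :: "(real \<Rightarrow> 'a::euclidean_space \<Rightarrow> real) \<Rightarrow> real \<Rightarrow> 'a \<Rightarrow> 'a" where
  "gradx F t x = (THE D. GDERIV (F t) x :> D)"

text \<open>The Hessian, as a linear endomorphism of the space.\<close>

definition hessx :: "(real \<Rightarrow> 'a::euclidean_space \<Rightarrow> real) \<Rightarrow> real \<Rightarrow> 'a \<Rightarrow> 'a \<Rightarrow> 'a" where
  "hessx F t x = frechet_derivative (gradx F t) (at x)"

definition partial_t :: "real \<Rightarrow> (real \<Rightarrow> 'a \<Rightarrow> real) \<Rightarrow> real \<Rightarrow> 'a \<Rightarrow> real" where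
  "partial_t T F t x = vector_derivative (\<lambda>s. F s x) (at t within {0..T})"

subsection \<open>Standing assumptions\<close>

definition F0 :: "real \<Rightarrow> (real \<Rightarrow> 'a::euclidean_space \<Rightarrow> real) \<Rightarrow> bool" where
  "F0 T F \<longleftrightarrow> C2_on (\<lambda>(t, x). F t x) ({0..T} \<times> UNIV)"

definition F1 :: "real \<Rightarrow> (real \<Rightarrow> 'a::euclidean_space \<Rightarrow> real) \<Rightarrow> bool" where
  "F1 T F \<longleftrightarrow> (\<forall>\<rho>>0. bounded {x. (SUP t\<in>{0..T}. \<bar>F t x\<bar>) \<le> \<rho>})"

definition F2 :: "real \<Rightarrow> (real \<Rightarrow> 'a::euclidean_space \<Rightarrow> real) \<Rightarrow> bool" where
  "F2 T F \<longleftrightarrow>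
     (\<exists>C1>0. \<exists>C2>0. \<forall>t\<in>{0..T}. \<forall>x. \<bar>partial_t T F t x\<bar> \<le> C1 * F t x + C2)"

definition F3 :: "real \<Rightarrow> (real \<Rightarrow> 'a::euclidean_space \<Rightarrow> real) \<Rightarrow> bool" where
  "F3 T F \<longleftrightarrow> (\<forall>t\<in>{0..T}. discrete {x. gradx F t x = 0})"

subsection \<open>Linear algebra of endomorphisms\<close>

definition eigenspace :: "('a::real_vector \<Rightarrow> 'a) \<Rightarrow> real \<Rightarrow> 'a set" where
  "eigenspace A \<mu> = {v. A v = \<mu> *\<^sub>R v}"

definition eigenvalues :: "('a::real_vector \<Rightarrow> 'a) \<Rightarrow> real set" where
  "eigenvalues A = {\<mu>. \<exists>v\<in>eigenspace A \<mu>. v \<noteq> 0}"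

text \<open>Simplicity is algebraic: the generalized eigenspace has dimension one.\<close>

definition simple_eigenvalue :: "('a::real_vector \<Rightarrow> 'a) \<Rightarrow> real \<Rightarrow> bool" where
  "simple_eigenvalue A \<mu> \<longleftrightarrow>
     \<mu> \<in> eigenvalues A \<and> dim {v. \<exists>k. ((\<lambda>x. A x - \<mu> *\<^sub>R x) ^^ k) v = 0} = 1"

text \<open>
  The Leibniz formula for the matrix of \<open>A\<close> in the orthonormal basis \<open>Basis\<close>; the library's
  \<open>det\<close> covers only matrices indexed by finite types.
\<close>

definition endo_det :: "('a::euclidean_space \<Rightarrow> 'a) \<Rightarrow> real" where
  "endo_det A =
     (\<Sum>p | p permutes (Basis :: 'a set). of_int (sign p) * (\<Prod>b\<in>Basis. A b \<bullet> p b))"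

definition lambda1 :: "(real \<Rightarrow> 'a::euclidean_space \<Rightarrow> real) \<Rightarrow> real \<Rightarrow> real" where
  "lambda1 F t = Min (eigenvalues (hessx F t 0))"

definition t_star :: "real \<Rightarrow> (real \<Rightarrow> 'a::euclidean_space \<Rightarrow> real) \<Rightarrow> real" where
  "t_star T F = (LEAST t. t \<in> {0<..<T} \<and> integral {0..t} (lambda1 F) = 0)"

subsection \<open>Gradient flow and its limits\<close>

definition gradient_flow ::
    "real \<Rightarrow> (real \<Rightarrow> 'a::euclidean_space \<Rightarrow> real) \<Rightarrow> real \<Rightarrow> (real \<Rightarrow> 'a) \<Rightarrow> bool" where
  "gradient_flow T F \<epsilon> u \<longleftrightarrow>
     (\<exists>u'. \<forall>t\<in>{0..T}. (u has_vector_derivative u' t) (at t within {0..T}) \<and>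
                      \<epsilon> *\<^sub>R u' t = - gradx F t (u t))"

definition jump_set :: "real \<Rightarrow> (real \<Rightarrow> 'a::topological_space) \<Rightarrow> real set" where
  "jump_set T u = {t\<in>{0..T}. \<not> continuous (at t within {0..T}) u}"

text \<open>
  The properties which the compactness theorem of Agostiniani and Rossi guarantees for the
  pointwise limit \<open>u\<close> of a (sub)sequence \<open>v\<close> of solutions.
\<close>

definition compactness_limit ::
    "real \<Rightarrow> (real \<Rightarrow> 'a::euclidean_space \<Rightarrow> real) \<Rightarrow> (nat \<Rightarrow> real \<Rightarrow> 'a) \<Rightarrow> (real \<Rightarrow> 'a) \<Rightarrow> bool"
  where
  "compactness_limit T F v u \<longleftrightarrow>
     (\<forall>t\<in>{0..T}. (\<lambda>k. v k t) \<longlonglongrightarrow> u t) \<and>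
     countable (jump_set T u) \<and>
     continuous_on ({0..T} - jump_set T u) u \<and>
     (\<forall>t\<in>{0..T} - jump_set T u. gradx F t (u t) = 0) \<and>
     (\<forall>t\<in>{0<..T}. \<exists>l. (u \<longlongrightarrow> l) (at_left t)) \<and>
     (\<forall>t\<in>{0..<T}. \<exists>l. (u \<longlongrightarrow> l) (at_right t))"

end

(*
  Near u = 0 the equation is a perturbation of \<epsilon> u' = - A(t) u with a remainder \<eta> |u|, \<eta> as small as
  we like on a small ball of radius \<delta>. With G(t) the integral of \<lambda>1 over [0,t], the norm of u is at most
  |u(0)| exp((-G(t) + \<eta> t)/\<epsilon>), so u stays small before t_star. Write v for the component of u along e1. The
  spectral gap makes the cone |u|^2 \<le> K v^2 invariant, and inside the cone v grows at least like
  exp((-G(t) - \<eta> K t)/\<epsilon>), which beats the polynomially small initial value as soon as G < 0. By (A2),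
  \<lambda>1(t_star) < 0, so the first times t_\<epsilon> with |u| = \<delta> converge to t_star. Backwards from t_\<epsilon> the
  rescaled solutions decay exponentially within the cone, with v bounded away from 0 on compact sets; these
  estimates pass to the limit and give all the claims on w. Bounds on [0,T] come from the energy estimate
  contained in (F1)-(F2), and a Gronwall argument shows that the rescaled solutions are locally
  uniformly Cauchy once their values at s = 0 converge.
*)

theory Submission
  imports Defs "HOL-Real_Asymp.Real_Asymp"
begin

subsection \<open>First and second derivatives of the energy\<close>

text \<open>The obstacle is the precision of the escape time. In a ball of fixed radius \<delta> the
  linearization has an error \<eta>, and exponents are divided by \<epsilon>, so an error \<eta>
  accumulated from time 0 would shift the escape by a fixed amount. Hence two pairs are used. The
  pair (\<eta>, \<delta>) is fixed once, after K, and only has to respect the spectral gap and the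
  growth rate near \<open>t_star\<close>. For each window of width \<theta> around
  \<open>t_star\<close> a smaller pair (\<eta>', \<delta>') controls the time before the window; it
  is admissible there because the norm stays, for small \<epsilon>, below its vanishing initial
  value. K comes from the initial angle with the line L, and the same K bounds the angle of w in the
  limit. The estimates concern |u|^2 and v^2, which remain differentiable at zeros; this explains
  the factor 2 / \<epsilon> in the exponents. Over a rescaled time s the length \<epsilon> |s|
  cancels that \<epsilon>, so bounds in s alone survive the limit.\<close>

lemma second_difference_MVT:
  fixes f :: "'a::real_inner \<Rightarrow> real"
  assumes f: "\<And>x. (f has_derivative (\<lambda>h. g x \<bullet> h)) (at x)"
    and g: "\<And>x. (g has_derivative H x) (at x)"
    and s: "s > 0"
  shows "\<exists>\<sigma> \<tau>. 0 < \<sigma> \<and> \<sigma> < s \<and> 0 < \<tau> \<and> \<tau> < s \<and>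
    f (a + s *\<^sub>R h + s *\<^sub>R k) - f (a + s *\<^sub>R h) - (f (a + s *\<^sub>R k) - f a) =
    s\<^sup>2 * (H (a + \<sigma> *\<^sub>R h + \<tau> *\<^sub>R k) k \<bullet> h)"
proof -
  \<comment> \<open>The mixed second difference is \<open>D s - D 0\<close>. The mean value theorem
    is applied along h and then, at the point found, along k, so h and k play different roles
    although the second difference is symmetric in them.\<close>
  define D where "D \<sigma> = f (a + \<sigma> *\<^sub>R h + s *\<^sub>R k) - f (a + \<sigma> *\<^sub>R h)" for \<sigma>
  have D': "(D has_real_derivative (g (a + \<sigma> *\<^sub>R h + s *\<^sub>R k) \<bullet> h - g (a + \<sigma> *\<^sub>R h) \<bullet> h)) (at \<sigma>)" for \<sigma>
  proof -
    have "((\<lambda>\<sigma>. f (a + \<sigma> *\<^sub>R h + c)) has_derivative (\<lambda>d. g (a + \<sigma> *\<^sub>R h + c) \<bullet> (d *\<^sub>R h))) (at \<sigma>)" for c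
      by (rule has_derivative_compose[OF _ f]) (auto intro!: derivative_eq_intros)
    from this[of "s *\<^sub>R k"] this[of 0]
    have "(D has_derivative (\<lambda>d. g (a + \<sigma> *\<^sub>R h + s *\<^sub>R k) \<bullet> (d *\<^sub>R h) - g (a + \<sigma> *\<^sub>R h) \<bullet> (d *\<^sub>R h))) (at \<sigma>)"
      unfolding D_def by (auto intro!: has_derivative_diff)
    then show ?thesis
      unfolding has_field_derivative_def
      by (rule has_derivative_eq_rhs) (auto simp: algebra_simps)
  qed
  from MVT2[OF s D'] obtain \<sigma> where \<sigma>: "0 < \<sigma>" "\<sigma> < s"
    "D s - D 0 = s * (g (a + \<sigma> *\<^sub>R h + s *\<^sub>R k) \<bullet> h - g (a + \<sigma> *\<^sub>R h) \<bullet> h)"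
    by auto
  have E': "((\<lambda>\<tau>. g (a + \<sigma> *\<^sub>R h + \<tau> *\<^sub>R k) \<bullet> h) has_real_derivative
      (H (a + \<sigma> *\<^sub>R h + \<tau> *\<^sub>R k) k \<bullet> h)) (at \<tau>)" for \<tau>
  proof -
    let ?x = "a + \<sigma> *\<^sub>R h + \<tau> *\<^sub>R k"
    interpret H: bounded_linear "H ?x" by (rule has_derivative_bounded_linear[OF g])
    have "((\<lambda>\<tau>. g (a + \<sigma> *\<^sub>R h + \<tau> *\<^sub>R k)) has_derivative (\<lambda>d. H ?x (d *\<^sub>R k))) (at \<tau>)"
      by (rule has_derivative_compose[OF _ g]) (auto intro!: derivative_eq_intros)
    then have "((\<lambda>\<tau>. g (a + \<sigma> *\<^sub>R h + \<tau> *\<^sub>R k) \<bullet> h) has_derivative (\<lambda>d. H ?x (d *\<^sub>R k) \<bullet> h)) (at \<tau>)"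
      by (rule has_derivative_inner_left)
    then show ?thesis
      unfolding has_field_derivative_def
      by (rule has_derivative_eq_rhs) (auto simp: H.scaleR)
  qed
  from MVT2[OF s E'] obtain \<tau> where "0 < \<tau>" "\<tau> < s"
    "g (a + \<sigma> *\<^sub>R h + s *\<^sub>R k) \<bullet> h - g (a + \<sigma> *\<^sub>R h) \<bullet> h = s * (H (a + \<sigma> *\<^sub>R h + \<tau> *\<^sub>R k) k \<bullet> h)"
    by auto
  with \<sigma> show ?thesis
    by (intro exI[of _ \<sigma>] exI[of _ \<tau>]) (simp add: D_def power2_eq_square)
qed

text \<open>Schwarz's theorem. Exchanging h and k does not change the second difference, so
  \<open>second_difference_MVT\<close> evaluates it in two ways, with the roles of h and k swapped,
  at two points near a. Continuity at a lets both points shrink to a.\<close>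

lemma second_derivative_symmetric:
  fixes f :: "'a::real_inner \<Rightarrow> real"
  assumes f: "\<And>x. (f has_derivative (\<lambda>h. g x \<bullet> h)) (at x)"
    and g: "\<And>x. (g has_derivative H x) (at x)"
    and cont: "\<And>h. isCont (\<lambda>x. H x h) a"
  shows "H a h \<bullet> k = H a k \<bullet> h"
proof -
  have "\<bar>H a h \<bullet> k - H a k \<bullet> h\<bar> \<le> 2 * e" if e: "e > 0" for e
  proof -
    have "isCont (\<lambda>x. H x h \<bullet> k) a" "isCont (\<lambda>x. H x k \<bullet> h) a"
      by (intro continuous_intros cont)+
    moreover have "\<exists>d>0. \<forall>x. norm (x - a) < d \<longrightarrow> \<bar>f x - f a\<bar> < e" if "isCont f a" for f :: "'a \<Rightarrow> real"
      using that e unfolding continuous_at_eps_delta dist_norm real_norm_def by blast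
    ultimately obtain d1 d2 where d: "d1 > 0" "d2 > 0"
      "\<And>x. norm (x - a) < d1 \<Longrightarrow> \<bar>H x h \<bullet> k - H a h \<bullet> k\<bar> < e"
      "\<And>x. norm (x - a) < d2 \<Longrightarrow> \<bar>H x k \<bullet> h - H a k \<bullet> h\<bar> < e"
      by metis
    define d where "d = min d1 d2"
    \<comment> \<open>With this s every intermediate point lies within d of a; the summand 1 keeps
      the denominator positive when h = k = 0.\<close>
    define s where "s = d / (norm h + norm k + 1)"
    have den: "norm h + norm k + 1 > 0"
      by (intro add_nonneg_pos add_nonneg_nonneg) auto
    then have s: "s > 0" using d by (simp add: s_def d_def)
    have near: "norm (\<sigma> *\<^sub>R h + \<tau> *\<^sub>R k) < d" if "0 < \<sigma>" "\<sigma> < s" "0 < \<tau>" "\<tau> < s" for \<sigma> \<tau>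
    proof -
      have "norm (\<sigma> *\<^sub>R h + \<tau> *\<^sub>R k) \<le> \<sigma> * norm h + \<tau> * norm k"
        using norm_triangle_ineq[of "\<sigma> *\<^sub>R h" "\<tau> *\<^sub>R k"] that by simp
      also have "\<dots> \<le> s * norm h + s * norm k"
        using that by (intro add_mono mult_right_mono) auto
      also have "\<dots> < s * (norm h + norm k + 1)"
        using s by (simp add: algebra_simps)
      also have "\<dots> = d"
        unfolding s_def using den by simp
      finally show ?thesis .
    qed
    obtain \<sigma>1 \<tau>1 where 1: "0 < \<sigma>1" "\<sigma>1 < s" "0 < \<tau>1" "\<tau>1 < s"
      "f (a + s *\<^sub>R h + s *\<^sub>R k) - f (a + s *\<^sub>R h) - (f (a + s *\<^sub>R k) - f a) =
        s\<^sup>2 * (H (a + \<sigma>1 *\<^sub>R h + \<tau>1 *\<^sub>R k) k \<bullet> h)"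
      using second_difference_MVT[OF f g s, of a h k] by blast
    obtain \<sigma>2 \<tau>2 where 2: "0 < \<sigma>2" "\<sigma>2 < s" "0 < \<tau>2" "\<tau>2 < s"
      "f (a + s *\<^sub>R k + s *\<^sub>R h) - f (a + s *\<^sub>R k) - (f (a + s *\<^sub>R h) - f a) =
        s\<^sup>2 * (H (a + \<sigma>2 *\<^sub>R k + \<tau>2 *\<^sub>R h) h \<bullet> k)"
      using second_difference_MVT[OF f g s, of a k h] by blast
    have swap: "a + s *\<^sub>R k + s *\<^sub>R h = a + s *\<^sub>R h + s *\<^sub>R k"
      by simp
    have "s\<^sup>2 * (H (a + \<sigma>1 *\<^sub>R h + \<tau>1 *\<^sub>R k) k \<bullet> h) = s\<^sup>2 * (H (a + \<sigma>2 *\<^sub>R k + \<tau>2 *\<^sub>R h) h \<bullet> k)"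
      using 1(5) 2(5) unfolding swap by linarith
    then have "H (a + \<sigma>1 *\<^sub>R h + \<tau>1 *\<^sub>R k) k \<bullet> h = H (a + \<sigma>2 *\<^sub>R k + \<tau>2 *\<^sub>R h) h \<bullet> k"
      using s by simp
    moreover have "\<bar>H (a + \<sigma>1 *\<^sub>R h + \<tau>1 *\<^sub>R k) k \<bullet> h - H a k \<bullet> h\<bar> < e"
      using near[OF 1(1-4)] by (intro d(4)) (simp add: d_def add.assoc)
    moreover have "\<bar>H (a + \<sigma>2 *\<^sub>R k + \<tau>2 *\<^sub>R h) h \<bullet> k - H a h \<bullet> k\<bar> < e"
      using near[OF 2(3,4,1,2)] by (intro d(3)) (simp add: d_def algebra_simps)
    ultimately show ?thesis by linarith
  qed
  \<comment> \<open>With a quarter of the gap as e, the gap is at most half of itself.\<close>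
  from this[of "\<bar>H a h \<bullet> k - H a k \<bullet> h\<bar> / 4"] show ?thesis by (cases "H a h \<bullet> k - H a k \<bullet> h = 0") auto
qed

text \<open>Derivatives in \<open>F0\<close> are relative to the time strip. At fixed t the space
  variable is unrestricted, so the restriction to the slice is a full derivative even at the
  endpoints 0 and T.\<close>

lemma has_derivative_slice:
  fixes f :: "'a::real_normed_vector \<times> 'b::real_normed_vector \<Rightarrow> 'c::real_normed_vector"
  assumes t: "t \<in> S" and f: "(f has_derivative f') (at (t, x) within S \<times> UNIV)"
  shows "((\<lambda>y. f (t, y)) has_derivative (\<lambda>h. f' (0, h))) (at x)"
proof -
  have "((\<lambda>y. (t, y)) has_derivative (\<lambda>h. (0, h))) (at x)"
    by (auto intro!: derivative_eq_intros)
  moreover have "(f has_derivative f') (at (t, x) within range (\<lambda>y. (t, y)))"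
    by (rule has_derivative_subset[OF f]) (use t in auto)
  ultimately show ?thesis
    by (rule has_derivative_in_compose)
qed

text \<open>\<open>gradx\<close> is a definite description and \<open>hessx\<close> a chosen Frechet
  derivative. Both are tied here to blocks of the derivatives D1 and D2 supplied by
  \<open>F0\<close>; later continuity and norm estimates go through D1 and D2.\<close>

lemma F0_derivatives:
  fixes F :: "real \<Rightarrow> 'a::euclidean_space \<Rightarrow> real"
  assumes "F0 T F"
  obtains D1 :: "real \<times> 'a \<Rightarrow> (real \<times> 'a) \<Rightarrow>\<^sub>L real"
    and D2 :: "real \<times> 'a \<Rightarrow> (real \<times> 'a) \<Rightarrow>\<^sub>L ((real \<times> 'a) \<Rightarrow>\<^sub>L real)"
  where
    "\<And>t x. t \<in> {0..T} \<Longrightarrow>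
       ((\<lambda>(t, x). F t x) has_derivative blinfun_apply (D1 (t, x))) (at (t, x) within {0..T} \<times> UNIV)"
    "\<And>t x. t \<in> {0..T} \<Longrightarrow> GDERIV (F t) x :> gradx F t x"
    "\<And>t x h. t \<in> {0..T} \<Longrightarrow> gradx F t x \<bullet> h = blinfun_apply (D1 (t, x)) (0, h)"
    "\<And>t x. t \<in> {0..T} \<Longrightarrow> (gradx F t has_derivative hessx F t x) (at x)"
    "\<And>t x h k. t \<in> {0..T} \<Longrightarrow>
       hessx F t x h \<bullet> k = blinfun_apply (blinfun_apply (D2 (t, x)) (0, h)) (0, k)"
    "continuous_on ({0..T} \<times> UNIV) D1" "continuous_on ({0..T} \<times> UNIV) D2"
proof -
  let ?S = "{0..T} \<times> (UNIV :: 'a set)"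
  obtain D1 D2 where
    D1: "\<And>p. p \<in> ?S \<Longrightarrow> ((\<lambda>(t, x). F t x) has_derivative blinfun_apply (D1 p)) (at p within ?S)"
    and D2: "\<And>p. p \<in> ?S \<Longrightarrow> (D1 has_derivative blinfun_apply (D2 p)) (at p within ?S)"
    and cD2: "continuous_on ?S D2"
    using assms unfolding F0_def C2_on_def by blast
  have cD1: "continuous_on ?S D1"
    using D2 by (meson continuous_on_eq_continuous_within has_derivative_continuous)
  define g where "g t x = (\<Sum>b\<in>Basis. blinfun_apply (D1 (t, x)) (0, b) *\<^sub>R b)" for t and x :: 'a
  \<comment> \<open>Riesz representation in coordinates: it turns the space block of D1 into a
    gradient vector, and that of D2 into an endomorphism.\<close>
  have repr: "(\<Sum>b\<in>Basis. l b *\<^sub>R b) \<bullet> h = l h" if "linear l" for l :: "'a \<Rightarrow> real" and h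
  proof -
    have "l h = l (\<Sum>b\<in>Basis. (h \<bullet> b) *\<^sub>R b)"
      by (simp add: euclidean_representation)
    also have "\<dots> = (\<Sum>b\<in>Basis. (h \<bullet> b) * l b)"
      using that by (simp add: linear_sum linear_cmul)
    finally show ?thesis
      unfolding inner_sum_left inner_scaleR_left by (simp add: inner_commute mult.commute)
  qed
  have lin0: "linear (\<lambda>h. blinfun_apply L (0, h))" for L :: "(real \<times> 'a) \<Rightarrow>\<^sub>L real"
    by (intro bounded_linear.linear bounded_linear_intros)
  have gi: "g t x \<bullet> h = blinfun_apply (D1 (t, x)) (0, h)" for t x h
    unfolding g_def by (rule repr[OF lin0])
  have G: "GDERIV (F t) x :> g t x" if "t \<in> {0..T}" for t x
    using has_derivative_slice[OF that D1, of x] that unfolding gderiv_def inner_commute[of _ "g t x"] gi by simp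
  have grad: "gradx F t x = g t x" if t: "t \<in> {0..T}" for t x
  proof -
    have "D = g t x" if "GDERIV (F t) x :> D" for D
    proof -
      have "(\<lambda>h. h \<bullet> D) = (\<lambda>h. h \<bullet> g t x)"
        using that G[OF t, of x] unfolding gderiv_def by (rule has_derivative_unique)
      then show ?thesis by (metis vector_eq_ldot)
    qed
    then show ?thesis unfolding gradx_def using G[OF t] by blast
  qed
  define A where "A t x h = (\<Sum>b\<in>Basis. blinfun_apply (blinfun_apply (D2 (t, x)) (0, h)) (0, b) *\<^sub>R b)" for t and x h :: 'a
  have A: "(gradx F t has_derivative A t x) (at x)" if t: "t \<in> {0..T}" for t x
  proof -
    have "((\<lambda>y. D1 (t, y)) has_derivative (\<lambda>h. D2 (t, x) (0, h))) (at x)"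
      using has_derivative_slice[OF t D2, of x] t by simp
    then have "((\<lambda>y. blinfun_apply (D1 (t, y)) (0, b)) has_derivative (\<lambda>h. blinfun_apply (D2 (t, x) (0, h)) (0, b))) (at x)" for b
      by (rule bounded_linear.has_derivative[OF blinfun.bounded_linear_left])
    then have "(g t has_derivative A t x) (at x)"
      unfolding g_def A_def by (intro has_derivative_sum has_derivative_scaleR_left)
    moreover have "gradx F t = g t" using grad[OF t] by blast
    ultimately show ?thesis by simp
  qed
  have H: "hessx F t x = A t x" if t: "t \<in> {0..T}" for t x
    unfolding hessx_def using frechet_derivative_at[OF A[OF t]] by simp
  show thesis
  proof (rule that[of D1 D2])
    fix t x h k assume t: "t \<in> {0..T}"
    show "hessx F t x h \<bullet> k = blinfun_apply (blinfun_apply (D2 (t, x)) (0, h)) (0, k)"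
      unfolding H[OF t] A_def by (rule repr[OF lin0])
  qed (use D1 G A H cD1 cD2 in \<open>auto simp: grad gi\<close>)
qed


section \<open>Estimates for gradient and Hessian, uniform in time\<close>

lemma gradx_hessx_derivative:
  fixes F :: "real \<Rightarrow> 'a::euclidean_space \<Rightarrow> real"
  assumes "F0 T F" "t \<in> {0..T}"
  shows "GDERIV (F t) x :> gradx F t x" "(gradx F t has_derivative hessx F t x) (at x)"
  by (rule F0_derivatives[OF assms(1)]; use assms(2) in blast)+

lemma continuous_on_gradx:
  fixes F :: "real \<Rightarrow> 'a::euclidean_space \<Rightarrow> real"
  assumes "F0 T F"
  shows "continuous_on ({0..T} \<times> UNIV) (\<lambda>(t, x). gradx F t x)"
proof -
  obtain D1 :: "real \<times> 'a \<Rightarrow> (real \<times> 'a) \<Rightarrow>\<^sub>L real" where D: "\<And>t x h. t \<in> {0..T} \<Longrightarrow> gradx F t x \<bullet> h = blinfun_apply (D1 (t, x)) (0, h)"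
    "continuous_on ({0..T} \<times> UNIV) D1"
    by (rule F0_derivatives[OF assms]) blast
  have "continuous_on ({0..T} \<times> UNIV) (\<lambda>p. \<Sum>b\<in>Basis. blinfun_apply (D1 p) (0, b) *\<^sub>R b :: 'a)"
    by (intro continuous_intros D(2))
  then show ?thesis
    by (rule continuous_on_eq) (auto simp: D(1)[symmetric] euclidean_representation)
qed

lemma hessx_bounds:
  fixes F :: "real \<Rightarrow> 'a::euclidean_space \<Rightarrow> real"
  assumes "F0 T F"
  obtains D2 :: "real \<times> 'a \<Rightarrow> (real \<times> 'a) \<Rightarrow>\<^sub>L ((real \<times> 'a) \<Rightarrow>\<^sub>L real)"
  where "continuous_on ({0..T} \<times> UNIV) D2"
    "\<And>t x h. t \<in> {0..T} \<Longrightarrow> norm (hessx F t x h) \<le> norm (D2 (t, x)) * norm h"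
    "\<And>s t x y h. s \<in> {0..T} \<Longrightarrow> t \<in> {0..T} \<Longrightarrow>
       norm (hessx F t x h - hessx F s y h) \<le> norm (D2 (t, x) - D2 (s, y)) * norm h"
    "\<And>h. continuous_on ({0..T} \<times> UNIV) (\<lambda>p. hessx F (fst p) (snd p) h)"
    "continuous_on ({0..T} \<times> UNIV) (\<lambda>p. hessx F (fst p) 0 (snd p))"
proof -
  obtain D2 :: "real \<times> 'a \<Rightarrow> (real \<times> 'a) \<Rightarrow>\<^sub>L ((real \<times> 'a) \<Rightarrow>\<^sub>L real)" where
    D: "\<And>t x h k. t \<in> {0..T} \<Longrightarrow>
       hessx F t x h \<bullet> k = blinfun_apply (blinfun_apply (D2 (t, x)) (0, h)) (0, k)"
    "continuous_on ({0..T} \<times> UNIV) D2"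
    by (rule F0_derivatives[OF assms]) blast
  \<comment> \<open>Test with k = v and cancel one factor \<open>norm v\<close>. As D is arbitrary,
    this also covers differences of two Hessians.\<close>
  have bound: "norm v \<le> norm D * norm h"
    if v: "\<And>k. v \<bullet> k = blinfun_apply (blinfun_apply D (0, h)) (0, k)"
    for v h :: 'a and D :: "(real \<times> 'a) \<Rightarrow>\<^sub>L ((real \<times> 'a) \<Rightarrow>\<^sub>L real)"
  proof -
    have "norm v * norm v = v \<bullet> v"
      by (simp add: dot_square_norm power2_eq_square)
    also have "\<dots> = blinfun_apply (blinfun_apply D (0, h)) (0, v)"
      by (rule v)
    also have "\<dots> \<le> norm (blinfun_apply D (0, h)) * norm (0::real, v)"
      using norm_blinfun[of "blinfun_apply D (0, h)" "(0, v)"] by simp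
    also have "\<dots> \<le> norm D * norm (0::real, h) * norm (0::real, v)"
      by (intro mult_right_mono norm_blinfun) auto
    finally have "norm v * norm v \<le> (norm D * norm h) * norm v"
      by (simp add: norm_Pair)
    then show ?thesis
      by (cases "v = 0") auto
  qed
  have repr: "hessx F t x h = (\<Sum>b\<in>Basis. blinfun_apply (blinfun_apply (D2 (t, x)) (0, h)) (0, b) *\<^sub>R b)"
    if "t \<in> {0..T}" for t x h
    using that by (simp add: D(1)[symmetric] euclidean_representation)
  show thesis
  proof (rule that[of D2])
    fix t x h assume "t \<in> {0..T}"
    then show "norm (hessx F t x h) \<le> norm (D2 (t, x)) * norm h"
      by (intro bound D(1))
  next
    fix s t x y h assume "s \<in> {0..T}" "t \<in> {0..T}"
    then show "norm (hessx F t x h - hessx F s y h) \<le> norm (D2 (t, x) - D2 (s, y)) * norm h"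
      by (intro bound) (simp add: D(1) inner_diff_left blinfun.diff_left)
  next
    fix h
    have "continuous_on ({0..T} \<times> UNIV)
      (\<lambda>p. \<Sum>b\<in>Basis. blinfun_apply (blinfun_apply (D2 p) (0, h)) (0, b) *\<^sub>R b :: 'a)"
      by (intro continuous_intros D(2))
    then show "continuous_on ({0..T} \<times> UNIV) (\<lambda>p. hessx F (fst p) (snd p) h)"
      by (rule continuous_on_eq) (auto simp: repr)
  next
    have "continuous_on ({0..T} \<times> UNIV) (\<lambda>p. D2 (fst p, 0::'a))"
      by (rule continuous_on_compose2[OF D(2)]) (auto intro!: continuous_intros)
    then have "continuous_on ({0..T} \<times> UNIV)
      (\<lambda>p. \<Sum>b\<in>Basis. blinfun_apply (blinfun_apply (D2 (fst p, 0::'a)) (0, snd p)) (0, b) *\<^sub>R b :: 'a)"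
      by (intro continuous_intros)
    then show "continuous_on ({0..T} \<times> UNIV) (\<lambda>p. hessx F (fst p) 0 (snd p))"
      by (rule continuous_on_eq) (auto simp: repr)
  qed (rule D(2))
qed

text \<open>Self-adjointness is obtained from \<open>F0\<close> through Schwarz's theorem; the whole
  spectral part rests on it.\<close>

lemma hessx_symmetric:
  fixes F :: "real \<Rightarrow> 'a::euclidean_space \<Rightarrow> real"
  assumes "F0 T F" "t \<in> {0..T}"
  shows "linear (hessx F t x)" "hessx F t x h \<bullet> k = hessx F t x k \<bullet> h"
proof -
  note D = gradx_hessx_derivative[OF assms]
  show "linear (hessx F t x)"
    using D(2) by (rule has_derivative_linear)
  have "continuous_on ({0..T} \<times> UNIV) (\<lambda>p. hessx F (fst p) (snd p) h)" for h
    by (rule hessx_bounds[OF assms(1)])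
  then have "continuous_on UNIV (\<lambda>x. hessx F (fst (t, x)) (snd (t, x)) h)" for h
    by (rule continuous_on_compose2) (use assms(2) in \<open>auto intro!: continuous_intros\<close>)
  then have "isCont (\<lambda>x. hessx F t x h) x" for h
    by (simp add: continuous_on_eq_continuous_at)
  then show "hessx F t x h \<bullet> k = hessx F t x k \<bullet> h"
    using D by (intro second_derivative_symmetric[of "F t" "gradx F t"])
      (simp_all add: gderiv_def inner_commute)
qed

text \<open>Mean value inequality on a convex ball, with D2 bounded on a compact set, so that L does
  not depend on t. It feeds the Gronwall comparison of rescaled solutions.\<close>

lemma gradx_lipschitz_on_balls:
  fixes F :: "real \<Rightarrow> 'a::euclidean_space \<Rightarrow> real"
  assumes "F0 T F"
  obtains L where "L \<ge> 0" "\<And>t x y. t \<in> {0..T} \<Longrightarrow> norm x \<le> R \<Longrightarrow> norm y \<le> R \<Longrightarrow>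
    norm (gradx F t x - gradx F t y) \<le> L * norm (x - y)"
proof -
  obtain D2 :: "real \<times> 'a \<Rightarrow> (real \<times> 'a) \<Rightarrow>\<^sub>L ((real \<times> 'a) \<Rightarrow>\<^sub>L real)" where D2: "continuous_on ({0..T} \<times> UNIV) D2"
    "\<And>t x h. t \<in> {0..T} \<Longrightarrow> norm (hessx F t x h) \<le> norm (D2 (t, x)) * norm h"
    by (rule hessx_bounds[OF assms]) blast
  have "compact (D2 ` ({0..T} \<times> cball 0 R))"
    by (intro compact_continuous_image continuous_on_subset[OF D2(1)] compact_Times) auto
  then obtain B where B: "B > 0" "\<And>t x. t \<in> {0..T} \<Longrightarrow> norm x \<le> R \<Longrightarrow> norm (D2 (t, x)) \<le> B"
    by (force dest!: compact_imp_bounded simp: bounded_pos)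
  show thesis
  proof (rule that[of B])
    fix t and x y :: 'a assume t: "t \<in> {0..T}" and "norm x \<le> R" "norm y \<le> R"
    moreover note gradx_hessx_derivative(2)[OF assms t]
    moreover have "onorm (hessx F t x) \<le> B" if "x \<in> cball 0 R" for x
    proof (rule onorm_le)
      fix h
      have "norm (hessx F t x h) \<le> norm (D2 (t, x)) * norm h"
        by (rule D2(2)[OF t])
      also have "\<dots> \<le> B * norm h"
        using t that by (intro mult_right_mono B(2)) auto
      finally show "norm (hessx F t x h) \<le> B * norm h" .
    qed
    ultimately show "norm (gradx F t x - gradx F t y) \<le> B * norm (x - y)"
      by (intro differentiable_bound[where S = "cball 0 R" and f' = "hessx F t"])
        (auto intro: has_derivative_at_withinI)
  qed (use B in auto)
qed

text \<open>Serves both the remainder near 0 and the continuity of \<open>lambda1\<close> in time.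
  The bound \<open>d \<le> 1\<close> keeps points within d of 0 inside the unit ball, where the
  estimate is valid.\<close>

lemma hessx_uniformly_continuous:
  fixes F :: "real \<Rightarrow> 'a::euclidean_space \<Rightarrow> real"
  assumes "F0 T F" "e > 0"
  obtains d where "d > 0" "d \<le> 1"
    "\<And>s t x y h. s \<in> {0..T} \<Longrightarrow> t \<in> {0..T} \<Longrightarrow> norm x \<le> 1 \<Longrightarrow> norm y \<le> 1 \<Longrightarrow>
       dist (t, x) (s, y) < d \<Longrightarrow> norm (hessx F t x h - hessx F s y h) \<le> e * norm h"
proof -
  obtain D2 :: "real \<times> 'a \<Rightarrow> (real \<times> 'a) \<Rightarrow>\<^sub>L ((real \<times> 'a) \<Rightarrow>\<^sub>L real)" where D2: "continuous_on ({0..T} \<times> UNIV) D2"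
    "\<And>s t x y h. s \<in> {0..T} \<Longrightarrow> t \<in> {0..T} \<Longrightarrow>
       norm (hessx F t x h - hessx F s y h) \<le> norm (D2 (t, x) - D2 (s, y)) * norm h"
    by (rule hessx_bounds[OF assms(1)]) blast
  have "uniformly_continuous_on ({0..T} \<times> cball 0 1) D2"
    by (intro compact_uniformly_continuous continuous_on_subset[OF D2(1)] compact_Times) auto
  then obtain d where d: "d > 0" "\<And>p q. p \<in> {0..T} \<times> cball 0 1 \<Longrightarrow> q \<in> {0..T} \<times> cball 0 1 \<Longrightarrow>
      dist q p < d \<Longrightarrow> dist (D2 q) (D2 p) < e"
    using assms(2) by (elim uniformly_continuous_onE) blast+
  show thesis
  proof (rule that[of "min d 1"])
    fix s t and x y h :: 'a
    assume *: "s \<in> {0..T}" "t \<in> {0..T}" "norm x \<le> 1" "norm y \<le> 1" "dist (t, x) (s, y) < min d 1"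
    then have "norm (D2 (t, x) - D2 (s, y)) \<le> e"
      using d(2)[of "(s, y)" "(t, x)"] by (simp add: dist_norm)
    then have "norm (D2 (t, x) - D2 (s, y)) * norm h \<le> e * norm h"
      by (rule mult_right_mono) auto
    with D2(2)[OF *(1,2), of x h y] show "norm (hessx F t x h - hessx F s y h) \<le> e * norm h"
      by (rule order_trans)
  qed (use d in auto)
qed

text \<open>Mean value inequality for \<open>gradx F t\<close> minus its linear part at 0: the
  derivative of this difference is the variation of the Hessian, which is at most \<eta> on a small
  ball.\<close>

lemma gradx_remainder:
  fixes F :: "real \<Rightarrow> 'a::euclidean_space \<Rightarrow> real"
  assumes "F0 T F" "\<eta> > 0"
  obtains \<delta> where "\<delta> > 0" "\<And>t x. t \<in> {0..T} \<Longrightarrow> norm x \<le> \<delta> \<Longrightarrow>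
    norm (gradx F t x - gradx F t 0 - hessx F t 0 x) \<le> \<eta> * norm x"
proof -
  obtain d where d: "d > 0" "d \<le> 1"
    "\<And>s t x y h. s \<in> {0..T} \<Longrightarrow> t \<in> {0..T} \<Longrightarrow> norm x \<le> 1 \<Longrightarrow> norm y \<le> 1 \<Longrightarrow>
       dist (t, x) (s, y) < d \<Longrightarrow> norm (hessx F t x h - hessx F s y h) \<le> \<eta> * norm h"
    using hessx_uniformly_continuous[OF assms] by blast
  show thesis
  proof (rule that[of "d / 2"])
    fix t and x :: 'a assume t: "t \<in> {0..T}" and x: "norm x \<le> d / 2"
    note der = gradx_hessx_derivative(2)[OF assms(1) t]
    have "bounded_linear (hessx F t 0)"
      using der by (rule has_derivative_bounded_linear)
    then have "((\<lambda>y. gradx F t y - hessx F t 0 y) has_derivative (\<lambda>h. hessx F t y h - hessx F t 0 h))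
      (at y within cball 0 (d / 2))" for y
      by (intro has_derivative_diff has_derivative_at_withinI[OF der] bounded_linear_imp_has_derivative)
    moreover have "onorm (\<lambda>h. hessx F t y h - hessx F t 0 h) \<le> \<eta>" if "y \<in> cball 0 (d / 2)" for y
      by (rule onorm_le) (use that d t in \<open>auto intro!: d(3) simp: dist_Pair_Pair\<close>)
    ultimately have "norm (gradx F t x - hessx F t 0 x - (gradx F t 0 - hessx F t 0 0)) \<le> \<eta> * norm (x - 0)"
      using x d(1) by (intro differentiable_bound[where S = "cball 0 (d / 2)"
        and f' = "\<lambda>y h. hessx F t y h - hessx F t 0 h"]) auto
    moreover have "hessx F t 0 0 = 0"
      by (rule linear_0[OF hessx_symmetric(1)[OF assms(1) t]])
    ultimately show "norm (gradx F t x - gradx F t 0 - hessx F t 0 x) \<le> \<eta> * norm x"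
      by (simp add: algebra_simps)
  qed (use d in auto)
qed

lemma energy_derivative:
  fixes F :: "real \<Rightarrow> 'a::euclidean_space \<Rightarrow> real"
  assumes "F0 T F" "T > 0" "t \<in> {0..T}"
    and u: "(u has_vector_derivative u') (at t within {0..T})"
  shows "((\<lambda>t. F t (u t)) has_real_derivative partial_t T F t (u t) + gradx F t (u t) \<bullet> u')
    (at t within {0..T})"
proof -
  obtain D1 :: "real \<times> 'a \<Rightarrow> (real \<times> 'a) \<Rightarrow>\<^sub>L real" where
    D1: "\<And>x. ((\<lambda>(t, x). F t x) has_derivative blinfun_apply (D1 (t, x))) (at (t, x) within {0..T} \<times> UNIV)"
    "\<And>x h. gradx F t x \<bullet> h = blinfun_apply (D1 (t, x)) (0, h)"
    using assms(3) by (rule_tac F0_derivatives[OF assms(1)]) blast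
  have chain: "((\<lambda>s. F s (v s)) has_vector_derivative D1 (t, v t) (1, v')) (at t within {0..T})"
    if v: "(v has_vector_derivative v') (at t within {0..T})" for v v'
  proof -
    have "((\<lambda>s. (s, v s)) has_derivative (\<lambda>d. (d, d *\<^sub>R v'))) (at t within {0..T})"
      using v unfolding has_vector_derivative_def by (auto intro!: derivative_eq_intros)
    moreover have "((\<lambda>(t, x). F t x) has_derivative blinfun_apply (D1 (t, v t)))
        (at (t, v t) within (\<lambda>s. (s, v s)) ` {0..T})"
      by (rule has_derivative_subset[OF D1(1)]) auto
    ultimately have "((\<lambda>s. F s (v s)) has_derivative (\<lambda>d. D1 (t, v t) (d, d *\<^sub>R v'))) (at t within {0..T})"
      using has_derivative_in_compose by fastforce
    moreover have "(d, d *\<^sub>R v') = d *\<^sub>R (1, v')" for d :: real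
      by simp
    ultimately show ?thesis
      unfolding has_vector_derivative_def by (simp add: blinfun.scaleR_right del: scaleR_Pair)
  qed
  \<comment> \<open>The chain rule along a constant curve isolates the time block of D1 and so
    identifies it with \<open>partial_t\<close>.\<close>
  have "((\<lambda>s. F s (u t)) has_vector_derivative D1 (t, u t) (1, 0)) (at t within {0..T})"
    by (rule chain[where v = "\<lambda>_. u t"]) (auto intro!: derivative_eq_intros)
  then have p: "partial_t T F t (u t) = D1 (t, u t) (1, 0)"
    using vector_derivative_within_cbox[of 0 T t] assms(2,3) unfolding partial_t_def by simp
  have "D1 (t, u t) (1, u') = D1 (t, u t) (1, 0) + D1 (t, u t) (0, u')"
    by (simp flip: blinfun.add_right)
  then show ?thesis
    using chain[OF u] by (simp add: p D1(2) has_real_derivative_iff_has_vector_derivative)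
qed

subsection \<open>The lowest eigenvalue\<close>

text \<open>Moving from v to v - s B v changes the form by -2 s |B v|^2 plus a term quadratic in s.
  This is negative for small s unless B v = 0.\<close>

lemma psd_form_zero:
  fixes B :: "'a::real_inner \<Rightarrow> 'a"
  assumes lin: "linear B" and sym: "\<And>x y. B x \<bullet> y = B y \<bullet> x"
    and psd: "\<And>x. B x \<bullet> x \<ge> 0" and v: "B v \<bullet> v = 0"
  shows "B v = 0"
proof (rule ccontr)
  assume nz: "B v \<noteq> 0"
  define w where "w = B v"
  define c where "c = B w \<bullet> w"
  \<comment> \<open>Chosen so that s c < |w|^2, which lets the linear term win; the summand 1 covers
    c = 0.\<close>
  define s where "s = (w \<bullet> w) / (c + 1)"
  have c: "c \<ge> 0" unfolding c_def by (rule psd)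
  have w: "w \<bullet> w > 0" using nz by (simp add: w_def)
  have s: "s > 0" using c w by (simp add: s_def)
  have "0 \<le> B (v - s *\<^sub>R w) \<bullet> (v - s *\<^sub>R w)" by (rule psd)
  also have "\<dots> = B v \<bullet> v - s * (B v \<bullet> w) - s * (B w \<bullet> v) + s * s * (B w \<bullet> w)"
    by (simp add: linear_diff[OF lin] linear_cmul[OF lin] inner_diff_left inner_diff_right algebra_simps)
  also have "B w \<bullet> v = w \<bullet> w" unfolding w_def by (rule sym)
  finally have "0 \<le> s * (s * c - 2 * (w \<bullet> w))"
    by (simp add: v[folded w_def] w_def[symmetric] c_def[symmetric] algebra_simps)
  then have "2 * (w \<bullet> w) \<le> s * c" using s by (simp add: zero_le_mult_iff)
  also have "\<dots> \<le> s * (c + 1)" using s by simp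
  also have "\<dots> = w \<bullet> w" using c by (simp add: s_def)
  finally show False using w by simp
qed

text \<open>The form of A - m is semidefinite and vanishes at v, so \<open>psd_form_zero\<close>
  applies; this takes the place of Lagrange multipliers.\<close>

lemma rayleigh_eigenvector:
  fixes A :: "'a::real_inner \<Rightarrow> 'a"
  assumes lin: "linear A" and sym: "\<And>x y. A x \<bullet> y = A y \<bullet> x"
    and low: "\<And>x. m * (norm x)\<^sup>2 \<le> A x \<bullet> x" and v: "A v \<bullet> v = m * (norm v)\<^sup>2"
  shows "A v = m *\<^sub>R v"
proof -
  have "(\<lambda>x. A x - m *\<^sub>R x) v = 0"
  proof (rule psd_form_zero[where B = "\<lambda>x. A x - m *\<^sub>R x" and v = v])
    show "linear (\<lambda>x. A x - m *\<^sub>R x)"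
      using lin by (intro linear_compose_sub linear_scaleR)
  qed (use sym low v in \<open>auto simp: inner_diff_left inner_diff_right inner_commute power2_norm_eq_inner\<close>)
  then show ?thesis by simp
qed

text \<open>Makes \<open>Min\<close> in \<open>lambda1\<close> meaningful. Eigenvectors for distinct
  eigenvalues are orthogonal, hence independent.\<close>

lemma finite_eigenvalues:
  fixes A :: "'a::euclidean_space \<Rightarrow> 'a"
  assumes sym: "\<And>x y. A x \<bullet> y = A y \<bullet> x"
  shows "finite (eigenvalues A)"
proof -
  have "\<forall>\<mu>\<in>eigenvalues A. \<exists>x. A x = \<mu> *\<^sub>R x \<and> x \<noteq> 0"
    by (auto simp: eigenvalues_def eigenspace_def)
  from bchoice[OF this] obtain v where
    v: "\<And>\<mu>. \<mu> \<in> eigenvalues A \<Longrightarrow> A (v \<mu>) = \<mu> *\<^sub>R v \<mu> \<and> v \<mu> \<noteq> 0"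
    by blast
  have orth: "v \<mu> \<bullet> v \<nu> = 0" if "\<mu> \<in> eigenvalues A" "\<nu> \<in> eigenvalues A" "\<mu> \<noteq> \<nu>" for \<mu> \<nu>
  proof -
    have "\<mu> * (v \<mu> \<bullet> v \<nu>) = \<nu> * (v \<mu> \<bullet> v \<nu>)"
      using sym[of "v \<mu>" "v \<nu>"] v[OF that(1)] v[OF that(2)] by (simp add: inner_commute)
    with that(3) show ?thesis by simp
  qed
  have "pairwise orthogonal (v ` eigenvalues A)"
    using orth by (auto simp: pairwise_def orthogonal_def)
  then have "finite (v ` eigenvalues A)"
    using v by (intro independent_imp_finite pairwise_orthogonal_independent) auto
  moreover have "inj_on v (eigenvalues A)"
  proof (rule inj_onI, rule ccontr)
    fix \<mu> \<nu> assume *: "\<mu> \<in> eigenvalues A" "\<nu> \<in> eigenvalues A" "v \<mu> = v \<nu>" "\<mu> \<noteq> \<nu>"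
    with orth[OF *(1,2,4)] v[OF *(1)] show False by simp
  qed
  ultimately show ?thesis by (rule finite_imageD)
qed

text \<open>The minimum m of the form on the unit sphere is itself an eigenvalue, so the least
  eigenvalue is at most m; this inequality suffices for the lower bound.\<close>

lemma min_eigenvalue_rayleigh:
  fixes A :: "'a::euclidean_space \<Rightarrow> 'a"
  assumes lin: "linear A" and sym: "\<And>x y. A x \<bullet> y = A y \<bullet> x"
  shows "Min (eigenvalues A) \<in> eigenvalues A" "Min (eigenvalues A) * (norm x)\<^sup>2 \<le> A x \<bullet> x"
proof -
  have "continuous_on (sphere 0 1) (\<lambda>x. A x \<bullet> x)"
    by (intro continuous_intros linear_continuous_on linear_conv_bounded_linear[THEN iffD1] lin)
  moreover have "sphere (0::'a) 1 \<noteq> {}" by simp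
  ultimately obtain v where v: "norm v = 1" "\<And>y. norm y = 1 \<Longrightarrow> A v \<bullet> v \<le> A y \<bullet> y"
    using continuous_attains_inf[of "sphere (0::'a) 1" "\<lambda>x. A x \<bullet> x"] by auto
  define m where "m = A v \<bullet> v"
  have low: "m * (norm y)\<^sup>2 \<le> A y \<bullet> y" for y
  proof (cases "y = 0")
    case False
    have "m \<le> A ((1 / norm y) *\<^sub>R y) \<bullet> ((1 / norm y) *\<^sub>R y)"
      unfolding m_def using False by (intro v(2)) simp
    also have "\<dots> = (A y \<bullet> y) / (norm y)\<^sup>2"
      by (simp add: linear_cmul[OF lin] power2_eq_square)
    finally show ?thesis using False by (simp add: field_simps)
  qed (simp add: linear_0[OF lin])
  have "A v = m *\<^sub>R v"
    by (rule rayleigh_eigenvector[OF lin sym low]) (simp add: m_def v(1))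
  then have "m \<in> eigenvalues A"
    using v(1) unfolding eigenvalues_def eigenspace_def by force
  moreover have fin: "finite (eigenvalues A)" by (rule finite_eigenvalues[OF sym])
  ultimately show "Min (eigenvalues A) \<in> eigenvalues A" by (intro Min_in) auto
  have "Min (eigenvalues A) \<le> m" using fin \<open>m \<in> eigenvalues A\<close> by simp
  then have "Min (eigenvalues A) * (norm x)\<^sup>2 \<le> m * (norm x)\<^sup>2" by (rule mult_right_mono) simp
  also note low
  finally show "Min (eigenvalues A) * (norm x)\<^sup>2 \<le> A x \<bullet> x" .
qed

text \<open>Compactness in (t, z) yields one gap for all times. It is positive because a unit vector
  orthogonal to e with Rayleigh quotient \<open>l t\<close> would be a lowest eigenvector, hence a
  multiple of e.\<close>

lemma spectral_gap:
  fixes A :: "real \<Rightarrow> 'a::euclidean_space \<Rightarrow> 'a"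
  assumes "compact I"
    and lin: "\<And>t. t \<in> I \<Longrightarrow> linear (A t)" and sym: "\<And>t x y. t \<in> I \<Longrightarrow> A t x \<bullet> y = A t y \<bullet> x"
    and low: "\<And>t x. t \<in> I \<Longrightarrow> l t * (norm x)\<^sup>2 \<le> A t x \<bullet> x"
    and eig: "\<And>t. t \<in> I \<Longrightarrow> eigenspace (A t) (l t) = span {e}"
    and contA: "continuous_on (I \<times> UNIV) (\<lambda>p. A (fst p) (snd p))" and contl: "continuous_on I l"
  obtains \<gamma> where "\<gamma> > 0" "\<And>t z. t \<in> I \<Longrightarrow> z \<bullet> e = 0 \<Longrightarrow> (l t + \<gamma>) * (norm z)\<^sup>2 \<le> A t z \<bullet> z"
proof -
  let ?S = "I \<times> (sphere 0 1 \<inter> {z. z \<bullet> e = 0})"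
  let ?f = "\<lambda>p. A (fst p) (snd p) \<bullet> snd p - l (fst p)"
  have "\<exists>\<gamma>>0. \<forall>p\<in>?S. \<gamma> \<le> ?f p"
  \<comment> \<open>The set is empty, for example, in dimension one with e nonzero; any positive
    \<gamma> then serves.\<close>
  proof (cases "?S = {}")
    case True
    then show ?thesis by (intro exI[of _ 1]) auto
  next
    case False
    have "closed {z. z \<bullet> e = 0}"
      by (intro closed_Collect_eq continuous_intros)
    then have "compact ?S"
      by (intro compact_Times assms(1) compact_Int_closed) auto
    moreover have "continuous_on ?S ?f"
    proof (intro continuous_intros)
      show "continuous_on ?S (\<lambda>p. A (fst p) (snd p))"
        by (rule continuous_on_subset[OF contA]) auto
      show "continuous_on ?S (\<lambda>p. l (fst p))"
        by (rule continuous_on_compose2[OF contl]) (auto intro!: continuous_intros)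
    qed
    ultimately obtain p where p: "p \<in> ?S" "\<And>q. q \<in> ?S \<Longrightarrow> ?f p \<le> ?f q"
      using continuous_attains_inf[OF _ False] by blast
    obtain t z where tz: "p = (t, z)" "t \<in> I" "norm z = 1" "z \<bullet> e = 0"
      using p(1) by auto
    have "?f p \<ge> 0" using low[OF tz(2), of z] tz by simp
    moreover have "?f p \<noteq> 0"
    proof
      assume "?f p = 0"
      then have "A t z = l t *\<^sub>R z"
        using tz by (intro rayleigh_eigenvector lin sym low) auto
      then have "z \<in> span {e}" using eig[OF tz(2)] by (auto simp: eigenspace_def)
      then obtain c where "z = c *\<^sub>R e" by (auto simp: span_singleton)
      with tz(4) have "z \<bullet> z = 0" by simp
      with tz(3) show False by simp
    qed
    ultimately show ?thesis using p(2) by (intro exI[of _ "?f p"]) auto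
  qed
  then obtain \<gamma> where \<gamma>: "\<gamma> > 0" "\<And>p. p \<in> ?S \<Longrightarrow> \<gamma> \<le> ?f p" by blast
  show thesis
  proof (rule that[OF \<gamma>(1)])
    fix t z assume t: "t \<in> I" and z: "z \<bullet> e = 0"
    show "(l t + \<gamma>) * (norm z)\<^sup>2 \<le> A t z \<bullet> z"
    proof (cases "z = 0")
      case False
      have "\<gamma> \<le> A t ((1 / norm z) *\<^sub>R z) \<bullet> ((1 / norm z) *\<^sub>R z) - l t"
        using \<gamma>(2)[of "(t, (1 / norm z) *\<^sub>R z)"] False t z by simp
      also have "A t ((1 / norm z) *\<^sub>R z) \<bullet> ((1 / norm z) *\<^sub>R z) = (A t z \<bullet> z) / (norm z)\<^sup>2"
        by (simp add: linear_cmul[OF lin[OF t]] power2_eq_square)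
      finally show ?thesis using False by (simp add: field_simps)
    qed (simp add: linear_0[OF lin[OF t]])
  qed
qed

text \<open>Composing p with the transposition of b and c preserves the product, since f agrees at b
  and c, but flips the sign. The sum therefore equals its own negative.\<close>

lemma leibniz_sum_repeated:
  fixes f :: "'a::euclidean_space \<Rightarrow> 'a"
  assumes bc: "b \<in> Basis" "c \<in> Basis" "b \<noteq> c" and eq: "f b = f c"
  shows "(\<Sum>p | p permutes (Basis :: 'a set). of_int (sign p) * (\<Prod>d\<in>Basis. f d \<bullet> p d)) = (0::real)"
proof -
  let ?q = "Transposition.transpose b c"
  have q: "?q permutes (Basis :: 'a set)" using bc by (intro permutes_swap_id)
  have fq: "f (?q d) = f d" for d using eq by (auto simp: Transposition.transpose_def)
  have prod: "(\<Prod>d\<in>Basis. f d \<bullet> p (?q d)) = (\<Prod>d\<in>Basis. f d \<bullet> p d)" for p :: "'a \<Rightarrow> 'a"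
  proof -
    have "(\<Prod>d\<in>Basis. f d \<bullet> p d) = (\<Prod>d\<in>Basis. f (?q d) \<bullet> p (?q d))"
      using prod.permute[OF q, of "\<lambda>d. f d \<bullet> p d"] by (simp add: o_def)
    then show ?thesis by (simp add: fq)
  qed
  have sgn: "sign (p \<circ> ?q) = - sign p" if "p permutes (Basis :: 'a set)" for p
  proof -
    have "permutation p" using that by (rule permutation_permutes[THEN iffD2, OF exI, OF conjI, rotated]) auto
    then show ?thesis
      using bc by (simp add: sign_compose permutation_swap_id sign_swap_id)
  qed
  let ?D = "\<Sum>p | p permutes (Basis :: 'a set). of_int (sign p) * (\<Prod>d\<in>Basis. f d \<bullet> p d) :: real"
  have "?D = (\<Sum>p | p permutes (Basis :: 'a set). of_int (sign (p \<circ> ?q)) * (\<Prod>d\<in>Basis. f d \<bullet> (p \<circ> ?q) d))"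
    by (rule sum_permutations_compose_right[OF q])
  also have "\<dots> = (\<Sum>p | p permutes (Basis :: 'a set). - (of_int (sign p) * (\<Prod>d\<in>Basis. f d \<bullet> p d)))"
    by (intro sum.cong refl) (simp add: sgn prod)
  also have "\<dots> = - ?D" by (rule sum_negf)
  finally show ?thesis by simp
qed

text \<open>A kernel vector with nonzero b-coordinate expresses \<open>A b\<close> through the other
  images; linearity of the Leibniz sum in slot b leaves only sums with a repeated value. The
  contrapositive turns (A2) into the statement that 0 is not an eigenvalue.\<close>

lemma endo_det_eq_0:
  fixes A :: "'a::euclidean_space \<Rightarrow> 'a"
  assumes lin: "linear A" and v: "A v = 0" "v \<noteq> 0"
  shows "endo_det A = 0"
proof -
  obtain b where b: "b \<in> Basis" "v \<bullet> b \<noteq> 0"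
    using v(2) by (metis euclidean_all_zero_iff)
  let ?C = "Basis - {b}"
  define k where "k c = - (v \<bullet> c) / (v \<bullet> b)" for c
  have "0 = A (\<Sum>c\<in>Basis. (v \<bullet> c) *\<^sub>R c)"
    using v(1) by (simp add: euclidean_representation)
  also have "\<dots> = (\<Sum>c\<in>Basis. (v \<bullet> c) *\<^sub>R A c)"
    by (simp add: linear_sum[OF lin] linear_cmul[OF lin])
  also have "\<dots> = (v \<bullet> b) *\<^sub>R A b + (\<Sum>c\<in>?C. (v \<bullet> c) *\<^sub>R A c)"
    using b(1) by (intro sum.remove) auto
  finally have "(v \<bullet> b) *\<^sub>R A b = - (\<Sum>c\<in>?C. (v \<bullet> c) *\<^sub>R A c)"
    by (metis eq_neg_iff_add_eq_0)
  then have "(1 / (v \<bullet> b)) *\<^sub>R ((v \<bullet> b) *\<^sub>R A b) = (1 / (v \<bullet> b)) *\<^sub>R - (\<Sum>c\<in>?C. (v \<bullet> c) *\<^sub>R A c)"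
    by (rule arg_cong)
  then have Ab: "A b = (\<Sum>c\<in>?C. k c *\<^sub>R A c)"
    using b(2) by (simp add: k_def scaleR_sum_right sum_negf divide_inverse mult.commute)
  have "endo_det A = (\<Sum>p | p permutes (Basis :: 'a set). \<Sum>c\<in>?C.
      k c * (of_int (sign p) * (\<Prod>d\<in>Basis. (A(b := A c)) d \<bullet> p d)))"
    unfolding endo_det_def
  proof (intro sum.cong refl)
    fix p :: "'a \<Rightarrow> 'a"
    have split: "(\<Prod>d\<in>Basis. (A(b := y)) d \<bullet> p d) = (y \<bullet> p b) * (\<Prod>d\<in>?C. A d \<bullet> p d)" for y
    proof -
      have "(\<Prod>d\<in>Basis. (A(b := y)) d \<bullet> p d) = ((A(b := y)) b \<bullet> p b) * (\<Prod>d\<in>?C. (A(b := y)) d \<bullet> p d)"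
        using b(1) by (intro prod.remove) auto
      also have "(\<Prod>d\<in>?C. (A(b := y)) d \<bullet> p d) = (\<Prod>d\<in>?C. A d \<bullet> p d)"
        by (intro prod.cong) auto
      finally show ?thesis by simp
    qed
    have "(\<Prod>d\<in>Basis. A d \<bullet> p d) = (A b \<bullet> p b) * (\<Prod>d\<in>?C. A d \<bullet> p d)"
      using b(1) by (intro prod.remove) auto
    also have "A b \<bullet> p b = (\<Sum>c\<in>?C. k c * (A c \<bullet> p b))"
      unfolding Ab by (simp add: inner_sum_left)
    finally have "(\<Prod>d\<in>Basis. A d \<bullet> p d) = (\<Sum>c\<in>?C. k c * (\<Prod>d\<in>Basis. (A(b := A c)) d \<bullet> p d))"
      unfolding split by (simp add: sum_distrib_right mult.assoc)
    then show "of_int (sign p) * (\<Prod>d\<in>Basis. A d \<bullet> p d) =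
        (\<Sum>c\<in>?C. k c * (of_int (sign p) * (\<Prod>d\<in>Basis. (A(b := A c)) d \<bullet> p d)))"
      by (simp add: sum_distrib_left mult.left_commute)
  qed
  also have "\<dots> = (\<Sum>c\<in>?C. k c * (\<Sum>p | p permutes (Basis :: 'a set).
      of_int (sign p) * (\<Prod>d\<in>Basis. (A(b := A c)) d \<bullet> p d)))"
    by (subst sum.swap) (simp add: sum_distrib_left)
  also have "\<dots> = 0"
  proof (intro sum.neutral ballI)
    fix c assume "c \<in> ?C"
    then show "k c * (\<Sum>p | p permutes (Basis :: 'a set).
        of_int (sign p) * (\<Prod>d\<in>Basis. (A(b := A c)) d \<bullet> p d)) = 0"
      using leibniz_sum_repeated[of b c "A(b := A c)"] b(1) by auto
  qed
  finally show ?thesis .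
qed

subsection \<open>Growth and decay of solutions near the trivial branch\<close>

text \<open>\<open>f * exp (- H)\<close> is nonincreasing. No sign of f or h is involved, so the
  lemma applies to -f and to the indefinite function of \<open>cone_invariant\<close>.\<close>

lemma gronwall:
  fixes f H :: "real \<Rightarrow> real"
  assumes ab: "a \<le> b"
    and f: "\<And>t. t \<in> {a..b} \<Longrightarrow> (f has_real_derivative f' t) (at t within {a..b})"
    and H: "\<And>t. t \<in> {a..b} \<Longrightarrow> (H has_real_derivative h t) (at t within {a..b})"
    and le: "\<And>t. t \<in> {a..b} \<Longrightarrow> f' t \<le> h t * f t"
  shows "f b \<le> f a * exp (H b - H a)"
proof (cases "a = b")
  case False
  let ?k = "\<lambda>t. f t * exp (- H t)"
  have k: "(?k has_real_derivative (f' t - h t * f t) * exp (- H t)) (at t within {a..b})"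
    if "t \<in> {a..b}" for t
    by (rule derivative_eq_intros f[OF that] H[OF that] refl)+ (simp add: algebra_simps)
  have "?k b \<le> ?k a"
  proof (rule DERIV_nonpos_imp_decreasing_open[where f = ?k])
    fix t assume t: "a < t" "t < b"
    then have "(?k has_real_derivative (f' t - h t * f t) * exp (- H t)) (at t)"
      using k[of t] by (simp add: at_within_Icc_at)
    moreover have "(f' t - h t * f t) * exp (- H t) \<le> 0"
      using le[of t] t by (intro mult_nonpos_nonneg) auto
    ultimately show "\<exists>y. DERIV ?k t :> y \<and> y \<le> 0" by blast
  next
    show "continuous_on {a..b} ?k"
      using k by (rule DERIV_continuous_on)
  qed (use ab in auto)
  then have "?k b * exp (H b) \<le> ?k a * exp (H b)"
    by (rule mult_right_mono) simp
  then show ?thesis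
    by (simp add: mult.assoc flip: exp_add)
qed simp

lemma gronwall_ge:
  fixes f H :: "real \<Rightarrow> real"
  assumes "a \<le> b"
    and "\<And>t. t \<in> {a..b} \<Longrightarrow> (f has_real_derivative f' t) (at t within {a..b})"
    and "\<And>t. t \<in> {a..b} \<Longrightarrow> (H has_real_derivative h t) (at t within {a..b})"
    and "\<And>t. t \<in> {a..b} \<Longrightarrow> h t * f t \<le> f' t"
  shows "f a * exp (H b - H a) \<le> f b"
  using gronwall[of a b "\<lambda>t. - f t" "\<lambda>t. - f' t" H h] assms
  by (auto intro: DERIV_minus)

text \<open>\<tau> is the least point of a compact level set. The intermediate value theorem makes
  this set nonempty and excludes an earlier time with f at or above \<delta>.\<close>

lemma first_hitting_time:
  fixes f :: "real \<Rightarrow> real"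
  assumes cont: "continuous_on {0..T} f" and "f 0 < \<delta>" "t \<in> {0..T}" "\<delta> \<le> f t"
  obtains \<tau> where "0 < \<tau>" "\<tau> \<le> t" "f \<tau> = \<delta>" "\<And>s. 0 \<le> s \<Longrightarrow> s < \<tau> \<Longrightarrow> f s < \<delta>"
proof -
  have hit: "\<exists>s\<ge>0. s \<le> r \<and> f s = \<delta>" if "0 \<le> r" "r \<le> t" "\<delta> \<le> f r" for r
    by (rule IVT') (use that assms in \<open>auto intro: continuous_on_subset[OF cont]\<close>)
  define Z where "Z = {s \<in> {0..t}. f s = \<delta>}"
  have ct: "continuous_on {0..t} f"
    by (rule continuous_on_subset[OF cont]) (use assms in auto)
  have "closed Z"
    unfolding Z_def by (intro continuous_closed_preimage_constant ct) auto
  moreover have "bounded Z"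
    by (rule bounded_subset[OF bounded_closed_interval[of 0 t]]) (auto simp: Z_def)
  ultimately have "compact Z"
    by (simp add: compact_eq_bounded_closed)
  moreover have "Z \<noteq> {}"
    using hit[of t] assms by (auto simp: Z_def)
  ultimately obtain \<tau> where \<tau>: "\<tau> \<in> Z" "\<And>s. s \<in> Z \<Longrightarrow> \<tau> \<le> s"
    using compact_attains_inf[of Z] by blast
  show thesis
  proof (rule that[of \<tau>])
    show "0 < \<tau>"
      using \<tau>(1) assms(2) by (cases "\<tau> = 0") (auto simp: Z_def)
    fix s assume s: "0 \<le> s" "s < \<tau>"
    show "f s < \<delta>"
    proof (rule ccontr)
      assume "\<not> f s < \<delta>"
      then obtain r where "0 \<le> r" "r \<le> s" "f r = \<delta>"
        using hit[of s] s \<tau>(1) by (auto simp: Z_def)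
      moreover from this have "r \<in> Z"
        using s \<tau>(1) by (simp add: Z_def)
      ultimately show False
        using \<tau>(2)[of r] s(2) by simp
    qed
  qed (use \<tau> in \<open>auto simp: Z_def\<close>)
qed

text \<open>Two time ranges matter: the Rayleigh bound holds on all of {0..T}, whereas the fixed
  eigenvector and the gap come from (A1) and hold up to S, which will be \<open>t_star\<close> plus
  \<rho>.\<close>

locale linearized_flow =
  fixes g A :: "real \<Rightarrow> 'a::euclidean_space \<Rightarrow> 'a"
    and l G :: "real \<Rightarrow> real" and e :: 'a and T S \<gamma> :: real
  assumes S: "0 < S" "S \<le> T"
    and A_linear: "\<And>t. t \<in> {0..T} \<Longrightarrow> linear (A t)"
    and A_sym: "\<And>t x y. t \<in> {0..T} \<Longrightarrow> A t x \<bullet> y = A t y \<bullet> x"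
    and A_low: "\<And>t x. t \<in> {0..T} \<Longrightarrow> l t * (norm x)\<^sup>2 \<le> A t x \<bullet> x"
    and e: "norm e = 1" "\<And>t. t \<in> {0..S} \<Longrightarrow> A t e = l t *\<^sub>R e"
    and gap: "\<gamma> > 0" "\<And>t z. t \<in> {0..S} \<Longrightarrow> z \<bullet> e = 0 \<Longrightarrow> (l t + \<gamma>) * (norm z)\<^sup>2 \<le> A t z \<bullet> z"
    and G_deriv: "\<And>t. t \<in> {0..T} \<Longrightarrow> (G has_real_derivative l t) (at t within {0..T})"
    and G_0: "G 0 = 0"
begin

text \<open>Kept as a relation between \<eta> and \<delta> because one solution is estimated with
  two such pairs, on different time intervals.\<close>

definition remainder_le :: "real \<Rightarrow> real \<Rightarrow> bool" where
  "remainder_le \<eta> \<delta> \<longleftrightarrow>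
     \<eta> > 0 \<and> \<delta> > 0 \<and> (\<forall>t\<in>{0..T}. \<forall>x. norm x \<le> \<delta> \<longrightarrow> norm (g t x - A t x) \<le> \<eta> * norm x)"

definition flow :: "real \<Rightarrow> (real \<Rightarrow> 'a) \<Rightarrow> bool" where
  "flow \<epsilon> u \<longleftrightarrow> \<epsilon> > 0 \<and>
     (\<forall>t\<in>{0..T}. (u has_vector_derivative - (1 / \<epsilon>) *\<^sub>R g t (u t)) (at t within {0..T}))"

lemma remainder_inner:
  assumes "remainder_le \<eta> \<delta>" "t \<in> {0..T}" "norm x \<le> \<delta>"
  shows "\<bar>(g t x - A t x) \<bullet> y\<bar> \<le> \<eta> * norm x * norm y"
proof -
  have "\<bar>(g t x - A t x) \<bullet> y\<bar> \<le> norm (g t x - A t x) * norm y"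
    by (rule Cauchy_Schwarz_ineq2)
  also have "\<dots> \<le> (\<eta> * norm x) * norm y"
    using assms unfolding remainder_le_def by (intro mult_right_mono) auto
  finally show ?thesis .
qed

lemma G_deriv_within:
  assumes "0 \<le> a" "b \<le> T" "t \<in> {a..b}"
  shows "(G has_real_derivative l t) (at t within {a..b})"
  using G_deriv[of t] by (rule DERIV_subset) (use assms in auto)

lemma flow_continuous:
  assumes "flow \<epsilon> u"
  shows "continuous_on {0..T} u"
  using assms unfolding flow_def
  by (meson continuous_on_eq_continuous_within has_vector_derivative_continuous)

lemma flow_derivs:
  assumes u: "flow \<epsilon> u" and ab: "0 \<le> a" "b \<le> T" "t \<in> {a..b}"
  shows "((\<lambda>t. (norm (u t))\<^sup>2) has_real_derivative - (2 / \<epsilon>) * (g t (u t) \<bullet> u t)) (at t within {a..b})"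
    "((\<lambda>t. (u t \<bullet> e)\<^sup>2) has_real_derivative - (2 / \<epsilon>) * ((u t \<bullet> e) * (g t (u t) \<bullet> e))) (at t within {a..b})"
proof -
  have "(u has_vector_derivative - (1 / \<epsilon>) *\<^sub>R g t (u t)) (at t within {0..T})"
    using u ab unfolding flow_def by auto
  then have d: "(u has_vector_derivative - (1 / \<epsilon>) *\<^sub>R g t (u t)) (at t within {a..b})"
    by (rule has_vector_derivative_within_subset) (use ab in auto)
  show "((\<lambda>t. (norm (u t))\<^sup>2) has_real_derivative - (2 / \<epsilon>) * (g t (u t) \<bullet> u t)) (at t within {a..b})"
    using bounded_bilinear.has_vector_derivative[OF bounded_bilinear_inner d d]
    unfolding power2_norm_eq_inner has_real_derivative_iff_has_vector_derivative[symmetric]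
    by (rule DERIV_cong) (simp add: inner_commute)
  have "((\<lambda>t. u t \<bullet> e) has_real_derivative - (1 / \<epsilon>) * (g t (u t) \<bullet> e)) (at t within {a..b})"
    using bounded_linear.has_vector_derivative[OF bounded_linear_inner_left d, of e]
    by (simp add: has_real_derivative_iff_has_vector_derivative)
  from DERIV_power[OF this, of 2]
  show "((\<lambda>t. (u t \<bullet> e)\<^sup>2) has_real_derivative - (2 / \<epsilon>) * ((u t \<bullet> e) * (g t (u t) \<bullet> e))) (at t within {a..b})"
    by (rule DERIV_cong) simp
qed

text \<open>\<open>A_low\<close> and the remainder bound give \<open>g t (u t) \<bullet> u t\<close>
  at least (l - \<eta>) |u|^2, and Gronwall follows with the primitive ?H. This uses only the least
  eigenvalue, neither the gap nor the cone.\<close>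

lemma norm_upper:
  assumes u: "flow \<epsilon> u" and R: "remainder_le \<eta> \<delta>" and ab: "0 \<le> a" "a \<le> b" "b \<le> T"
    and small: "\<And>t. t \<in> {a..b} \<Longrightarrow> norm (u t) \<le> \<delta>"
  shows "(norm (u b))\<^sup>2 \<le> (norm (u a))\<^sup>2 * exp (2 / \<epsilon> * (G a - G b + \<eta> * (b - a)))"
proof -
  have \<epsilon>: "\<epsilon> > 0" using u by (simp add: flow_def)
  let ?H = "\<lambda>t. 2 / \<epsilon> * (\<eta> * t - G t)"
  have "(norm (u b))\<^sup>2 \<le> (norm (u a))\<^sup>2 * exp (?H b - ?H a)"
  proof (rule gronwall[OF ab(2) flow_derivs(1)[OF u ab(1,3)]])
    fix t assume t: "t \<in> {a..b}"
    show "(?H has_real_derivative 2 / \<epsilon> * (\<eta> - l t)) (at t within {a..b})"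
      by (rule derivative_eq_intros G_deriv_within[OF ab(1,3) t] refl)+ simp
    have tT: "t \<in> {0..T}" using t ab by auto
    have "\<bar>(g t (u t) - A t (u t)) \<bullet> u t\<bar> \<le> \<eta> * norm (u t) * norm (u t)"
      by (rule remainder_inner[OF R tT small[OF t]])
    then have "(l t - \<eta>) * (norm (u t))\<^sup>2 \<le> g t (u t) \<bullet> u t"
      using A_low[OF tT, of "u t"] by (simp add: inner_diff_left power2_eq_square algebra_simps)
    then have "2 / \<epsilon> * ((l t - \<eta>) * (norm (u t))\<^sup>2) \<le> 2 / \<epsilon> * (g t (u t) \<bullet> u t)"
      using \<epsilon> by (intro mult_left_mono) auto
    moreover have "2 / \<epsilon> * (\<eta> - l t) * (norm (u t))\<^sup>2 = - (2 / \<epsilon> * ((l t - \<eta>) * (norm (u t))\<^sup>2))"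
      by algebra
    ultimately show "- (2 / \<epsilon>) * (g t (u t) \<bullet> u t) \<le> 2 / \<epsilon> * (\<eta> - l t) * (norm (u t))\<^sup>2"
      by linarith
  qed
  then show ?thesis by (simp add: algebra_simps)
qed

text \<open>A continuation argument: \<open>norm_upper\<close> presupposes that the norm is at most
  \<delta>, and at a first time with norm equal to \<delta> it would bring the norm back to at most
  its initial value, which is below \<delta>.\<close>

lemma stays_small:
  assumes u: "flow \<epsilon> u" and R: "remainder_le \<eta> \<delta>" and "\<tau> \<le> T" "norm (u 0) < \<delta>"
    and G: "\<And>t. t \<in> {0..\<tau>} \<Longrightarrow> \<eta> * t \<le> G t" and t: "t \<in> {0..\<tau>}"
  shows "norm (u t) \<le> norm (u 0)"
proof -
  have \<epsilon>: "\<epsilon> > 0" using u by (simp add: flow_def)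
  have bound: "norm (u s) \<le> norm (u 0)" if "s \<in> {0..\<tau>}" "\<And>r. r \<in> {0..s} \<Longrightarrow> norm (u r) \<le> \<delta>" for s
  proof -
    have "(norm (u s))\<^sup>2 \<le> (norm (u 0))\<^sup>2 * exp (2 / \<epsilon> * (G 0 - G s + \<eta> * (s - 0)))"
      using that assms(3) by (intro norm_upper[OF u R]) auto
    also have "\<dots> \<le> (norm (u 0))\<^sup>2 * 1"
    proof (rule mult_left_mono)
      have "2 / \<epsilon> * (G 0 - G s + \<eta> * (s - 0)) \<le> 0"
        using G[OF that(1)] \<epsilon> by (intro mult_nonneg_nonpos) (simp_all add: G_0)
      then show "exp (2 / \<epsilon> * (G 0 - G s + \<eta> * (s - 0))) \<le> 1"
        by simp
    qed simp
    finally show ?thesis by simp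
  qed
  have cont: "continuous_on {0..\<tau>} (\<lambda>t. norm (u t))"
    using flow_continuous[OF u] by (intro continuous_on_norm) (rule continuous_on_subset, use assms(3) in auto)
  have "norm (u s) < \<delta>" if s: "s \<in> {0..\<tau>}" for s
  proof (rule ccontr)
    assume "\<not> norm (u s) < \<delta>"
    then have "\<delta> \<le> norm (u s)"
      by simp
    from first_hitting_time[OF cont assms(4) s this]
    obtain r where r: "0 < r" "r \<le> s" "norm (u r) = \<delta>" "\<And>q. 0 \<le> q \<Longrightarrow> q < r \<Longrightarrow> norm (u q) < \<delta>"
      by metis
    have "norm (u q) \<le> \<delta>" if "q \<in> {0..r}" for q
      using r(3) r(4)[of q] that by (cases "q = r") auto
    then have "norm (u r) \<le> norm (u 0)"
      using r s by (intro bound) auto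
    with r(3) assms(4) show False by simp
  qed
  then show ?thesis using t by (intro bound) (auto intro: less_imp_le)
qed

text \<open>
  For \<open>Q = |u|\<^sup>2 - K v\<^sup>2\<close> the spectral gap contributes \<open>- 2 \<gamma> (|u|\<^sup>2 - v\<^sup>2)\<close> to \<open>\<epsilon> Q'\<close>. As \<open>K \<ge> 2\<close>,
  this is at most \<open>- 2 (\<gamma> / K) Q - \<gamma> |u|\<^sup>2\<close>, and the last term absorbs the remainder; what is left is a
  linear differential inequality for \<open>Q\<close>.
\<close>

lemma cone_invariant:
  assumes u: "flow \<epsilon> u" and R: "remainder_le \<eta> \<delta>" and K: "K \<ge> 2" "2 * \<eta> * (1 + K) \<le> \<gamma>"
    and b: "b \<le> S" and small: "\<And>t. t \<in> {0..b} \<Longrightarrow> norm (u t) \<le> \<delta>"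
    and cone0: "(norm (u 0))\<^sup>2 \<le> K * (u 0 \<bullet> e)\<^sup>2" and t: "t \<in> {0..b}"
  shows "(norm (u t))\<^sup>2 \<le> K * (u t \<bullet> e)\<^sup>2"
proof -
  have \<epsilon>: "\<epsilon> > 0" using u by (simp add: flow_def)
  have tT: "t \<le> T" using t b S by auto
  let ?Q = "\<lambda>t. (norm (u t))\<^sup>2 - K * (u t \<bullet> e)\<^sup>2"
  let ?H = "\<lambda>t. - (2 / \<epsilon>) * (G t + \<gamma> / K * t)"
  have "?Q t \<le> ?Q 0 * exp (?H t - ?H 0)"
  proof (rule gronwall)
    fix s assume s: "s \<in> {0..t}"
    let ?v = "u s \<bullet> e"
    have sT: "s \<in> {0..T}" and sS: "s \<in> {0..S}" using s t b S by auto
    show "(?Q has_real_derivative - (2 / \<epsilon>) * (g s (u s) \<bullet> u s - K * (?v * (g s (u s) \<bullet> e)))) (at s within {0..t})"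
      by (rule derivative_eq_intros flow_derivs[OF u order_refl tT s] refl)+ (simp add: algebra_simps)
    show "(?H has_real_derivative - (2 / \<epsilon>) * (l s + \<gamma> / K)) (at s within {0..t})"
      by (rule derivative_eq_intros G_deriv_within[OF order_refl tT s] refl)+ simp
    define N where "N = (norm (u s))\<^sup>2"
    define V where "V = ?v\<^sup>2"
    define z where "z = u s - ?v *\<^sub>R e"
    have ee: "e \<bullet> e = 1" using e(1) by (simp add: dot_square_norm)
    have z: "z \<bullet> e = 0" by (simp add: z_def inner_diff_left ee)
    have u_eq: "u s = ?v *\<^sub>R e + z" by (simp add: z_def)
    have nz: "(norm z)\<^sup>2 = N - V"
      unfolding power2_norm_eq_inner N_def V_def z_def
      by (simp add: inner_diff_left inner_diff_right ee inner_commute power2_eq_square)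
    have Ae: "A s x \<bullet> e = l s * (x \<bullet> e)" for x
      using A_sym[OF sT, of x e] e(2)[OF sS] by (simp add: inner_commute)
    have "A s (u s) \<bullet> u s = A s (u s) \<bullet> (?v *\<^sub>R e) + A s (u s) \<bullet> z"
      by (simp add: z_def inner_diff_right)
    also have "A s (u s) \<bullet> z = A s z \<bullet> u s" by (rule A_sym[OF sT])
    \<comment> \<open>There is no cross term: A z is orthogonal to e, since e is an eigenvector of a
      self-adjoint map.\<close>
    also have "A s z \<bullet> u s = A s z \<bullet> z"
      using Ae[of z] z by (simp add: z_def inner_diff_right)
    finally have Auu: "A s (u s) \<bullet> u s = l s * V + A s z \<bullet> z"
      by (simp add: Ae V_def power2_eq_square)
    have gapz: "(l s + \<gamma>) * (N - V) \<le> A s z \<bullet> z"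
      using gap(2)[OF sS z] by (simp add: nz)
    have small_s: "norm (u s) \<le> \<delta>" using s t by (intro small) auto
    have R1: "\<bar>(g s (u s) - A s (u s)) \<bullet> u s\<bar> \<le> \<eta> * N"
      using remainder_inner[OF R sT small_s, of "u s"] by (simp add: N_def power2_eq_square mult.assoc)
    have "\<bar>?v * ((g s (u s) - A s (u s)) \<bullet> e)\<bar> \<le> norm (u s) * (\<eta> * norm (u s) * norm e)"
      unfolding abs_mult
      using remainder_inner[OF R sT small_s, of e] Cauchy_Schwarz_ineq2[of "u s" e] e(1)
      by (intro mult_mono) auto
    then have R2: "\<bar>?v * ((g s (u s) - A s (u s)) \<bullet> e)\<bar> \<le> \<eta> * N"
      using e(1) by (simp add: N_def power2_eq_square ac_simps)
    have R2': "K * (?v * ((g s (u s) - A s (u s)) \<bullet> e)) \<le> K * (\<eta> * N)"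
      using R2 K(1) by (intro mult_left_mono) auto
    have gu: "g s (u s) \<bullet> u s = l s * V + A s z \<bullet> z + (g s (u s) - A s (u s)) \<bullet> u s"
      using Auu by (simp add: inner_diff_left)
    have ge: "?v * (g s (u s) \<bullet> e) = l s * V + ?v * ((g s (u s) - A s (u s)) \<bullet> e)"
      by (simp add: inner_diff_left Ae V_def power2_eq_square algebra_simps)
    define X p r where "X = A s z \<bullet> z" and "p = ?v * ((g s (u s) - A s (u s)) \<bullet> e)"
      and "r = (g s (u s) - A s (u s)) \<bullet> u s"
    \<comment> \<open>The gap provides \<gamma> N - \<gamma> V. One half of \<gamma> N pays for
      \<gamma> / K N, the other half for the two remainders \<eta> N and K \<eta> N.\<close>
    have "\<gamma> / K * N \<le> \<gamma> / 2 * N"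
      using K(1) gap(1) by (intro mult_right_mono divide_left_mono) (auto simp: N_def)
    moreover have "\<eta> * N + K * (\<eta> * N) \<le> \<gamma> / 2 * N"
      using mult_right_mono[OF K(2), of N] by (simp add: N_def algebra_simps)
    moreover have "l s * N - l s * V + \<gamma> * N - \<gamma> * V \<le> X"
      using gapz by (simp add: X_def algebra_simps)
    moreover have "- (\<eta> * N) \<le> r" "K * p \<le> K * (\<eta> * N)"
      using R1 R2' by (auto simp: r_def p_def)
    moreover have "\<gamma> / 2 * N + \<gamma> / 2 * N = \<gamma> * N"
      by simp
    ultimately have "l s * N - K * (l s * V) + \<gamma> / K * N - \<gamma> * V
        \<le> l s * V + X + r - (K * (l s * V) + K * p)"
      by linarith
    moreover have "(l s + \<gamma> / K) * (N - K * V) = l s * N - K * (l s * V) + \<gamma> / K * N - \<gamma> * V"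
      using K(1) by (simp add: algebra_simps)
    ultimately have "(l s + \<gamma> / K) * (N - K * V) \<le> g s (u s) \<bullet> u s - K * (?v * (g s (u s) \<bullet> e))"
      by (simp add: gu ge X_def p_def r_def distrib_left)
    then have "2 / \<epsilon> * ((l s + \<gamma> / K) * (N - K * V)) \<le> 2 / \<epsilon> * (g s (u s) \<bullet> u s - K * (?v * (g s (u s) \<bullet> e)))"
      using \<epsilon> by (intro mult_left_mono) auto
    then show "- (2 / \<epsilon>) * (g s (u s) \<bullet> u s - K * (?v * (g s (u s) \<bullet> e)))
        \<le> - (2 / \<epsilon>) * (l s + \<gamma> / K) * ?Q s"
      unfolding N_def V_def by linarith
  qed (use t in auto)
  \<comment> \<open>The exponential is positive whatever the sign of l, so Q keeps the sign it has
    at time 0.\<close>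
  also have "\<dots> \<le> 0"
    using cone0 by (intro mult_nonpos_nonneg) auto
  finally show ?thesis by simp
qed

text \<open>Inside the cone |x| is at most K times the component along e (K bounds its own square
  root as \<open>K \<ge> 1\<close>). The error \<eta> |x| is thus proportional to that component,
  whose equation becomes a closed scalar one.\<close>

lemma cone_remainder:
  assumes R: "remainder_le \<eta> \<delta>" and K: "K \<ge> 1" and t: "t \<in> {0..S}" and small: "norm x \<le> \<delta>"
    and cone: "(norm x)\<^sup>2 \<le> K * (x \<bullet> e)\<^sup>2"
  shows "\<bar>(x \<bullet> e) * (g t x \<bullet> e) - l t * (x \<bullet> e)\<^sup>2\<bar> \<le> \<eta> * K * (x \<bullet> e)\<^sup>2"
proof -
  have tT: "t \<in> {0..T}" using t S by auto
  have \<eta>: "\<eta> > 0" using R by (simp add: remainder_le_def)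
  have "(norm x)\<^sup>2 \<le> (K * \<bar>x \<bullet> e\<bar>)\<^sup>2"
  proof -
    have "K * (x \<bullet> e)\<^sup>2 \<le> K\<^sup>2 * (x \<bullet> e)\<^sup>2"
      using K by (intro mult_right_mono) (auto simp: power2_eq_square)
    with cone show ?thesis by (simp add: power_mult_distrib)
  qed
  then have x: "norm x \<le> K * \<bar>x \<bullet> e\<bar>"
    using K by (simp add: power2_le_iff_abs_le)
  have Ae: "A t x \<bullet> e = l t * (x \<bullet> e)"
    using A_sym[OF tT, of x e] e(2)[OF t] by (simp add: inner_commute)
  have "(x \<bullet> e) * (g t x \<bullet> e) - l t * (x \<bullet> e)\<^sup>2 = (x \<bullet> e) * ((g t x - A t x) \<bullet> e)"
    by (simp add: inner_diff_left Ae power2_eq_square algebra_simps)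
  also have "\<bar>\<dots>\<bar> = \<bar>x \<bullet> e\<bar> * \<bar>(g t x - A t x) \<bullet> e\<bar>" by (rule abs_mult)
  also have "\<dots> \<le> \<bar>x \<bullet> e\<bar> * (\<eta> * norm x)"
    using remainder_inner[OF R tT small, of e] e(1) by (intro mult_left_mono) auto
  also have "\<dots> \<le> \<bar>x \<bullet> e\<bar> * (\<eta> * (K * \<bar>x \<bullet> e\<bar>))"
    using x \<eta> by (intro mult_left_mono) auto
  also have "\<dots> = \<eta> * K * (x \<bullet> e)\<^sup>2"
    by (simp add: power2_eq_square)
  finally show ?thesis .
qed

text \<open>Scalar Gronwall for v^2 with rates perturbed by \<eta> K. The first bound forces escape
  and, read backwards, decay; the second keeps v away from 0 backwards in time.\<close>

lemma component_bounds:
  assumes u: "flow \<epsilon> u" and R: "remainder_le \<eta> \<delta>" and K: "K \<ge> 1"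
    and ab: "0 \<le> a" "a \<le> b" "b \<le> S" and small: "\<And>t. t \<in> {a..b} \<Longrightarrow> norm (u t) \<le> \<delta>"
    and cone: "\<And>t. t \<in> {a..b} \<Longrightarrow> (norm (u t))\<^sup>2 \<le> K * (u t \<bullet> e)\<^sup>2"
  shows "(u a \<bullet> e)\<^sup>2 * exp (2 / \<epsilon> * (G a - G b - \<eta> * K * (b - a))) \<le> (u b \<bullet> e)\<^sup>2"
    and "(u b \<bullet> e)\<^sup>2 \<le> (u a \<bullet> e)\<^sup>2 * exp (2 / \<epsilon> * (G a - G b + \<eta> * K * (b - a)))"
proof -
  have \<epsilon>: "\<epsilon> > 0" using u by (simp add: flow_def)
  have bT: "b \<le> T" using ab S by auto
  have H: "((\<lambda>t. 2 / \<epsilon> * (c * t - G t)) has_real_derivative 2 / \<epsilon> * (c - l t)) (at t within {a..b})"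
    if "t \<in> {a..b}" for c t
    by (rule derivative_eq_intros G_deriv_within[OF ab(1) bT that] refl)+ simp
  have est: "2 / \<epsilon> * (- (\<eta> * K) - l t) * (u t \<bullet> e)\<^sup>2 \<le> - (2 / \<epsilon>) * ((u t \<bullet> e) * (g t (u t) \<bullet> e)) \<and>
    - (2 / \<epsilon>) * ((u t \<bullet> e) * (g t (u t) \<bullet> e)) \<le> 2 / \<epsilon> * (\<eta> * K - l t) * (u t \<bullet> e)\<^sup>2"
    if t: "t \<in> {a..b}" for t
  proof -
    have tS: "t \<in> {0..S}" using t ab by auto
    let ?p = "(u t \<bullet> e) * (g t (u t) \<bullet> e)"
    have "\<bar>?p - l t * (u t \<bullet> e)\<^sup>2\<bar> \<le> \<eta> * K * (u t \<bullet> e)\<^sup>2"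
      by (rule cone_remainder[OF R K tS small[OF t] cone[OF t]])
    then have "(- (\<eta> * K) - l t) * (u t \<bullet> e)\<^sup>2 \<le> - ?p" "- ?p \<le> (\<eta> * K - l t) * (u t \<bullet> e)\<^sup>2"
      by (auto simp: algebra_simps abs_le_iff)
    then have "2 / \<epsilon> * ((- (\<eta> * K) - l t) * (u t \<bullet> e)\<^sup>2) \<le> 2 / \<epsilon> * (- ?p)"
      "2 / \<epsilon> * (- ?p) \<le> 2 / \<epsilon> * ((\<eta> * K - l t) * (u t \<bullet> e)\<^sup>2)"
      using \<epsilon> by (intro mult_left_mono; simp)+
    then show ?thesis by (simp only: mult.assoc mult_minus_left mult_minus_right)
  qed
  have "(u a \<bullet> e)\<^sup>2 * exp (2 / \<epsilon> * (- (\<eta> * K) * b - G b) - 2 / \<epsilon> * (- (\<eta> * K) * a - G a)) \<le> (u b \<bullet> e)\<^sup>2"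
    by (rule gronwall_ge[OF ab(2) flow_derivs(2)[OF u ab(1) bT] H]) (use est in auto)
  then show "(u a \<bullet> e)\<^sup>2 * exp (2 / \<epsilon> * (G a - G b - \<eta> * K * (b - a))) \<le> (u b \<bullet> e)\<^sup>2"
    by (simp add: algebra_simps)
  have "(u b \<bullet> e)\<^sup>2 \<le> (u a \<bullet> e)\<^sup>2 * exp (2 / \<epsilon> * (\<eta> * K * b - G b) - 2 / \<epsilon> * (\<eta> * K * a - G a))"
    by (rule gronwall[OF ab(2) flow_derivs(2)[OF u ab(1) bT] H]) (use est in auto)
  then show "(u b \<bullet> e)\<^sup>2 \<le> (u a \<bullet> e)\<^sup>2 * exp (2 / \<epsilon> * (G a - G b + \<eta> * K * (b - a)))"
    by (simp add: algebra_simps)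
qed

text \<open>The factor c treats both signs at once. A change of sign would need a zero of v,
  excluded by the lower bound for v^2.\<close>

lemma component_pos:
  assumes u: "flow \<epsilon> u" and R: "remainder_le \<eta> \<delta>" and K: "K \<ge> 1"
    and b: "b \<le> S" and small: "\<And>t. t \<in> {0..b} \<Longrightarrow> norm (u t) \<le> \<delta>"
    and cone: "\<And>t. t \<in> {0..b} \<Longrightarrow> (norm (u t))\<^sup>2 \<le> K * (u t \<bullet> e)\<^sup>2"
    and pos: "0 < c * (u 0 \<bullet> e)" and t: "t \<in> {0..b}"
  shows "0 < c * (u t \<bullet> e)"
proof (rule ccontr)
  assume neg: "\<not> ?thesis"
  have "continuous_on {0..t} (\<lambda>t. c * (u t \<bullet> e))"
    by (intro continuous_intros continuous_on_subset[OF flow_continuous[OF u]]) (use t b S in auto)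
  then obtain s where s: "0 \<le> s" "s \<le> t" "c * (u s \<bullet> e) = 0"
    using IVT2'[of "\<lambda>t. c * (u t \<bullet> e)" t 0 0] neg pos t by auto
  have "(u 0 \<bullet> e)\<^sup>2 * exp (2 / \<epsilon> * (G 0 - G s - \<eta> * K * (s - 0))) \<le> (u s \<bullet> e)\<^sup>2"
    using s t b by (intro component_bounds(1)[OF u R K] small cone) auto
  moreover have "0 < (u 0 \<bullet> e)\<^sup>2 * exp (2 / \<epsilon> * (G 0 - G s - \<eta> * K * (s - 0)))"
    using pos by (intro mult_pos_pos) auto
  ultimately have "u s \<bullet> e \<noteq> 0" by auto
  with s(3) pos show False by auto
qed

end

subsection \<open>Compactness of the rescaled solutions\<close>

text \<open>With c = C2 / C1, (F2) bounds the time derivative of F by C1 (F + c), so F + c is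
  nonnegative and grows at most exponentially along a solution, where the gradient term only
  dissipates. As (F1) concerns the supremum over all times, the energy at time t must still be
  compared with that at other times for the same point. R depends on B but not on
  \<epsilon>.\<close>

lemma a_priori_bound:
  fixes F :: "real \<Rightarrow> 'a::euclidean_space \<Rightarrow> real"
  assumes "T > 0" "F0 T F" "F1 T F" "F2 T F"
  obtains R where "\<And>\<epsilon> u t. \<epsilon> > 0 \<Longrightarrow> gradient_flow T F \<epsilon> u \<Longrightarrow> norm (u 0) \<le> B \<Longrightarrow>
    t \<in> {0..T} \<Longrightarrow> norm (u t) \<le> R"
proof -
  obtain C1 C2 where C: "C1 > 0" "C2 > 0"
    "\<And>t x. t \<in> {0..T} \<Longrightarrow> \<bar>partial_t T F t x\<bar> \<le> C1 * F t x + C2"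
    using assms(4) unfolding F2_def by blast
  define c where "c = C2 / C1"
  have c: "c > 0" and C1c: "C1 * (f + c) = C1 * f + C2" for f
    using C by (auto simp: c_def algebra_simps)
  have low: "0 \<le> F t x + c" if "t \<in> {0..T}" for t x
  proof -
    have "0 \<le> C1 * (F t x + c)"
      using C(3)[OF that, of x] by (simp add: C1c)
    then show ?thesis using C(1) by (simp add: zero_le_mult_iff)
  qed
  have dF: "((\<lambda>s. F s (u s) + c) has_real_derivative partial_t T F s (u s) + gradx F s (u s) \<bullet> u')
      (at s within {a..b})"
    if "0 \<le> a" "b \<le> T" "s \<in> {a..b}" "(u has_vector_derivative u') (at s within {0..T})" for u u' s a b
  proof -
    have "((\<lambda>s. F s (u s)) has_real_derivative partial_t T F s (u s) + gradx F s (u s) \<bullet> u')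
      (at s within {0..T})"
      using that by (intro energy_derivative assms) auto
    then have "((\<lambda>s. F s (u s)) has_real_derivative partial_t T F s (u s) + gradx F s (u s) \<bullet> u')
      (at s within {a..b})"
      by (rule DERIV_subset) (use that in auto)
    then show ?thesis by (auto intro!: derivative_eq_intros)
  qed
  have dFx: "((\<lambda>s. F s x + c) has_real_derivative partial_t T F s x) (at s within {a..b})"
    if "0 \<le> a" "b \<le> T" "s \<in> {a..b}" for x s a b
    using dF[OF that has_vector_derivative_const, of x] by simp
  have dH: "((\<lambda>s. k * s) has_real_derivative k) (at s within {a..b})" for k s a b :: real
    by (auto intro!: derivative_eq_intros)
  \<comment> \<open>The point x is fixed and only time varies, so Gronwall is applied forwards or
    backwards according to the order of s and t.\<close>
  have all_times: "F s x + c \<le> (F t x + c) * exp (C1 * T)" if st: "s \<in> {0..T}" "t \<in> {0..T}" for s t x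
  proof (cases "t \<le> s")
    case True
    have "F s x + c \<le> (F t x + c) * exp (C1 * s - C1 * t)"
    proof (rule gronwall[OF True dFx dH])
      fix r assume "r \<in> {t..s}"
      then show "partial_t T F r x \<le> C1 * (F r x + c)"
        using C(3)[of r x] st by (auto simp: C1c abs_le_iff)
    qed (use st in auto)
    also have "\<dots> \<le> (F t x + c) * exp (C1 * T)"
      using st C(1) low[OF st(2), of x]
      by (intro mult_left_mono) (auto simp: simp flip: right_diff_distrib)
    finally show ?thesis .
  next
    case False
    have "(F s x + c) * exp (- C1 * t - - C1 * s) \<le> F t x + c"
    proof (rule gronwall_ge[OF _ dFx dH])
      fix r assume "r \<in> {s..t}"
      then show "- C1 * (F r x + c) \<le> partial_t T F r x"
        using C(3)[of r x] st C1c[of "F r x"] by (auto simp: abs_le_iff)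
    qed (use st False in auto)
    then have "(F s x + c) * exp (- C1 * t - - C1 * s) * exp (C1 * (t - s)) \<le> (F t x + c) * exp (C1 * (t - s))"
      by (rule mult_right_mono) simp
    then have "F s x + c \<le> (F t x + c) * exp (C1 * (t - s))"
      by (simp add: mult.assoc algebra_simps flip: exp_add)
    also have "\<dots> \<le> (F t x + c) * exp (C1 * T)"
      using st C(1) low[OF st(2), of x] by (intro mult_left_mono) auto
    finally show ?thesis .
  qed
  have "GDERIV (F 0) x :> gradx F 0 x" for x
    using assms(1) by (intro gradx_hessx_derivative[OF assms(2)]) simp
  then have "isCont (F 0) x" for x
    unfolding gderiv_def by (meson has_derivative_continuous)
  then have "continuous_on (cball 0 B) (F 0)"
    by (intro continuous_at_imp_continuous_on) auto
  then have "bounded (F 0 ` cball 0 B)"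
    by (intro compact_imp_bounded compact_continuous_image) auto
  then obtain M where M: "M > 0" "\<And>x. norm x \<le> B \<Longrightarrow> \<bar>F 0 x\<bar> \<le> M"
    unfolding bounded_pos by auto
  \<comment> \<open>One exponential accounts for growth along the solution, the other for changing
    the time at a fixed point. The final c covers negative values of F, which are at least
    -c.\<close>
  define \<rho> where "\<rho> = (M + c) * exp (C1 * T) * exp (C1 * T) + c"
  have "\<rho> > 0" using M(1) c by (simp add: \<rho>_def add_pos_pos)
  then have "bounded {x. (SUP t\<in>{0..T}. \<bar>F t x\<bar>) \<le> \<rho>}"
    using assms(3) unfolding F1_def by blast
  then obtain R where R: "\<And>x. (SUP t\<in>{0..T}. \<bar>F t x\<bar>) \<le> \<rho> \<Longrightarrow> norm x \<le> R"
    unfolding bounded_iff by auto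
  show thesis
  proof (rule that[of R])
    fix \<epsilon> u t
    assume \<epsilon>: "\<epsilon> > 0" and u: "gradient_flow T F \<epsilon> u" and u0: "norm (u 0) \<le> B" and t: "t \<in> {0..T}"
    obtain u' where u': "\<And>t. t \<in> {0..T} \<Longrightarrow> (u has_vector_derivative u' t) (at t within {0..T})"
      "\<And>t. t \<in> {0..T} \<Longrightarrow> \<epsilon> *\<^sub>R u' t = - gradx F t (u t)"
      using u unfolding gradient_flow_def by blast
    have "F t (u t) + c \<le> (F 0 (u 0) + c) * exp (C1 * t - C1 * 0)"
    proof (rule gronwall[OF _ dF[OF _ _ _ u'(1)] dH])
      fix s assume "s \<in> {0..t}"
      then have s: "s \<in> {0..T}" using t by auto
      have "gradx F s (u s) = - (\<epsilon> *\<^sub>R u' s)"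
        using u'(2)[OF s] by simp
      then have "gradx F s (u s) \<bullet> u' s \<le> 0"
        using \<epsilon> by simp
      then show "partial_t T F s (u s) + gradx F s (u s) \<bullet> u' s \<le> C1 * (F s (u s) + c)"
        using C(3)[OF s, of "u s"] by (simp add: C1c abs_le_iff)
    qed (use t in auto)
    also have "\<dots> \<le> (M + c) * exp (C1 * T)"
      using t C(1) M(1) M(2)[OF u0] c by (intro mult_mono) auto
    finally have E: "F t (u t) + c \<le> (M + c) * exp (C1 * T)" .
    have "\<bar>F s (u t)\<bar> \<le> \<rho>" if s: "s \<in> {0..T}" for s
    proof -
      have "F s (u t) + c \<le> (F t (u t) + c) * exp (C1 * T)"
        by (rule all_times[OF s t])
      also have "\<dots> \<le> (M + c) * exp (C1 * T) * exp (C1 * T)"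
        by (rule mult_right_mono[OF E]) simp
      finally have "F s (u t) + c \<le> \<rho> - c"
        by (simp add: \<rho>_def)
      moreover have "c \<le> \<rho>"
        using M(1) c by (simp add: \<rho>_def)
      ultimately show ?thesis
        using low[OF s, of "u t"] c by (simp add: abs_le_iff)
    qed
    then have "(SUP s\<in>{0..T}. \<bar>F s (u t)\<bar>) \<le> \<rho>"
      using assms(1) by (intro cSUP_least) auto
    then show "norm (u t) \<le> R" by (rule R)
  qed
qed

lemma two_sided_gronwall:
  fixes f :: "real \<Rightarrow> real"
  assumes f: "\<And>t. t \<in> {-N..N} \<Longrightarrow> (f has_real_derivative f' t) (at t within {-N..N})"
    and le: "\<And>t. t \<in> {-N..N} \<Longrightarrow> \<bar>f' t\<bar> \<le> c * f t" and s: "s \<in> {-N..N}"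
  shows "f s \<le> f 0 * exp (c * \<bar>s\<bar>)"
proof -
  have sub: "(f has_real_derivative f' t) (at t within {a..b})"
    if "{a..b} \<subseteq> {-N..N}" "t \<in> {a..b}" for a b t
    using f[of t] by (rule DERIV_subset) (use that in auto)
  have dH: "((\<lambda>s. k * s) has_real_derivative k) (at s within {a..b})" for k s a b :: real
    by (auto intro!: derivative_eq_intros)
  show ?thesis
  proof (cases "0 \<le> s")
    case True
    have "f s \<le> f 0 * exp (c * s - c * 0)"
      by (rule gronwall[OF True sub dH]) (use s le in \<open>force simp: abs_le_iff\<close>)+
    with True show ?thesis by simp
  next
    case False
    have "f s * exp (- c * 0 - - c * s) \<le> f 0"
    proof (rule gronwall_ge[OF _ sub dH])
      fix t assume "t \<in> {s..0}"
      then show "- c * f t \<le> f' t"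
        using le[of t] s by (auto simp: abs_le_iff)
    qed (use False s in auto)
    then have "f s * exp (c * s) * exp (- c * s) \<le> f 0 * exp (- c * s)"
      by (intro mult_right_mono) auto
    then show ?thesis
      using False by (simp add: mult.assoc flip: exp_add)
  qed
qed

text \<open>Adding \<sigma>^2 to the squared distance makes the differential inequality homogeneous:
  the forcing 2 |x - y| \<sigma> is at most |x - y|^2 + \<sigma>^2.\<close>

lemma perturbed_flows_close:
  fixes x y :: "real \<Rightarrow> 'a::euclidean_space"
  assumes x: "\<And>s. s \<in> {-N..N} \<Longrightarrow> (x has_vector_derivative x' s) (at s within {-N..N})"
    and y: "\<And>s. s \<in> {-N..N} \<Longrightarrow> (y has_vector_derivative y' s) (at s within {-N..N})"
    and L: "L \<ge> 0"
    and le: "\<And>s. s \<in> {-N..N} \<Longrightarrow> norm (x' s - y' s) \<le> L * norm (x s - y s) + \<sigma>"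
    and s: "s \<in> {-N..N}"
  shows "(norm (x s - y s))\<^sup>2 \<le> ((norm (x 0 - y 0))\<^sup>2 + \<sigma>\<^sup>2) * exp ((2 * L + 1) * N)"
proof -
  let ?f = "\<lambda>s. (norm (x s - y s))\<^sup>2 + \<sigma>\<^sup>2"
  have "?f s \<le> ?f 0 * exp ((2 * L + 1) * \<bar>s\<bar>)"
  proof (rule two_sided_gronwall[OF _ _ s])
    fix t assume t: "t \<in> {-N..N}"
    let ?d = "x t - y t" and ?d' = "x' t - y' t"
    have d: "((\<lambda>s. x s - y s) has_vector_derivative ?d') (at t within {-N..N})"
      by (intro has_vector_derivative_diff x y t)
    have "((\<lambda>s. (norm (x s - y s))\<^sup>2) has_real_derivative 2 * (?d \<bullet> ?d')) (at t within {-N..N})"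
      using bounded_bilinear.has_vector_derivative[OF bounded_bilinear_inner d d]
      unfolding power2_norm_eq_inner has_real_derivative_iff_has_vector_derivative[symmetric]
      by (rule DERIV_cong) (simp add: inner_commute)
    from DERIV_add[OF this DERIV_const[of "\<sigma>\<^sup>2"]]
    show "(?f has_real_derivative 2 * (?d \<bullet> ?d')) (at t within {-N..N})"
      by simp
    have "\<bar>?d \<bullet> ?d'\<bar> \<le> norm ?d * norm ?d'"
      by (rule Cauchy_Schwarz_ineq2)
    also have "\<dots> \<le> norm ?d * (L * norm ?d + \<sigma>)"
      by (rule mult_left_mono[OF le[OF t]]) simp
    finally have "\<bar>2 * (?d \<bullet> ?d')\<bar> \<le> 2 * L * (norm ?d)\<^sup>2 + 2 * norm ?d * \<sigma>"
      by (simp add: power2_eq_square algebra_simps)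
    also have "2 * norm ?d * \<sigma> \<le> (norm ?d)\<^sup>2 + \<sigma>\<^sup>2"
      by (rule sum_squares_bound)
    also have "2 * L * (norm ?d)\<^sup>2 + ((norm ?d)\<^sup>2 + \<sigma>\<^sup>2) \<le> (2 * L + 1) * ?f t"
      using mult_nonneg_nonneg[OF L zero_le_power2[of \<sigma>]] by (simp add: algebra_simps)
    finally show "\<bar>2 * (?d \<bullet> ?d')\<bar> \<le> (2 * L + 1) * ?f t" by simp
  qed
  also have "\<dots> \<le> ?f 0 * exp ((2 * L + 1) * N)"
    using L s by (intro mult_left_mono) (auto intro!: mult_left_mono)
  finally show ?thesis
    using zero_le_power2[of \<sigma>] by linarith
qed

text \<open>Over a bounded range of s the true times collapse to t0, so the rescaled solutions
  satisfy the autonomous limit equation up to a small error. Only their values at s = 0 need a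
  subsequence; the Cauchy estimate then holds on every window, without a diagonal argument.\<close>

lemma rescaled_flows_converge:
  fixes g :: "real \<Rightarrow> 'a::euclidean_space \<Rightarrow> 'a" and u :: "nat \<Rightarrow> real \<Rightarrow> 'a"
  assumes cont: "continuous_on ({0..T} \<times> UNIV) (\<lambda>(t, x). g t x)"
    and lip: "\<And>t x y. t \<in> {0..T} \<Longrightarrow> norm x \<le> R \<Longrightarrow> norm y \<le> R \<Longrightarrow> norm (g t x - g t y) \<le> L * norm (x - y)"
    and L: "L \<ge> 0" and t0: "0 < t0" "t0 < T"
    and \<epsilon>: "\<And>k. \<epsilon> k > 0" "\<epsilon> \<longlonglongrightarrow> 0" and tk: "t \<longlonglongrightarrow> t0"
    and u: "\<And>k s. s \<in> {0..T} \<Longrightarrow> (u k has_vector_derivative - (1 / \<epsilon> k) *\<^sub>R g s (u k s)) (at s within {0..T})"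
    and R: "\<And>k s. s \<in> {0..T} \<Longrightarrow> norm (u k s) \<le> R"
  obtains q w where "strict_mono q"
    "\<And>K. compact K \<Longrightarrow> uniform_limit K (\<lambda>k s. u (q k) (t (q k) + \<epsilon> (q k) * s)) w sequentially"
    "\<And>s. (w has_vector_derivative - g t0 (w s)) (at s)"
proof -
  define W where "W k s = u k (t k + \<epsilon> k * s)" for k s
  have near: "\<forall>\<^sub>F k in sequentially. \<forall>s\<in>{-N..N}. t k + \<epsilon> k * s \<in> {0..T} \<and> \<bar>t k + \<epsilon> k * s - t0\<bar> < d"
    if "d > 0" for N d
  proof -
    \<comment> \<open>Staying below t0 and T - t0 keeps the whole window inside {0..T}.\<close>
    define d' where "d' = Min {d, t0, T - t0}"
    have d': "d' > 0" "d' \<le> d" "d' \<le> t0" "d' \<le> T - t0" using that t0 by (auto simp: d'_def)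
    have "(\<lambda>k. \<bar>t k - t0\<bar> + \<epsilon> k * \<bar>N\<bar>) \<longlonglongrightarrow> \<bar>t0 - t0\<bar> + 0 * \<bar>N\<bar>"
      by (intro tendsto_intros tk \<epsilon>)
    then have "\<forall>\<^sub>F k in sequentially. \<bar>t k - t0\<bar> + \<epsilon> k * \<bar>N\<bar> < d'"
      using d'(1) by (intro order_tendstoD) auto
    then show ?thesis
    proof eventually_elim
      case (elim k)
      show ?case
      proof
        fix s assume "s \<in> {-N..N}"
        then have "\<bar>\<epsilon> k * s\<bar> \<le> \<epsilon> k * \<bar>N\<bar>"
          using \<epsilon>(1)[of k] by (auto simp: abs_mult intro!: mult_left_mono)
        with elim d' show "t k + \<epsilon> k * s \<in> {0..T} \<and> \<bar>t k + \<epsilon> k * s - t0\<bar> < d"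
          by auto
      qed
    qed
  qed
  have W_deriv: "(W k has_vector_derivative - g (t k + \<epsilon> k * s) (W k s)) (at s within {-N..N})"
    if "\<forall>s\<in>{-N..N}. t k + \<epsilon> k * s \<in> {0..T}" "s \<in> {-N..N}" for k s N
  proof -
    have "((\<lambda>s. t k + \<epsilon> k * s) has_vector_derivative \<epsilon> k) (at s within {-N..N})"
      by (auto intro!: derivative_eq_intros simp flip: has_real_derivative_iff_has_vector_derivative)
    moreover have "(u k has_vector_derivative - (1 / \<epsilon> k) *\<^sub>R g (t k + \<epsilon> k * s) (u k (t k + \<epsilon> k * s)))
        (at (t k + \<epsilon> k * s) within (\<lambda>s. t k + \<epsilon> k * s) ` {-N..N})"
      by (rule has_vector_derivative_within_subset[OF u]) (use that in auto)
    ultimately have "(u k \<circ> (\<lambda>s. t k + \<epsilon> k * s) has_vector_derivative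
        \<epsilon> k *\<^sub>R (- (1 / \<epsilon> k) *\<^sub>R g (t k + \<epsilon> k * s) (u k (t k + \<epsilon> k * s)))) (at s within {-N..N})"
      by (rule vector_diff_chain_within)
    moreover have "u k \<circ> (\<lambda>s. t k + \<epsilon> k * s) = W k"
      by (auto simp: W_def)
    ultimately show ?thesis
      using \<epsilon>(1)[of k] by (simp add: W_def)
  qed
  have freeze: "\<forall>\<^sub>F k in sequentially. \<forall>s\<in>{-N..N}. t k + \<epsilon> k * s \<in> {0..T} \<and>
      norm (W k s) \<le> R \<and> norm (g (t k + \<epsilon> k * s) (W k s) - g t0 (W k s)) \<le> \<sigma>"
    if \<sigma>: "\<sigma> > 0" for N \<sigma>
  proof -
    have "uniformly_continuous_on ({0..T} \<times> cball 0 R) (\<lambda>(t, x). g t x)"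
      by (intro compact_uniformly_continuous continuous_on_subset[OF cont] compact_Times) auto
    then obtain d where d: "d > 0"
      "\<And>p q. p \<in> {0..T} \<times> cball 0 R \<Longrightarrow> q \<in> {0..T} \<times> cball 0 R \<Longrightarrow>
        dist q p < d \<Longrightarrow> dist (case q of (t, x) \<Rightarrow> g t x) (case p of (t, x) \<Rightarrow> g t x) < \<sigma>"
      using \<sigma> by (elim uniformly_continuous_onE) blast+
    show ?thesis
      using near[OF d(1), of N]
    proof eventually_elim
      case (elim k)
      show ?case
      proof
        fix s assume s: "s \<in> {-N..N}"
        then have *: "t k + \<epsilon> k * s \<in> {0..T}" "\<bar>t k + \<epsilon> k * s - t0\<bar> < d" using elim by auto
        then have WR: "norm (W k s) \<le> R" unfolding W_def by (intro R)
        have "norm (g (t k + \<epsilon> k * s) (W k s) - g t0 (W k s)) \<le> \<sigma>"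
          using d(2)[of "(t0, W k s)" "(t k + \<epsilon> k * s, W k s)"] * WR t0
          by (auto simp: dist_Pair_Pair dist_norm)
        with * WR show "t k + \<epsilon> k * s \<in> {0..T} \<and>
          norm (W k s) \<le> R \<and> norm (g (t k + \<epsilon> k * s) (W k s) - g t0 (W k s)) \<le> \<sigma>"
          by blast
      qed
    qed
  qed
  have "\<forall>\<^sub>F k in sequentially. W k 0 \<in> cball 0 R"
    using freeze[OF zero_less_one, of 0] by eventually_elim (auto dest: bspec[of _ _ 0])
  \<comment> \<open>The bound R is available once \<open>t k\<close> lies in {0..T}; the shift by n0
    discards the earlier indices.\<close>
  then obtain n0 where "\<And>k. W (k + n0) 0 \<in> cball 0 R"
    unfolding eventually_sequentially by (metis le_add2)
  then obtain w0 q0 where q0: "strict_mono q0" "((\<lambda>k. W (k + n0) 0) \<circ> q0) \<longlonglongrightarrow> w0"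
    using compact_cball[of "0::'a" R] unfolding compact_def by metis
  define q where "q k = q0 k + n0" for k
  have q: "strict_mono q"
    using q0(1) by (auto simp: q_def strict_mono_def)
  define V where "V k = W (q k)" for k
  have V0: "(\<lambda>k. V k 0) \<longlonglongrightarrow> w0"
    using q0(2) by (simp add: V_def q_def o_def)
  define a where "a k s = t (q k) + \<epsilon> (q k) * s" for k s
  have freezeV: "\<forall>\<^sub>F k in sequentially. \<forall>s\<in>{-N..N}. a k s \<in> {0..T} \<and>
      norm (V k s) \<le> R \<and> norm (g (a k s) (V k s) - g t0 (V k s)) \<le> \<sigma>" if "\<sigma> > 0" for N \<sigma>
    using eventually_subseq[OF q freeze[OF that, of N]] by (simp add: a_def V_def)
  have V_deriv: "(V k has_vector_derivative - g (a k s) (V k s)) (at s within {-N..N})"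
    if "\<forall>s\<in>{-N..N}. a k s \<in> {0..T}" "s \<in> {-N..N}" for k s N
    using W_deriv[of N "q k" s] that by (simp add: a_def V_def)
  have t0T: "t0 \<in> {0..T}" using t0 by auto
  have cauchy: "uniformly_Cauchy_on {-N..N} V" for N
    unfolding uniformly_Cauchy_on_def
  proof (intro allI impI)
    fix e :: real assume e: "e > 0"
    define E where "E = exp ((2 * L + 1) * \<bar>N\<bar>)"
    have E: "E \<ge> 1" using L by (simp add: E_def)
    \<comment> \<open>The two freezing errors add up to 2 \<sigma>, and the initial distance is
      below 2 \<sigma>. The resulting bound 8 \<sigma>^2 E is e^2 / (2 E), less than e^2.\<close>
    define \<sigma> where "\<sigma> = e / (4 * E)"
    have \<sigma>: "\<sigma> > 0" using e E by (simp add: \<sigma>_def)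
    have "Cauchy (\<lambda>k. V k 0)" using V0 by (rule LIMSEQ_imp_Cauchy)
    then obtain n1 where n1: "\<And>j k. j \<ge> n1 \<Longrightarrow> k \<ge> n1 \<Longrightarrow> dist (V j 0) (V k 0) < 2 * \<sigma>"
      unfolding Cauchy_def using \<sigma> by (metis zero_less_mult_iff zero_less_numeral)
    obtain n2 where n2: "\<And>k s. k \<ge> n2 \<Longrightarrow> s \<in> {-N..N} \<Longrightarrow> a k s \<in> {0..T} \<and>
      norm (V k s) \<le> R \<and> norm (g (a k s) (V k s) - g t0 (V k s)) \<le> \<sigma>"
      using freezeV[OF \<sigma>, of N] unfolding eventually_sequentially by blast
    show "\<exists>M. \<forall>x\<in>{-N..N}. \<forall>m\<ge>M. \<forall>n\<ge>M. dist (V m x) (V n x) < e"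
    proof (intro exI[of _ "max n1 n2"] ballI allI impI)
      fix s m n assume s: "s \<in> {-N..N}" and "max n1 n2 \<le> m" "max n1 n2 \<le> n"
      then have m: "n1 \<le> m" "n2 \<le> m" and n: "n1 \<le> n" "n2 \<le> n" by auto
      have "(norm (V m s - V n s))\<^sup>2 \<le> ((norm (V m 0 - V n 0))\<^sup>2 + (2 * \<sigma>)\<^sup>2) * exp ((2 * L + 1) * N)"
      proof (rule perturbed_flows_close[OF V_deriv V_deriv L _ s])
        fix r assume r: "r \<in> {-N..N}"
        note m' = n2[OF m(2) r] and n' = n2[OF n(2) r]
        have "norm (g t0 (V m r) - g t0 (V n r)) \<le> L * norm (V m r - V n r)"
          using m' n' by (intro lip t0T) auto
        moreover have eq: "- g (a m r) (V m r) - - g (a n r) (V n r) =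
            (g (a n r) (V n r) - g t0 (V n r)) - (g (a m r) (V m r) - g t0 (V m r))
            - (g t0 (V m r) - g t0 (V n r))" by simp
        ultimately show "norm (- g (a m r) (V m r) - - g (a n r) (V n r)) \<le> L * norm (V m r - V n r) + 2 * \<sigma>"
          unfolding eq using m'[THEN conjunct2, THEN conjunct2] n'[THEN conjunct2, THEN conjunct2]
            norm_triangle_ineq4[of "g (a n r) (V n r) - g t0 (V n r)" "g (a m r) (V m r) - g t0 (V m r)"]
            norm_triangle_ineq4[of "(g (a n r) (V n r) - g t0 (V n r)) - (g (a m r) (V m r) - g t0 (V m r))"
              "g t0 (V m r) - g t0 (V n r)"] by linarith
      qed (use n2 m n in auto)
      also have "\<dots> \<le> ((2 * \<sigma>)\<^sup>2 + (2 * \<sigma>)\<^sup>2) * E"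
        using n1[OF m(1) n(1)] s L \<sigma> unfolding E_def
        by (intro mult_mono add_mono power_mono) (auto simp: dist_norm intro!: mult_left_mono)
      also have "\<dots> = e\<^sup>2 / (2 * E)"
        using E by (simp add: \<sigma>_def power2_eq_square field_simps)
      also have "\<dots> < e\<^sup>2"
        using E e by (simp add: divide_less_eq)
      finally show "dist (V m s) (V n s) < e"
        using e by (simp add: dist_norm power2_less_imp_less)
    qed
  qed
  \<comment> \<open>Defined pointwise, so that the uniform limits on all windows are the same
    function.\<close>
  define w where "w s = lim (\<lambda>k. V k s)" for s
  have ul: "uniform_limit {-N..N} V w sequentially" for N
    using cauchy[of N] unfolding uniformly_convergent_eq_Cauchy[symmetric] w_def
    by (simp add: uniformly_convergent_uniform_limit_iff)
  have mem: "s \<in> {-\<bar>s\<bar>..\<bar>s\<bar>}" for s :: real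
    by (auto simp: abs_if)
  have ptw: "(\<lambda>k. V k s) \<longlonglongrightarrow> w s" for s
    by (rule tendsto_uniform_limitI[OF ul[of "\<bar>s\<bar>"] mem])
  have wR: "norm (w s) \<le> R" for s
  proof (rule tendsto_upperbound[OF tendsto_norm[OF ptw]])
    show "\<forall>\<^sub>F k in sequentially. norm (V k s) \<le> R"
      using freezeV[OF zero_less_one, of "\<bar>s\<bar>"] by eventually_elim (use mem in blast)
  qed simp
  have w_deriv: "(w has_vector_derivative - g t0 (w s)) (at s)" for s
  proof -
    \<comment> \<open>The margin 1 puts s in the interior, where the derivative within the window is
      a full derivative.\<close>
    define N where "N = \<bar>s\<bar> + 1"
    obtain m where m: "\<And>k r. k \<ge> m \<Longrightarrow> r \<in> {-N..N} \<Longrightarrow> a k r \<in> {0..T}"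
      using freezeV[OF zero_less_one, of N] unfolding eventually_sequentially by blast
    have "\<exists>v. \<forall>x\<in>{-N..N}. (\<lambda>n. V (n + m) x) \<longlonglongrightarrow> v x \<and>
        (v has_derivative (\<lambda>h. h *\<^sub>R - g t0 (w x))) (at x within {-N..N})"
    proof (rule has_derivative_sequence[where ?x0.0 = s])
      fix n x assume "x \<in> {-N..N}"
      then show "(V (n + m) has_derivative (\<lambda>h. h *\<^sub>R - g (a (n + m) x) (V (n + m) x))) (at x within {-N..N})"
        using V_deriv[of N "n + m" x] m unfolding has_vector_derivative_def by simp
    next
      fix e :: real assume e: "e > 0"
      \<comment> \<open>Half of e is spent on freezing the time, half on the Lipschitz bound; L + 1
        avoids division by 0.\<close>
      have "\<forall>\<^sub>F k in sequentially. \<forall>x\<in>{-N..N}. norm (V k x - w x) < e / (2 * (L + 1))"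
        using uniform_limitD[OF ul[of N], of "e / (2 * (L + 1))"] e L by (simp add: dist_norm)
      with freezeV[OF half_gt_zero[OF e], of N]
      have "\<forall>\<^sub>F k in sequentially. \<forall>x\<in>{-N..N}. \<forall>h.
        norm (h *\<^sub>R - g (a k x) (V k x) - h *\<^sub>R - g t0 (w x)) \<le> e * norm h"
      proof eventually_elim
        case (elim k)
        show ?case
        proof (intro ballI allI)
          fix x h assume x: "x \<in> {-N..N}"
          have "norm (g t0 (V k x) - g t0 (w x)) \<le> L * norm (V k x - w x)"
            using elim x wR by (intro lip t0T) auto
          also have "\<dots> \<le> (L + 1) * (e / (2 * (L + 1)))"
            using elim x L by (intro mult_mono) (auto intro: less_imp_le)
          also have "\<dots> = e / 2" using L by (simp add: field_simps)
          finally have "norm (g (a k x) (V k x) - g t0 (w x)) \<le> e"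
            using elim x norm_triangle_ineq[of "g (a k x) (V k x) - g t0 (V k x)" "g t0 (V k x) - g t0 (w x)"]
            by fastforce
          then have "\<bar>h\<bar> * norm (g (a k x) (V k x) - g t0 (w x)) \<le> \<bar>h\<bar> * e"
            by (rule mult_left_mono) simp
          moreover have "norm (h *\<^sub>R - g (a k x) (V k x) - h *\<^sub>R - g t0 (w x)) =
              \<bar>h\<bar> * norm (g (a k x) (V k x) - g t0 (w x))"
            by (simp add: norm_minus_commute flip: norm_scaleR scaleR_diff_right)
          ultimately show "norm (h *\<^sub>R - g (a k x) (V k x) - h *\<^sub>R - g t0 (w x)) \<le> e * norm h"
            by (simp add: mult.commute)
        qed
      qed
      then show "\<forall>\<^sub>F n in sequentially. \<forall>x\<in>{-N..N}. \<forall>h.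
        norm (h *\<^sub>R - g (a (n + m) x) (V (n + m) x) - h *\<^sub>R - g t0 (w x)) \<le> e * norm h"
        by (rule sequentially_offset)
    next
      show "(\<lambda>n. V (n + m) s) \<longlonglongrightarrow> w s"
        using ptw by (rule LIMSEQ_ignore_initial_segment)
    qed (auto simp: N_def)
    then obtain v where v: "\<And>x. x \<in> {-N..N} \<Longrightarrow> (\<lambda>n. V (n + m) x) \<longlonglongrightarrow> v x"
      "\<And>x. x \<in> {-N..N} \<Longrightarrow> (v has_derivative (\<lambda>h. h *\<^sub>R - g t0 (w x))) (at x within {-N..N})"
      by blast
    have vw: "v x = w x" if "x \<in> {-N..N}" for x
      using v(1)[OF that] LIMSEQ_ignore_initial_segment[OF ptw, of m x] by (rule LIMSEQ_unique)
    have "(v has_vector_derivative - g t0 (w s)) (at s)"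
    proof -
      have N: "-N < s" "s < N" by (auto simp: N_def abs_if)
      then have "(v has_derivative (\<lambda>h. h *\<^sub>R - g t0 (w s))) (at s within {-N..N})"
        by (intro v(2)) auto
      with N show ?thesis
        unfolding has_vector_derivative_def by (simp add: at_within_Icc_at)
    qed
    then show ?thesis
      by (rule has_vector_derivative_transform_within_open[where S = "{-N<..<N}"])
        (use vw in \<open>auto simp: N_def abs_if\<close>)
  qed
  show thesis
  proof (rule that[OF q _ w_deriv])
    fix K :: "real set" assume "compact K"
    then have "bounded K" by (rule compact_imp_bounded)
    then obtain N where "\<And>s. s \<in> K \<Longrightarrow> \<bar>s\<bar> \<le> N"
      unfolding bounded_iff by auto
    then have "K \<subseteq> {-N..N}" by force
    from uniform_limit_on_subset[OF ul this] have "uniform_limit K V w sequentially" .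
    moreover have "V = (\<lambda>k s. u (q k) (t (q k) + \<epsilon> (q k) * s))"
      by (simp add: V_def W_def fun_eq_iff)
    ultimately show "uniform_limit K (\<lambda>k s. u (q k) (t (q k) + \<epsilon> (q k) * s)) w sequentially"
      by simp
  qed
qed

subsection \<open>Escape times\<close>

lemma lambda1_rayleigh:
  fixes F :: "real \<Rightarrow> 'a::euclidean_space \<Rightarrow> real"
  assumes "F0 T F" "t \<in> {0..T}"
  shows "lambda1 F t \<in> eigenvalues (hessx F t 0)"
    and "lambda1 F t * (norm x)\<^sup>2 \<le> hessx F t 0 x \<bullet> x"
  unfolding lambda1_def
  by (rule min_eigenvalue_rayleigh[OF hessx_symmetric[OF assms]])+

text \<open>A lowest eigenvector at time t is a test vector for the Rayleigh bound at time s, and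
  conversely.\<close>

lemma continuous_on_lambda1:
  fixes F :: "real \<Rightarrow> 'a::euclidean_space \<Rightarrow> real"
  assumes "F0 T F"
  shows "continuous_on {0..T} (lambda1 F)"
  unfolding continuous_on_iff
proof (intro ballI allI impI)
  fix t e :: real assume t: "t \<in> {0..T}" and e: "e > 0"
  from e have "e / 2 > 0" by simp
  then obtain d where d: "d > 0" "d \<le> 1"
    "\<And>s t x y h. s \<in> {0..T} \<Longrightarrow> t \<in> {0..T} \<Longrightarrow> norm x \<le> 1 \<Longrightarrow> norm y \<le> 1 \<Longrightarrow>
       dist (t, x) (s, y) < d \<Longrightarrow> norm (hessx F t x h - hessx F s y h) \<le> e / 2 * norm h"
    using hessx_uniformly_continuous[OF assms] by blast
  have half: "lambda1 F s \<le> lambda1 F t + e / 2"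
    if st: "s \<in> {0..T}" "t \<in> {0..T}" "dist t s < d" for s t
  proof -
    obtain v where v: "hessx F t 0 v = lambda1 F t *\<^sub>R v" "v \<noteq> 0"
      using lambda1_rayleigh(1)[OF assms st(2)] by (auto simp: eigenvalues_def eigenspace_def)
    define r where "r = (hessx F t 0 v - hessx F s 0 v) \<bullet> v"
    have "\<bar>r\<bar> \<le> norm (hessx F t 0 v - hessx F s 0 v) * norm v"
      unfolding r_def by (rule Cauchy_Schwarz_ineq2)
    also have "\<dots> \<le> (e / 2 * norm v) * norm v"
      using st by (intro mult_right_mono d(3)) (auto simp: dist_Pair_Pair)
    finally have "\<bar>r\<bar> \<le> e / 2 * (norm v)\<^sup>2"
      by (simp add: power2_eq_square)
    moreover have "lambda1 F s * (norm v)\<^sup>2 \<le> hessx F s 0 v \<bullet> v"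
      by (rule lambda1_rayleigh(2)[OF assms st(1)])
    moreover have "hessx F s 0 v \<bullet> v = lambda1 F t * (norm v)\<^sup>2 - r"
      unfolding r_def by (simp add: inner_diff_left v(1) power2_norm_eq_inner)
    ultimately have "lambda1 F s * (norm v)\<^sup>2 \<le> (lambda1 F t + e / 2) * (norm v)\<^sup>2"
      unfolding distrib_right by linarith
    then show ?thesis using v(2) by simp
  qed
  show "\<exists>d>0. \<forall>s\<in>{0..T}. dist s t < d \<longrightarrow> dist (lambda1 F s) (lambda1 F t) < e"
  proof (intro exI[of _ d] conjI ballI impI d(1))
    fix s assume "s \<in> {0..T}" "dist s t < d"
    then have "lambda1 F s \<le> lambda1 F t + e / 2" "lambda1 F t \<le> lambda1 F s + e / 2"
      using half t by (auto simp: dist_commute)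
    then show "dist (lambda1 F s) (lambda1 F t) < e"
      using e by (simp add: dist_real_def)
  qed
qed

text \<open>\<open>LEAST\<close> over the reals needs an attained minimum. It exists because G
  leaves 0 upwards with slope \<open>l 0\<close>, so its zeros in the interval stay away from 0,
  while G T < 0. The linear lower bound for G before ts is the margin required by
  \<open>stays_small\<close>.\<close>

lemma first_zero_of_integral:
  fixes l :: "real \<Rightarrow> real"
  defines "G \<equiv> \<lambda>t. integral {0..t} l"
  assumes T: "T > 0" and cont: "continuous_on {0..T} l" and l0: "l 0 > 0" and neg: "G T < 0"
    and ts: "ts = (LEAST t. t \<in> {0<..<T} \<and> G t = 0)"
  shows "0 < ts" "ts < T" "G ts = 0" "\<And>t. 0 < t \<Longrightarrow> t < ts \<Longrightarrow> G t > 0" "l ts \<le> 0"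
    and "\<And>t. t \<in> {0..T} \<Longrightarrow> (G has_real_derivative l t) (at t within {0..T})"
    and "\<And>\<tau>. 0 < \<tau> \<Longrightarrow> \<tau> < ts \<Longrightarrow> \<exists>\<eta>>0. \<forall>t\<in>{0..\<tau>}. \<eta> * t \<le> G t"
proof -
  show der: "(G has_real_derivative l t) (at t within {0..T})" if "t \<in> {0..T}" for t
    unfolding G_def using cont that by (rule integral_has_real_derivative)
  have cG: "continuous_on {0..T} G"
    using der by (rule DERIV_continuous_on)
  have G0: "G 0 = 0" by (simp add: G_def)
  have "((\<lambda>t. G t - l 0 / 2 * t) has_real_derivative l 0 / 2) (at 0 within {0..T})"
    using T by (auto intro!: derivative_eq_intros der)
  then have "\<exists>d>0. \<forall>h>0. 0 + h \<in> {0..T} \<longrightarrow> h < d \<longrightarrow> G 0 - l 0 / 2 * 0 < G (0 + h) - l 0 / 2 * (0 + h)"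
    by (rule has_real_derivative_pos_inc_right) (use l0 in simp)
  then obtain d where d: "d > 0" "\<And>h. 0 < h \<Longrightarrow> h \<le> T \<Longrightarrow> h < d \<Longrightarrow> l 0 / 2 * h < G h"
    by (auto simp: G0)
  define d' where "d' = min d T / 2"
  have d': "0 < d'" "d' < d" "d' < T" using d(1) T by (auto simp: d'_def)
  have pos: "0 < G h" if "0 < h" "h \<le> d'" for h
    using d(2)[of h] l0 d' that by (smt (verit) half_gt_zero mult_pos_pos)
  \<comment> \<open>The shift by d' skips the zero of G at 0, and the sign change turns the first
    zero into a first hitting of level 0 from below.\<close>
  have "continuous_on {0..T - d'} (\<lambda>s. - G (s + d'))"
    by (intro continuous_on_minus continuous_on_compose2[OF cG] continuous_intros) (use d' in auto)
  then obtain \<sigma> where \<sigma>: "0 < \<sigma>" "\<sigma> \<le> T - d'" "- G (\<sigma> + d') = 0"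
    "\<And>s. 0 \<le> s \<Longrightarrow> s < \<sigma> \<Longrightarrow> - G (s + d') < 0"
    using first_hitting_time[of "T - d'" "\<lambda>s. - G (s + d')" 0 "T - d'"] pos[of d'] d' neg by auto
  define t1 where "t1 = \<sigma> + d'"
  have Gpos: "0 < G t" if "0 < t" "t < t1" for t
    using pos[of t] \<sigma>(4)[of "t - d'"] that by (cases "t \<le> d'") (auto simp: t1_def)
  have t1: "0 < t1" "t1 < T" "G t1 = 0"
    using \<sigma> d' neg by (auto simp: t1_def less_le)
  have "ts = t1"
    unfolding ts
  proof (rule Least_equality)
    fix y assume "y \<in> {0<..<T} \<and> G y = 0"
    then show "t1 \<le> y" using Gpos[of y] by force
  qed (use t1 in auto)
  then show *: "0 < ts" "ts < T" "G ts = 0" "\<And>t. 0 < t \<Longrightarrow> t < ts \<Longrightarrow> G t > 0"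
    using t1 Gpos by auto
  show "l ts \<le> 0"
  proof (rule ccontr)
    assume "\<not> l ts \<le> 0"
    then have "\<exists>d>0. \<forall>h>0. ts - h \<in> {0..T} \<longrightarrow> h < d \<longrightarrow> G (ts - h) < G ts"
      using * by (intro has_real_derivative_pos_inc_left[OF der]) auto
    then obtain r where r: "r > 0" "\<And>h. 0 < h \<Longrightarrow> ts - h \<in> {0..T} \<Longrightarrow> h < r \<Longrightarrow> G (ts - h) < G ts"
      by blast
    define h where "h = min r ts / 2"
    have "0 < h" "h < r" "h < ts" using r(1) *(1) by (auto simp: h_def)
    then show False using r(2)[of h] *(2,3) *(4)[of "ts - h"] by auto
  qed
  show "\<exists>\<eta>>0. \<forall>t\<in>{0..\<tau>}. \<eta> * t \<le> G t" if \<tau>: "0 < \<tau>" "\<tau> < ts" for \<tau>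
  proof -
    have "continuous_on {min d' \<tau>..\<tau>} G"
      by (rule continuous_on_subset[OF cG]) (use \<tau> d' * in auto)
    moreover have "{min d' \<tau>..\<tau>} \<noteq> {}" by simp
    ultimately obtain x where x: "x \<in> {min d' \<tau>..\<tau>}" "\<And>y. y \<in> {min d' \<tau>..\<tau>} \<Longrightarrow> G x \<le> G y"
      using continuous_attains_inf[of "{min d' \<tau>..\<tau>}" G] by auto
    have Gx: "0 < G x" using x(1) \<tau> d' by (intro *(4)) auto
    show ?thesis
    \<comment> \<open>The first entry comes from the slope at 0, the second from the positive
      minimum of G on the rest of {0..\<tau>}.\<close>
    proof (intro exI[of _ "min (l 0 / 2) (G x / \<tau>)"] conjI ballI)
      show "0 < min (l 0 / 2) (G x / \<tau>)" using l0 Gx \<tau> by simp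
      fix t assume t: "t \<in> {0..\<tau>}"
      show "min (l 0 / 2) (G x / \<tau>) * t \<le> G t"
      proof (cases "t < min d' \<tau>")
        case True
        have "min (l 0 / 2) (G x / \<tau>) * t \<le> l 0 / 2 * t" using t by (intro mult_right_mono[OF min.cobounded1]) auto
        also have "\<dots> \<le> G t"
          using d(2)[of t] t True d' G0 by (cases "t = 0") auto
        finally show ?thesis .
      next
        case False
        have "min (l 0 / 2) (G x / \<tau>) * t \<le> G x / \<tau> * t" using t by (intro mult_right_mono[OF min.cobounded2]) auto
        also have "\<dots> \<le> G x / \<tau> * \<tau>" using t Gx \<tau> by (intro mult_left_mono) auto
        also have "\<dots> = G x" using \<tau> by simp
        also have "\<dots> \<le> G t" using t False by (intro x(2)) auto
        finally show ?thesis .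
      qed
    qed
  qed
qed

lemma exp_beats_powr:
  fixes \<epsilon> :: "nat \<Rightarrow> real"
  assumes "\<And>k. \<epsilon> k > 0" "\<epsilon> \<longlonglongrightarrow> 0" "\<alpha> > 0" "m > 0"
  shows "filterlim (\<lambda>k. (\<epsilon> k powr \<alpha>)\<^sup>2 * exp (m / \<epsilon> k)) at_top sequentially"
proof -
  have "filterlim (\<lambda>x::real. (x powr \<alpha>)\<^sup>2 * exp (m / x)) at_top (at_right 0)"
    using assms(3,4) by real_asymp
  moreover have "filterlim \<epsilon> (at_right 0) sequentially"
    using assms(1,2) by (intro tendsto_imp_filterlim_at_right) auto
  ultimately show ?thesis by (rule filterlim_compose)
qed

section \<open>Escape from the small ball around \<open>t_star\<close>\<close>

context linearized_flow
begin

lemma component_le_norm: "(x \<bullet> e)\<^sup>2 \<le> (norm x)\<^sup>2"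
  using power_mono[OF Cauchy_Schwarz_ineq2[of x e], of 2] e(1) by simp

lemma G_decrease:
  assumes "0 \<le> a" "a \<le> b" "b \<le> T" "\<And>t. t \<in> {a..b} \<Longrightarrow> l t \<le> c"
  shows "G b - G a \<le> c * (b - a)"
proof -
  have d: "((\<lambda>t. G t - c * t) has_real_derivative l t - c) (at t within {a..b})" if "t \<in> {a..b}" for t
    by (rule derivative_eq_intros G_deriv_within[OF assms(1,3) that] refl)+ simp
  have "G b - c * b \<le> G a - c * a"
  proof (rule DERIV_nonpos_imp_decreasing_open[OF assms(2)])
    fix t assume "a < t" "t < b"
    then show "\<exists>y. ((\<lambda>t. G t - c * t) has_real_derivative y) (at t) \<and> y \<le> 0"
      using d[of t] assms(4)[of t] by (intro exI[of _ "l t - c"]) (auto simp: at_within_Icc_at)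
  next
    show "continuous_on {a..b} (\<lambda>t. G t - c * t)" using d by (rule DERIV_continuous_on)
  qed
  then show ?thesis by (simp add: algebra_simps)
qed

lemma G_decrease_lower:
  assumes "0 \<le> a" "a \<le> b" "b \<le> T" "\<And>t. t \<in> {a..b} \<Longrightarrow> - c \<le> l t"
  shows "G a - G b \<le> c * (b - a)"
proof -
  have d: "((\<lambda>t. G t + c * t) has_real_derivative l t + c) (at t within {a..b})" if "t \<in> {a..b}" for t
    by (rule derivative_eq_intros G_deriv_within[OF assms(1,3) that] refl)+ simp
  have "G a + c * a \<le> G b + c * b"
  proof (rule DERIV_nonneg_imp_increasing_open[OF assms(2)])
    fix t assume "a < t" "t < b"
    then show "\<exists>y. ((\<lambda>t. G t + c * t) has_real_derivative y) (at t) \<and> 0 \<le> y"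
      using d[of t] assms(4)[of t] by (intro exI[of _ "l t + c"]) (auto simp: at_within_Icc_at)
  next
    show "continuous_on {a..b} (\<lambda>t. G t + c * t)" using d by (rule DERIV_continuous_on)
  qed
  then show ?thesis by (simp add: algebra_simps)
qed

text \<open>Here \<eta>, and with it \<delta>, may depend on \<tau>: the initial values tend to 0
  and enter any ball eventually.\<close>

lemma eventually_small_before:
  fixes u :: "nat \<Rightarrow> real \<Rightarrow> 'a"
  assumes rem: "\<And>\<eta>. \<eta> > 0 \<Longrightarrow> \<exists>\<delta>. remainder_le \<eta> \<delta>"
    and G_low: "\<exists>\<eta>>0. \<forall>t\<in>{0..\<tau>}. \<eta> * t \<le> G t" and "\<tau> \<le> T"
    and u: "\<And>k. flow (\<epsilon> k) (u k)" "(\<lambda>k. u k 0) \<longlonglongrightarrow> 0"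
  shows "\<forall>\<^sub>F k in sequentially. \<forall>t\<in>{0..\<tau>}. norm (u k t) \<le> norm (u k 0)"
proof -
  obtain \<eta> where \<eta>: "\<eta> > 0" "\<And>t. t \<in> {0..\<tau>} \<Longrightarrow> \<eta> * t \<le> G t" using G_low by blast
  obtain \<delta> where \<delta>: "remainder_le \<eta> \<delta>" using rem[OF \<eta>(1)] by blast
  then have "\<delta> > 0" by (simp add: remainder_le_def)
  then have "\<forall>\<^sub>F k in sequentially. norm (u k 0) < \<delta>"
    using u(2) by (intro order_tendstoD(2)[OF tendsto_norm_zero])
  then show ?thesis
  proof eventually_elim
    case (elim k)
    show ?case
      using stays_small[OF u(1) \<delta> assms(3) elim \<eta>(2)] by blast
  qed
qed

text \<open>To be contradicted: remaining in the \<delta>-ball up to b bounds the initial norm by an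
  exponentially small quantity. Up to a the fine pair keeps the loss small; on [a, b] the coarse
  pair still leaves half of the growth rate.\<close>

lemma escape:
  assumes u: "flow \<epsilon> u" and K: "K \<ge> 2" "\<eta> * K \<le> \<mu> / 2" "2 * \<eta> * (1 + K) \<le> \<gamma>" and R: "remainder_le \<eta> \<delta>"
    and R': "remainder_le \<eta>' \<delta>'" "\<eta>' * K * T \<le> \<mu> * (b - a) / 16"
    and ab: "0 \<le> a" "a \<le> b" "b \<le> S" "G a \<le> \<mu> * (b - a) / 8"
    and neg: "\<And>t. t \<in> {a..b} \<Longrightarrow> l t \<le> - \<mu>" and \<mu>: "\<mu> > 0"
    and cone0: "(norm (u 0))\<^sup>2 \<le> K * (u 0 \<bullet> e)\<^sup>2"
    and before: "\<And>t. t \<in> {0..a} \<Longrightarrow> norm (u t) \<le> \<delta>'"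
    and small: "\<And>t. t \<in> {0..b} \<Longrightarrow> norm (u t) \<le> \<delta>"
  shows "(norm (u 0))\<^sup>2 * exp (\<mu> * (b - a) / (2 * \<epsilon>)) \<le> K * \<delta>\<^sup>2"
proof -
  have \<epsilon>: "\<epsilon> > 0" using u by (simp add: flow_def)
  have bT: "b \<le> T" using ab S by auto
  have K1: "K \<ge> 1" using K by simp
  let ?V = "\<lambda>t. (u t \<bullet> e)\<^sup>2"
  have cone: "(norm (u t))\<^sup>2 \<le> K * ?V t" if "t \<in> {0..b}" for t
    by (rule cone_invariant[OF u R K(1,3) ab(3) small cone0 that])
  have \<eta>': "\<eta>' * K * a \<le> \<eta>' * K * T"
    using R'(1) K(1) ab bT by (intro mult_left_mono) (auto simp: remainder_le_def)
  \<comment> \<open>In units of \<mu> (b - a) / \<epsilon>, the losses 1/8 from G a and 1/16 from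
    the remainder double to 3/8. The gain on [a, b] is 1, so the net 5/8 exceeds the claimed
    1/2.\<close>
  have "?V 0 * exp (- (\<mu> * (b - a) * 3 / 8) / \<epsilon>) \<le> ?V 0 * exp (2 / \<epsilon> * (G 0 - G a - \<eta>' * K * (a - 0)))"
  proof (intro mult_left_mono)
    have "2 / \<epsilon> * (- (\<mu> * (b - a) * 3 / 16)) \<le> 2 / \<epsilon> * (G 0 - G a - \<eta>' * K * (a - 0))"
      using \<eta>' R'(2) ab(4) \<epsilon> by (intro mult_left_mono) (auto simp: G_0)
    then show "exp (- (\<mu> * (b - a) * 3 / 8) / \<epsilon>) \<le> exp (2 / \<epsilon> * (G 0 - G a - \<eta>' * K * (a - 0)))"
      by simp
  qed simp
  also have "\<dots> \<le> ?V a"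
    by (rule component_bounds(1)[OF u R'(1) K1]) (use ab before cone in auto)
  finally have Va: "?V 0 * exp (- (\<mu> * (b - a) * 3 / 8) / \<epsilon>) \<le> ?V a" .
  have "G b - G a \<le> - (\<mu> * (b - a))"
    using G_decrease[OF ab(1,2) bT neg] by simp
  moreover have "\<eta> * K * (b - a) \<le> \<mu> / 2 * (b - a)"
    using K(2) ab by (intro mult_right_mono) auto
  moreover have "\<mu> / 2 * (b - a) + \<mu> / 2 * (b - a) = \<mu> * (b - a)"
    by (simp add: algebra_simps)
  ultimately have "\<mu> * (b - a) / 2 \<le> G a - G b - \<eta> * K * (b - a)"
    by linarith
  then have "2 / \<epsilon> * (\<mu> * (b - a) / 2) \<le> 2 / \<epsilon> * (G a - G b - \<eta> * K * (b - a))"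
    using \<epsilon> by (intro mult_left_mono) auto
  then have "?V a * exp (\<mu> * (b - a) / \<epsilon>) \<le> ?V a * exp (2 / \<epsilon> * (G a - G b - \<eta> * K * (b - a)))"
    by (intro mult_left_mono) auto
  also have "\<dots> \<le> ?V b"
    by (rule component_bounds(1)[OF u R K1]) (use ab small cone in auto)
  finally have Vb: "?V a * exp (\<mu> * (b - a) / \<epsilon>) \<le> ?V b" .
  have "(norm (u 0))\<^sup>2 * exp (\<mu> * (b - a) / (2 * \<epsilon>)) \<le>
      (K * ?V 0) * exp (- (\<mu> * (b - a) * 3 / 8) / \<epsilon> + \<mu> * (b - a) / \<epsilon>)"
    using cone0 K \<epsilon> \<mu> ab by (intro mult_mono) (auto simp: field_simps)
  also have "\<dots> = K * (?V 0 * exp (- (\<mu> * (b - a) * 3 / 8) / \<epsilon>) * exp (\<mu> * (b - a) / \<epsilon>))"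
    by (simp only: exp_add mult.assoc)
  also have "\<dots> \<le> K * (?V a * exp (\<mu> * (b - a) / \<epsilon>))"
    using Va K by (intro mult_left_mono mult_right_mono) auto
  also have "\<dots> \<le> K * ?V b"
    using Vb K by (intro mult_left_mono) auto
  also have "?V b \<le> (norm (u b))\<^sup>2"
    by (rule component_le_norm)
  also have "\<dots> \<le> \<delta>\<^sup>2"
    using small[of b] ab by (intro power_mono) auto
  finally show ?thesis using K by simp
qed

lemma hitting_times_converge:
  fixes u :: "nat \<Rightarrow> real \<Rightarrow> 'a"
  assumes rem: "\<And>\<eta>. \<eta> > 0 \<Longrightarrow> \<exists>\<delta>. remainder_le \<eta> \<delta>"
    and ts: "0 < ts" "G ts = 0"
    and G_low: "\<And>\<tau>. 0 < \<tau> \<Longrightarrow> \<tau> < ts \<Longrightarrow> \<exists>\<eta>>0. \<forall>t\<in>{0..\<tau>}. \<eta> * t \<le> G t"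
    and \<mu>: "\<mu> > 0" and d: "d > 0" "d < ts" "ts + d \<le> S"
    and neg: "\<And>t. t \<in> {ts - d..ts + d} \<Longrightarrow> l t \<le> - \<mu>"
    and K: "K \<ge> 2" "\<eta> * K \<le> \<mu> / 2" "2 * \<eta> * (1 + K) \<le> \<gamma>" and R: "remainder_le \<eta> \<delta>"
    and u: "\<And>k. flow (\<epsilon> k) (u k)" "(\<lambda>k. u k 0) \<longlonglongrightarrow> 0" and \<epsilon>: "\<epsilon> \<longlonglongrightarrow> 0"
    and cone0: "\<forall>\<^sub>F k in sequentially. (norm (u k 0))\<^sup>2 \<le> K * (u k 0 \<bullet> e)\<^sup>2"
    and alg: "\<alpha> > 0" "c > 0" "\<forall>\<^sub>F k in sequentially. c * \<epsilon> k powr \<alpha> \<le> norm (u k 0)"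
  obtains t where "\<And>k. t k \<in> {0..T}" "t \<longlonglongrightarrow> ts"
    "\<forall>\<^sub>F k in sequentially. norm (u k (t k)) = \<delta> \<and> (\<forall>s\<in>{0..t k}. norm (u k s) \<le> \<delta>)"
proof -
  have \<epsilon>pos: "\<epsilon> k > 0" for k using u(1)[of k] by (simp add: flow_def)
  have \<delta>: "\<delta> > 0" using R by (simp add: remainder_le_def)
  have tsT: "ts + d \<le> T" using d S by simp
  \<comment> \<open>The strict inequality at earlier times makes the hitting time unique.\<close>
  define hit where "hit k \<tau> \<longleftrightarrow> \<tau> \<in> {0..T} \<and> norm (u k \<tau>) = \<delta> \<and> (\<forall>s. 0 \<le> s \<longrightarrow> s < \<tau> \<longrightarrow> norm (u k s) < \<delta>)"
    for k \<tau>
  have small0: "\<forall>\<^sub>F k in sequentially. norm (u k 0) < r" if "r > 0" for r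
    using u(2) that by (intro order_tendstoD(2)[OF tendsto_norm_zero])
  have main: "\<forall>\<^sub>F k in sequentially. (\<exists>\<tau>. hit k \<tau>) \<and> (\<forall>\<tau>. hit k \<tau> \<longrightarrow> ts - \<theta> \<le> \<tau> \<and> \<tau> \<le> ts + \<theta>)"
    if \<theta>: "0 < \<theta>" "\<theta> \<le> d" for \<theta>
  proof -
    have "continuous_on {0..T} G"
      using G_deriv by (rule DERIV_continuous_on)
    then have "\<forall>e>0. \<exists>r>0. \<forall>x\<in>{0..T}. dist x ts < r \<longrightarrow> dist (G x) (G ts) < e"
      using ts(1) tsT d(1) by (simp add: continuous_on_iff)
    moreover have "0 < \<mu> * \<theta> / 8" using \<mu> \<theta> by simp
    ultimately obtain r where r: "r > 0" "\<And>x. x \<in> {0..T} \<Longrightarrow> \<bar>x - ts\<bar> < r \<Longrightarrow> \<bar>G x - G ts\<bar> < \<mu> * \<theta> / 8"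
      unfolding dist_real_def by blast
    \<comment> \<open>a is moved so close to ts that continuity of G, with G ts = 0, leaves at most
      the share of G a allowed by \<open>escape\<close>.\<close>
    define \<theta>' where "\<theta>' = min \<theta> (r / 2)"
    have \<theta>': "0 < \<theta>'" "\<theta>' \<le> \<theta>" "\<theta>' < r" using r(1) \<theta> by (auto simp: \<theta>'_def)
    define a b where "a = ts - \<theta>'" and "b = ts + \<theta>"
    have ab: "0 < a" "a \<le> b" "b \<le> S" "\<theta> \<le> b - a" "b \<le> T" "a < ts" "ts - \<theta> \<le> a"
      using \<theta> \<theta>' d tsT by (auto simp: a_def b_def)
    have "\<bar>G a\<bar> < \<mu> * \<theta> / 8"
      using r(2)[of a] ab \<theta>' by (auto simp: ts(2) a_def b_def)
    also have "\<mu> * \<theta> / 8 \<le> \<mu> * (b - a) / 8"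
      using \<mu> ab(4) by simp
    finally have Ga: "G a \<le> \<mu> * (b - a) / 8" by simp
    \<comment> \<open>The value for which \<eta>' K T exhausts the remainder budget of
      \<open>escape\<close>.\<close>
    define \<eta>' where "\<eta>' = \<mu> * (b - a) / 16 / (K * T)"
    have KT: "K * T > 0" using K(1) S by simp
    have \<eta>': "\<eta>' > 0" "\<eta>' * K * T \<le> \<mu> * (b - a) / 16"
      using \<mu> \<theta>(1) ab KT by (auto simp: \<eta>'_def mult.assoc)
    obtain \<delta>' where R': "remainder_le \<eta>' \<delta>'" using rem[OF \<eta>'(1)] by blast
    then have \<delta>': "\<delta>' > 0" by (simp add: remainder_le_def)
    have negab: "l t \<le> - \<mu>" if "t \<in> {a..b}" for t
      using that \<theta> \<theta>' by (intro neg) (auto simp: a_def b_def)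
    have before: "\<forall>\<^sub>F k in sequentially. \<forall>t\<in>{0..a}. norm (u k t) \<le> norm (u k 0)"
      using ab G_low[of a] by (intro eventually_small_before[OF rem _ _ u]) auto
    let ?m = "\<mu> * (b - a) / 2"
    have "?m > 0" using \<mu> ab \<theta> by simp
    from exp_beats_powr[OF \<epsilon>pos \<epsilon> alg(1) this]
    have "\<forall>\<^sub>F k in sequentially. K * \<delta>\<^sup>2 / c\<^sup>2 < (\<epsilon> k powr \<alpha>)\<^sup>2 * exp (?m / \<epsilon> k)"
      by (simp add: filterlim_at_top_dense)
    with before small0[OF \<delta>] small0[OF \<delta>'] cone0 alg(3) show ?thesis
    proof eventually_elim
      case (elim k)
      have "\<exists>t\<in>{0..b}. \<delta> \<le> norm (u k t)"
      proof (rule ccontr)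
        assume "\<not> ?thesis"
        then have small: "norm (u k t) \<le> \<delta>" if "t \<in> {0..b}" for t using that by force
        have "norm (u k t) \<le> \<delta>'" if "t \<in> {0..a}" for t
          using elim(1,3) that by force
        then have "(norm (u k 0))\<^sup>2 * exp (\<mu> * (b - a) / (2 * \<epsilon> k)) \<le> K * \<delta>\<^sup>2"
          by (intro escape[OF u(1) K R R' \<eta>'(2) _ ab(2,3) Ga negab \<mu> elim(4) _ small])
            (use ab in auto)
        moreover have "c\<^sup>2 * (\<epsilon> k powr \<alpha>)\<^sup>2 \<le> (norm (u k 0))\<^sup>2"
          using power_mono[OF elim(5), of 2] alg(2) by (simp add: power_mult_distrib)
        then have "c\<^sup>2 * (\<epsilon> k powr \<alpha>)\<^sup>2 * exp (?m / \<epsilon> k) \<le> (norm (u k 0))\<^sup>2 * exp (?m / \<epsilon> k)"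
          by (rule mult_right_mono) simp
        moreover have "K * \<delta>\<^sup>2 < c\<^sup>2 * ((\<epsilon> k powr \<alpha>)\<^sup>2 * exp (?m / \<epsilon> k))"
          using elim(6) alg(2) by (simp add: divide_less_eq mult.commute)
        moreover have "\<mu> * (b - a) / (2 * \<epsilon> k) = ?m / \<epsilon> k" by simp
        ultimately show False by (simp only:)
      qed
      then obtain t where t: "t \<in> {0..b}" "\<delta> \<le> norm (u k t)" by blast
      have cont: "continuous_on {0..T} (\<lambda>t. norm (u k t))"
        by (intro continuous_on_norm flow_continuous[OF u(1)])
      have tT: "t \<in> {0..T}" using t ab by auto
      from first_hitting_time[OF cont elim(2) tT t(2)] obtain \<tau> where
        \<tau>: "0 < \<tau>" "\<tau> \<le> t" "norm (u k \<tau>) = \<delta>" "\<And>s. 0 \<le> s \<Longrightarrow> s < \<tau> \<Longrightarrow> norm (u k s) < \<delta>"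
        by metis
      then have "hit k \<tau>" using tT by (auto simp: hit_def)
      moreover have "ts - \<theta> \<le> \<sigma> \<and> \<sigma> \<le> ts + \<theta>" if "hit k \<sigma>" for \<sigma>
      proof
        show "ts - \<theta> \<le> \<sigma>"
        proof (rule ccontr)
          assume "\<not> ?thesis"
          then have "\<sigma> \<in> {0..a}" using that ab by (auto simp: hit_def)
          with elim(1,2) have "norm (u k \<sigma>) < \<delta>" by force
          with that show False by (simp add: hit_def)
        qed
        have "\<sigma> \<le> t" using that t by (force simp: hit_def)
        then show "\<sigma> \<le> ts + \<theta>" using t by (simp add: b_def)
      qed
      ultimately show ?case by blast
    qed
  qed
  \<comment> \<open>The default ts concerns the finitely many k without hitting time and keeps
    \<open>t k\<close> in {0..T}.\<close>
  define t where "t k = (if \<exists>\<tau>. hit k \<tau> then SOME \<tau>. hit k \<tau> else ts)" for k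
  have t_hit: "hit k (t k)" if "\<exists>\<tau>. hit k \<tau>" for k
    using that unfolding t_def by (simp add: someI_ex)
  show thesis
  proof (rule that[of t])
    fix k show "t k \<in> {0..T}"
      using t_hit[of k] ts(1) tsT d(1) by (cases "\<exists>\<tau>. hit k \<tau>") (auto simp: hit_def t_def)
  next
    show "t \<longlonglongrightarrow> ts"
    proof (rule tendstoI)
      fix r :: real assume r: "r > 0"
      from main[of "min (r / 2) d"] have "\<forall>\<^sub>F k in sequentially.
        (\<exists>\<tau>. hit k \<tau>) \<and> (\<forall>\<tau>. hit k \<tau> \<longrightarrow> ts - min (r / 2) d \<le> \<tau> \<and> \<tau> \<le> ts + min (r / 2) d)"
        using r d(1) by simp
      then show "\<forall>\<^sub>F k in sequentially. dist (t k) ts < r"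
      proof eventually_elim
        case (elim k)
        then have "ts - min (r / 2) d \<le> t k" "t k \<le> ts + min (r / 2) d"
          using t_hit[of k] by blast+
        then show ?case using r by (auto simp: dist_real_def)
      qed
    qed
  next
    show "\<forall>\<^sub>F k in sequentially. norm (u k (t k)) = \<delta> \<and> (\<forall>s\<in>{0..t k}. norm (u k s) \<le> \<delta>)"
      using main[OF d(1) order_refl]
    proof eventually_elim
      case (elim k)
      then have "hit k (t k)" using t_hit by blast
      then have n: "norm (u k (t k)) = \<delta>" "\<And>s. 0 \<le> s \<Longrightarrow> s < t k \<Longrightarrow> norm (u k s) < \<delta>"
        by (auto simp: hit_def)
      have "norm (u k s) \<le> \<delta>" if "s \<in> {0..t k}" for s
        using n(1) n(2)[of s] that by (cases "s = t k") auto
      with n(1) show ?case by blast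
    qed
  qed
qed

text \<open>The elapsed time b - a equals -\<epsilon> s, which cancels the 1 / \<epsilon> in the
  exponents: decay and nondegeneracy are expressed in s alone, uniformly along the sequence.\<close>

lemma backward_estimates:
  assumes u: "flow \<epsilon> u" and K: "K \<ge> 2" "\<eta> * K \<le> \<mu> / 2" "2 * \<eta> * (1 + K) \<le> \<gamma>" and R: "remainder_le \<eta> \<delta>"
    and b: "b \<le> S" "norm (u b) = \<delta>" and small: "\<And>t. t \<in> {0..b} \<Longrightarrow> norm (u t) \<le> \<delta>"
    and cone0: "(norm (u 0))\<^sup>2 \<le> K * (u 0 \<bullet> e)\<^sup>2"
    and neg: "\<And>t. t \<in> {a..b} \<Longrightarrow> l t \<le> - \<mu>" and low: "\<And>t. t \<in> {a..b} \<Longrightarrow> - \<Lambda> \<le> l t"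
    and a: "0 \<le> a" "a = b + \<epsilon> * s" "s \<le> 0"
  shows "(norm (u a))\<^sup>2 \<le> K * (u a \<bullet> e)\<^sup>2"
    and "(u a \<bullet> e)\<^sup>2 \<le> \<delta>\<^sup>2 * exp (\<mu> * s)"
    and "\<delta>\<^sup>2 / K * exp (2 * (\<Lambda> + \<eta> * K) * s) \<le> (u a \<bullet> e)\<^sup>2"
    and "0 < c * (u 0 \<bullet> e) \<Longrightarrow> 0 < c * (u a \<bullet> e)"
proof -
  have \<epsilon>: "\<epsilon> > 0" using u by (simp add: flow_def)
  have bT: "b \<le> T" using b S by auto
  have ab: "a \<le> b" using a \<epsilon> by (simp add: mult_nonneg_nonpos)
  have K1: "K \<ge> 1" using K by simp
  have ba: "b - a = \<epsilon> * (- s)" using a by simp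
  have cone: "(norm (u t))\<^sup>2 \<le> K * (u t \<bullet> e)\<^sup>2" if "t \<in> {0..b}" for t
    by (rule cone_invariant[OF u R K(1,3) b(1) small cone0 that])
  show "(norm (u a))\<^sup>2 \<le> K * (u a \<bullet> e)\<^sup>2" using cone a ab by auto
  show "0 < c * (u a \<bullet> e)" if "0 < c * (u 0 \<bullet> e)"
    by (rule component_pos[OF u R K1 b(1) small cone that]) (use a ab in auto)
  have bounds: "(u a \<bullet> e)\<^sup>2 * exp (2 / \<epsilon> * (G a - G b - \<eta> * K * (b - a))) \<le> (u b \<bullet> e)\<^sup>2"
    "(u b \<bullet> e)\<^sup>2 \<le> (u a \<bullet> e)\<^sup>2 * exp (2 / \<epsilon> * (G a - G b + \<eta> * K * (b - a)))"
    by (rule component_bounds[OF u R K1 a(1) ab b(1)]; use small cone a in auto)+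
  have "G b - G a \<le> - (\<mu> * (b - a))"
    using G_decrease[OF a(1) ab bT neg] by simp
  moreover have "\<eta> * K * (b - a) \<le> \<mu> / 2 * (b - a)"
    using K(2) ab by (intro mult_right_mono) auto
  moreover have "\<mu> / 2 * (b - a) + \<mu> / 2 * (b - a) = \<mu> * (b - a)"
    by (simp add: algebra_simps)
  ultimately have "\<mu> / 2 * (b - a) \<le> G a - G b - \<eta> * K * (b - a)"
    by linarith
  then have "2 / \<epsilon> * (\<mu> / 2 * (b - a)) \<le> 2 / \<epsilon> * (G a - G b - \<eta> * K * (b - a))"
    using \<epsilon> by (intro mult_left_mono) auto
  then have "- (\<mu> * s) \<le> 2 / \<epsilon> * (G a - G b - \<eta> * K * (b - a))"
    using \<epsilon> by (simp add: ba)
  then have "(u a \<bullet> e)\<^sup>2 * exp (- (\<mu> * s)) \<le> (u a \<bullet> e)\<^sup>2 * exp (2 / \<epsilon> * (G a - G b - \<eta> * K * (b - a)))"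
    by (intro mult_left_mono) auto
  also note bounds(1)
  also have "(u b \<bullet> e)\<^sup>2 \<le> (norm (u b))\<^sup>2"
    by (rule component_le_norm)
  finally have "(u a \<bullet> e)\<^sup>2 * exp (- (\<mu> * s)) * exp (\<mu> * s) \<le> \<delta>\<^sup>2 * exp (\<mu> * s)"
    unfolding b(2) by (rule mult_right_mono) simp
  then show "(u a \<bullet> e)\<^sup>2 \<le> \<delta>\<^sup>2 * exp (\<mu> * s)"
    by (simp add: mult.assoc flip: exp_add)
  have "G a - G b \<le> \<Lambda> * (b - a)"
    by (rule G_decrease_lower[OF a(1) ab bT low])
  then have "2 / \<epsilon> * (G a - G b + \<eta> * K * (b - a)) \<le> 2 / \<epsilon> * ((\<Lambda> + \<eta> * K) * (b - a))"
    using \<epsilon> by (intro mult_left_mono) (auto simp: algebra_simps)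
  also have "\<dots> = - (2 * (\<Lambda> + \<eta> * K) * s)"
    using \<epsilon> by (simp add: ba)
  finally have "(u a \<bullet> e)\<^sup>2 * exp (2 / \<epsilon> * (G a - G b + \<eta> * K * (b - a))) \<le>
      (u a \<bullet> e)\<^sup>2 * exp (- (2 * (\<Lambda> + \<eta> * K) * s))"
    by (intro mult_left_mono) auto
  with bounds(2) have "(u b \<bullet> e)\<^sup>2 \<le> (u a \<bullet> e)\<^sup>2 * exp (- (2 * (\<Lambda> + \<eta> * K) * s))"
    by (rule order_trans)
  \<comment> \<open>The anchor at the hitting time: norm \<delta> together with the cone bounds v^2
    from below, which keeps the limit w nontrivial.\<close>
  moreover have "\<delta>\<^sup>2 / K \<le> (u b \<bullet> e)\<^sup>2"
    using cone[of b] b(2) K a ab by (simp add: divide_le_eq mult.commute)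
  ultimately have "\<delta>\<^sup>2 / K \<le> (u a \<bullet> e)\<^sup>2 * exp (- (2 * (\<Lambda> + \<eta> * K) * s))"
    by simp
  then have "\<delta>\<^sup>2 / K * exp (2 * (\<Lambda> + \<eta> * K) * s) \<le>
      (u a \<bullet> e)\<^sup>2 * exp (- (2 * (\<Lambda> + \<eta> * K) * s)) * exp (2 * (\<Lambda> + \<eta> * K) * s)"
    by (rule mult_right_mono) simp
  then show "\<delta>\<^sup>2 / K * exp (2 * (\<Lambda> + \<eta> * K) * s) \<le> (u a \<bullet> e)\<^sup>2"
    by (simp add: mult.assoc flip: exp_add)
qed

end

subsection \<open>The trajectory leaving the origin\<close>

lemma liminf_pos_eventually_ge:
  fixes f :: "nat \<Rightarrow> real"
  assumes "liminf (\<lambda>k. ereal (f k)) > 0"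
  obtains c where "c > 0" "\<forall>\<^sub>F k in sequentially. c < f k"
proof -
  obtain c where c: "0 < ereal c" "ereal c < liminf (\<lambda>k. ereal (f k))"
    using ereal_dense2[OF assms] by auto
  from less_LiminfD[OF c(2)] have "\<forall>\<^sub>F k in sequentially. c < f k" by simp
  with c(1) show thesis by (intro that) auto
qed

theorem proposition4p1:
  fixes F :: "real \<Rightarrow> 'a::euclidean_space \<Rightarrow> real"
    and T :: real
    and e1 :: 'a
    and \<epsilon> :: "nat \<Rightarrow> real"
    and u\<epsilon> :: "nat \<Rightarrow> real \<Rightarrow> 'a"
    and r :: "nat \<Rightarrow> nat"
    and u :: "real \<Rightarrow> 'a"
  assumes "T > 0"
    and "F0 T F" "F1 T F" "F2 T F" "F3 T F"
    and "\<forall>t\<in>{0..T}. gradx F t 0 = 0"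
    and "lambda1 F 0 > 0"
    and "integral {0..T} (lambda1 F) < 0"
    and A1: "\<exists>\<rho>>0. t_star T F + \<rho> \<le> T \<and>
               (\<forall>t\<in>{0..t_star T F + \<rho>}.
                  simple_eigenvalue (hessx F t 0) (lambda1 F t) \<and>
                  eigenspace (hessx F t 0) (lambda1 F t) = span {e1})"
    and A2: "endo_det (hessx F (t_star T F) 0) \<noteq> 0"
    and "\<forall>k. \<epsilon> k > 0" "\<epsilon> \<longlonglongrightarrow> 0"
    and "\<forall>k. gradient_flow T F (\<epsilon> k) (u\<epsilon> k)"
    and "(\<lambda>k. u\<epsilon> k 0) \<longlonglongrightarrow> 0"
    and "\<exists>\<alpha>>0. liminf (\<lambda>k. ereal (norm (u\<epsilon> k 0) / \<epsilon> k powr \<alpha>)) > 0"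
    and "liminf (\<lambda>k. ereal (\<bar>u\<epsilon> k 0 \<bullet> e1\<bar>\<^sup>2 / (norm (u\<epsilon> k 0))\<^sup>2)) > 0"
    and "strict_mono r" "compactness_limit T F (u\<epsilon> \<circ> r) u"
  shows "\<exists>t\<epsilon> :: nat \<Rightarrow> real. (\<forall>k. t\<epsilon> k \<in> {0..T}) \<and> t\<epsilon> \<longlonglongrightarrow> t_star T F \<and>
           (\<exists>(q :: nat \<Rightarrow> nat) (w :: real \<Rightarrow> 'a).
              strict_mono q \<and>
              (\<forall>K. compact K \<longrightarrow>
                 uniform_limit K
                   (\<lambda>k s. u\<epsilon> (r (q k)) (t\<epsilon> (r (q k)) + \<epsilon> (r (q k)) * s)) w sequentially) \<and>
              (\<forall>s. (w has_vector_derivative - gradx F (t_star T F) (w s)) (at s)) \<and>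
              (w \<longlongrightarrow> 0) at_bot \<and>
              ((\<forall>k. u\<epsilon> (r k) 0 \<bullet> e1 > 0) \<longrightarrow>
                 Liminf at_bot (\<lambda>s. ereal (w s \<bullet> e1 / norm (w s))) > 0) \<and>
              ((\<forall>k. u\<epsilon> (r k) 0 \<bullet> e1 < 0) \<longrightarrow>
                 Limsup at_bot (\<lambda>s. ereal (w s \<bullet> e1 / norm (w s))) < 0))"
proof -
  define ts where "ts = t_star T F"
  define l where "l = lambda1 F"
  define G where "G t = integral {0..t} l" for t
  note T = assms(1) and F0 = assms(2)
  have cl: "continuous_on {0..T} l"
    unfolding l_def by (rule continuous_on_lambda1[OF F0])
  have "ts = (LEAST t. t \<in> {0<..<T} \<and> integral {0..t} l = 0)"
    by (simp add: ts_def t_star_def l_def)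
  note Z = first_zero_of_integral[OF T cl assms(7,8)[folded l_def] this, folded G_def]
  have G0: "G 0 = 0" by (simp add: G_def)
  obtain \<rho> where \<rho>: "\<rho> > 0" "ts + \<rho> \<le> T"
    "\<And>t. t \<in> {0..ts + \<rho>} \<Longrightarrow> eigenspace (hessx F t 0) (l t) = span {e1}"
    using A1 unfolding ts_def l_def by blast
  define S where "S = ts + \<rho>"
  have S: "0 < S" "S \<le> T" using Z(1) \<rho> by (auto simp: S_def)
  have ST: "t \<in> {0..T}" if "t \<in> {0..S}" for t using that S by auto
  have ray: "l t \<in> eigenvalues (hessx F t 0)" "l t * (norm x)\<^sup>2 \<le> hessx F t 0 x \<bullet> x"
    if "t \<in> {0..T}" for t x
    using lambda1_rayleigh[OF F0 that] by (auto simp: l_def)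
  have e1: "e1 \<noteq> 0"
  proof
    assume "e1 = 0"
    then have "eigenspace (hessx F 0 0) (l 0) = {0}"
      using \<rho>(3)[of 0] \<rho>(1) Z(1) by simp
    with ray(1)[of 0] T show False by (auto simp: eigenvalues_def)
  qed
  \<comment> \<open>(A1) fixes only the line, so e1 is normalized; \<open>ie\<close> transfers the
    estimates back to e1.\<close>
  define e where "e = (1 / norm e1) *\<^sub>R e1"
  have norm_e: "norm e = 1" using e1 by (simp add: e_def)
  have ie: "x \<bullet> e1 = norm e1 * (x \<bullet> e)" for x using e1 by (simp add: e_def)
  have Ae: "hessx F t 0 e = l t *\<^sub>R e" if "t \<in> {0..S}" for t
  proof -
    have "e \<in> span {e1}" unfolding e_def by (intro span_scale span_base) simp
    then show ?thesis using \<rho>(3)[of t] that by (auto simp: S_def eigenspace_def)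
  qed
  have cA: "continuous_on ({0..T} \<times> UNIV) (\<lambda>p. hessx F (fst p) 0 (snd p))"
    by (rule hessx_bounds[OF F0])
  obtain \<gamma> where \<gamma>: "\<gamma> > 0"
    "\<And>t z. t \<in> {0..S} \<Longrightarrow> z \<bullet> e1 = 0 \<Longrightarrow> (l t + \<gamma>) * (norm z)\<^sup>2 \<le> hessx F t 0 z \<bullet> z"
  proof (rule spectral_gap[of "{0..S}" "\<lambda>t. hessx F t 0" l e1])
    show "continuous_on ({0..S} \<times> UNIV) (\<lambda>p. hessx F (fst p) 0 (snd p))"
      by (rule continuous_on_subset[OF cA]) (use S in auto)
    show "continuous_on {0..S} l"
      by (rule continuous_on_subset[OF cl]) (use S in auto)
  qed (use hessx_symmetric[OF F0 ST] ray(2)[OF ST] \<rho>(3) in \<open>auto simp: S_def\<close>)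
  interpret linearized_flow "gradx F" "\<lambda>t. hessx F t 0" l G e T S \<gamma>
    by (rule linearized_flow.intro)
      (use S hessx_symmetric[OF F0] ray(2) norm_e Ae \<gamma> Z(6) G0 in \<open>auto simp: ie\<close>)
  have rem: "\<exists>\<delta>. remainder_le \<eta> \<delta>" if \<eta>: "\<eta> > 0" for \<eta>
  proof -
    obtain \<delta> where "\<delta> > 0" "\<And>t x. t \<in> {0..T} \<Longrightarrow> norm x \<le> \<delta> \<Longrightarrow>
        norm (gradx F t x - gradx F t 0 - hessx F t 0 x) \<le> \<eta> * norm x"
      using gradx_remainder[OF F0 \<eta>] by blast
    then show ?thesis
      using \<eta> assms(6) unfolding remainder_le_def by (intro exI[of _ \<delta>]) auto
  qed
  have tsT: "ts \<in> {0..T}" using Z(1,2) by simp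
  \<comment> \<open>Minimality of ts gives only \<open>l ts \<le> 0\<close>; (A2) excludes equality,
    since a zero eigenvalue has a kernel vector.\<close>
  have "l ts \<noteq> 0"
  proof
    assume "l ts = 0"
    then obtain v where "hessx F ts 0 v = 0" "v \<noteq> 0"
      using ray(1)[OF tsT] by (auto simp: eigenvalues_def eigenspace_def)
    then have "endo_det (hessx F ts 0) = 0"
      by (intro endo_det_eq_0 hessx_symmetric(1)[OF F0 tsT])
    with A2 show False by (simp add: ts_def)
  qed
  with Z(5) have lts: "l ts < 0" by simp
  \<comment> \<open>Half of the growth rate at ts, so that it persists on a neighbourhood.\<close>
  define \<mu> where "\<mu> = - l ts / 2"
  have \<mu>: "\<mu> > 0" using lts by (simp add: \<mu>_def)
  obtain d0 where d0: "d0 > 0" "\<And>t. t \<in> {0..T} \<Longrightarrow> dist t ts < d0 \<Longrightarrow> dist (l t) (l ts) < \<mu>"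
    using cl tsT \<mu> unfolding continuous_on_iff by meson
  define d where "d = Min {d0 / 2, ts / 2, \<rho>}"
  have d: "d > 0" "d < ts" "ts + d \<le> S" "d < d0"
    using d0(1) Z(1) \<rho>(1) by (auto simp: d_def S_def min_def)
  have neg: "l t \<le> - \<mu>" if "t \<in> {ts - d..ts + d}" for t
  proof -
    have "dist (l t) (l ts) < \<mu>"
      using that d S by (intro d0(2)) (auto simp: dist_real_def)
    then show ?thesis by (simp add: dist_real_def \<mu>_def)
  qed
  obtain \<kappa> where \<kappa>: "\<kappa> > 0"
    "\<forall>\<^sub>F k in sequentially. \<kappa> < \<bar>u\<epsilon> k 0 \<bullet> e1\<bar>\<^sup>2 / (norm (u\<epsilon> k 0))\<^sup>2"
    using liminf_pos_eventually_ge[OF assms(16)] by blast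
  \<comment> \<open>\<kappa> is the eventual lower bound for the squared cosine, up to the factor
    |e1|^2; the value 2 is the minimum required by \<open>cone_invariant\<close>.\<close>
  define K where "K = max 2 ((norm e1)\<^sup>2 / \<kappa>)"
  have K: "K \<ge> 2" "(norm e1)\<^sup>2 / \<kappa> \<le> K" by (auto simp: K_def)
  have cone0: "\<forall>\<^sub>F k in sequentially. (norm (u\<epsilon> k 0))\<^sup>2 \<le> K * (u\<epsilon> k 0 \<bullet> e)\<^sup>2"
    using \<kappa>(2)
  proof eventually_elim
    case (elim k)
    then have "u\<epsilon> k 0 \<noteq> 0" using \<kappa>(1) by auto
    then have "\<kappa> * (norm (u\<epsilon> k 0))\<^sup>2 \<le> (norm e1)\<^sup>2 * (u\<epsilon> k 0 \<bullet> e)\<^sup>2"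
      using elim by (simp add: less_divide_eq ie power_mult_distrib)
    then have "(norm (u\<epsilon> k 0))\<^sup>2 \<le> (norm e1)\<^sup>2 / \<kappa> * (u\<epsilon> k 0 \<bullet> e)\<^sup>2"
      using \<kappa>(1) by (simp add: le_divide_eq mult.commute)
    also have "\<dots> \<le> K * (u\<epsilon> k 0 \<bullet> e)\<^sup>2"
      by (rule mult_right_mono[OF K(2)]) simp
    finally show ?case .
  qed
  \<comment> \<open>One entry preserves half of the rate \<mu> inside the cone, the other makes the
    cone invariant. \<delta> is then fixed for good.\<close>
  define \<eta> where "\<eta> = min (\<mu> / (2 * K)) (\<gamma> / (2 * (1 + K)))"
  have "\<eta> > 0" using \<mu> \<gamma>(1) K(1) by (simp add: \<eta>_def)
  then obtain \<delta> where R: "remainder_le \<eta> \<delta>" using rem by blast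
  have "\<eta> \<le> \<mu> / (2 * K)" "\<eta> \<le> \<gamma> / (2 * (1 + K))" by (auto simp: \<eta>_def)
  then have \<eta>: "\<eta> * K \<le> \<mu> / 2" "2 * \<eta> * (1 + K) \<le> \<gamma>"
    using K(1) by (simp_all add: le_divide_eq algebra_simps)
  have \<delta>: "\<delta> > 0" using R by (simp add: remainder_le_def)
  obtain \<alpha> where \<alpha>: "\<alpha> > 0" "liminf (\<lambda>k. ereal (norm (u\<epsilon> k 0) / \<epsilon> k powr \<alpha>)) > 0"
    using assms(15) by blast
  obtain c where c: "c > 0"
    "\<forall>\<^sub>F k in sequentially. c < norm (u\<epsilon> k 0) / \<epsilon> k powr \<alpha>"
    using liminf_pos_eventually_ge[OF \<alpha>(2)] by blast
  have c': "\<forall>\<^sub>F k in sequentially. c * \<epsilon> k powr \<alpha> \<le> norm (u\<epsilon> k 0)"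
    using c(2)
  proof eventually_elim
    case (elim k)
    moreover have "\<epsilon> k > 0" using assms(11) by simp
    ultimately show ?case by (simp add: less_divide_eq)
  qed
  have \<epsilon>pos: "\<epsilon> k > 0" for k using assms(11) by simp
  have flow: "flow (\<epsilon> k) (u\<epsilon> k)" for k
    unfolding flow_def
  proof (intro conjI ballI \<epsilon>pos)
    fix t assume t: "t \<in> {0..T}"
    obtain u' where u': "(u\<epsilon> k has_vector_derivative u' t) (at t within {0..T})"
      "\<epsilon> k *\<^sub>R u' t = - gradx F t (u\<epsilon> k t)"
      using assms(13) t unfolding gradient_flow_def by blast
    have "u' t = (1 / \<epsilon> k) *\<^sub>R (\<epsilon> k *\<^sub>R u' t)"
      using \<epsilon>pos[of k] by simp
    then have "u' t = - (1 / \<epsilon> k) *\<^sub>R gradx F t (u\<epsilon> k t)"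
      unfolding u'(2) by simp
    with u'(1) show "(u\<epsilon> k has_vector_derivative - (1 / \<epsilon> k) *\<^sub>R gradx F t (u\<epsilon> k t)) (at t within {0..T})"
      by simp
  qed
  \<comment> \<open>The times are found for the full sequence; subsequences enter only with the
    limit w.\<close>
  obtain t where t: "\<And>k. t k \<in> {0..T}" "t \<longlonglongrightarrow> ts"
    "\<forall>\<^sub>F k in sequentially. norm (u\<epsilon> k (t k)) = \<delta> \<and> (\<forall>s\<in>{0..t k}. norm (u\<epsilon> k s) \<le> \<delta>)"
    using hitting_times_converge[OF rem Z(1,3,7) \<mu> d(1-3) neg K(1) \<eta> R flow assms(14,12) cone0 \<alpha>(1) c(1) c']
    by blast
  have "bounded (range (\<lambda>k. u\<epsilon> k 0))"
    using assms(14) by (intro convergent_imp_bounded)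
  then obtain B where B: "\<And>k. norm (u\<epsilon> k 0) \<le> B"
    unfolding bounded_iff by auto
  obtain M where M: "\<And>\<epsilon> u t. \<epsilon> > 0 \<Longrightarrow> gradient_flow T F \<epsilon> u \<Longrightarrow> norm (u 0) \<le> B \<Longrightarrow>
      t \<in> {0..T} \<Longrightarrow> norm (u t) \<le> M"
    using a_priori_bound[OF T F0 assms(3,4)] by blast
  obtain L where L: "L \<ge> 0" "\<And>t x y. t \<in> {0..T} \<Longrightarrow> norm x \<le> M \<Longrightarrow> norm y \<le> M \<Longrightarrow>
      norm (gradx F t x - gradx F t y) \<le> L * norm (x - y)"
    using gradx_lipschitz_on_balls[OF F0] by blast
  have sub_r: "(\<lambda>k. f (r k)) \<longlonglongrightarrow> x" if "f \<longlonglongrightarrow> x" for f and x :: real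
    using LIMSEQ_subseq_LIMSEQ[OF that assms(17)] by (simp add: o_def)
  obtain q w where q: "strict_mono q"
    and ul: "\<And>K. compact K \<Longrightarrow>
      uniform_limit K (\<lambda>k s. u\<epsilon> (r (q k)) (t (r (q k)) + \<epsilon> (r (q k)) * s)) w sequentially"
    and w': "\<And>s. (w has_vector_derivative - gradx F ts (w s)) (at s)"
  proof (rule rescaled_flows_converge[OF continuous_on_gradx[OF F0] L(2) L(1) Z(1,2),
        where \<epsilon> = "\<lambda>k. \<epsilon> (r k)" and t = "\<lambda>k. t (r k)" and u = "\<lambda>k. u\<epsilon> (r k)"])
    show "(\<lambda>k. \<epsilon> (r k)) \<longlonglongrightarrow> 0" "(\<lambda>k. t (r k)) \<longlonglongrightarrow> ts"
      by (intro sub_r assms(12) t(2))+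
    show "(u\<epsilon> (r k) has_vector_derivative - (1 / \<epsilon> (r k)) *\<^sub>R gradx F s (u\<epsilon> (r k) s)) (at s within {0..T})"
      if "s \<in> {0..T}" for k s
      using flow[of "r k"] that by (simp add: flow_def)
    show "norm (u\<epsilon> (r k) s) \<le> M" if "s \<in> {0..T}" for k s
      using assms(13) B that by (intro M[OF \<epsilon>pos]) auto
  qed (use \<epsilon>pos in auto)
  define p where "p k = r (q k)" for k
  have p: "strict_mono p" using assms(17) q by (auto simp: p_def strict_mono_def)
  define W where "W k s = u\<epsilon> (p k) (t (p k) + \<epsilon> (p k) * s)" for k s
  have W: "(\<lambda>k. W k s) \<longlonglongrightarrow> w s" for s
    using tendsto_uniform_limitI[OF ul[of "{s}"], of s] by (simp add: W_def p_def)
  have "bounded (l ` {0..T})"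
    by (intro compact_imp_bounded compact_continuous_image cl) auto
  then obtain \<Lambda> where "\<forall>t\<in>{0..T}. \<bar>l t\<bar> \<le> \<Lambda>"
    unfolding bounded_iff by auto
  then have \<Lambda>: "- \<Lambda> \<le> l t" if "t \<in> {0..T}" for t
    using that by (force simp: abs_le_iff)
  \<comment> \<open>For fixed s the times involved eventually lie in the neighbourhood where l is
    below -\<mu>.\<close>
  have est: "\<forall>\<^sub>F k in sequentially. (norm (W k s))\<^sup>2 \<le> K * (W k s \<bullet> e)\<^sup>2 \<and>
      (W k s \<bullet> e)\<^sup>2 \<le> \<delta>\<^sup>2 * exp (\<mu> * s) \<and>
      \<delta>\<^sup>2 / K * exp (2 * (\<Lambda> + \<eta> * K) * s) \<le> (W k s \<bullet> e)\<^sup>2 \<and>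
      (\<forall>c. 0 < c * (u\<epsilon> (p k) 0 \<bullet> e) \<longrightarrow> 0 < c * (W k s \<bullet> e))"
    if s: "s \<le> 0" for s
  proof -
    have sub: "(\<lambda>k. f (p k)) \<longlonglongrightarrow> x" if "f \<longlonglongrightarrow> x" for f and x :: real
      using LIMSEQ_subseq_LIMSEQ[OF that p] by (simp add: o_def)
    have "(\<lambda>k. t (p k) + \<epsilon> (p k) * s) \<longlonglongrightarrow> ts + 0 * s"
      by (intro tendsto_intros sub t(2) assms(12))
    then have "\<forall>\<^sub>F k in sequentially. ts - d < t (p k) + \<epsilon> (p k) * s"
      using d(1) by (intro order_tendstoD(1)) auto
    moreover have "\<forall>\<^sub>F k in sequentially. t (p k) < ts + d"
      using d(1) by (intro order_tendstoD(2)[OF sub[OF t(2)]]) auto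
    ultimately show ?thesis
      using eventually_subseq[OF p t(3)] eventually_subseq[OF p cone0]
    proof eventually_elim
      case (elim k)
      have "t (p k) \<le> S" "0 \<le> t (p k) + \<epsilon> (p k) * s"
        using elim(1,2) d by auto
      moreover have "l x \<le> - \<mu>" "- \<Lambda> \<le> l x" if "x \<in> {t (p k) + \<epsilon> (p k) * s..t (p k)}" for x
        using that elim(1,2) d S by (auto intro!: neg \<Lambda>)
      ultimately show ?case
        using elim(3) backward_estimates[OF flow K(1) \<eta> R _ _ _ elim(4), of "t (p k)" "t (p k) + \<epsilon> (p k) * s" \<Lambda> s] s
        unfolding W_def by blast
    qed
  qed
  have lim: "(norm (w s))\<^sup>2 \<le> K * (w s \<bullet> e)\<^sup>2" "(w s \<bullet> e)\<^sup>2 \<le> \<delta>\<^sup>2 * exp (\<mu> * s)"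
    "\<delta>\<^sup>2 / K * exp (2 * (\<Lambda> + \<eta> * K) * s) \<le> (w s \<bullet> e)\<^sup>2" if s: "s \<le> 0" for s
  proof -
    have t1: "(\<lambda>k. (norm (W k s))\<^sup>2) \<longlonglongrightarrow> (norm (w s))\<^sup>2" and t2: "(\<lambda>k. (W k s \<bullet> e)\<^sup>2) \<longlonglongrightarrow> (w s \<bullet> e)\<^sup>2"
      by (intro tendsto_intros W)+
    show "(norm (w s))\<^sup>2 \<le> K * (w s \<bullet> e)\<^sup>2"
      by (rule tendsto_le[OF _ tendsto_mult_left[OF t2] t1]) (use est[OF s] in \<open>auto elim: eventually_mono\<close>)
    show "(w s \<bullet> e)\<^sup>2 \<le> \<delta>\<^sup>2 * exp (\<mu> * s)"
      by (rule tendsto_upperbound[OF t2]) (use est[OF s] in \<open>auto elim: eventually_mono\<close>)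
    show "\<delta>\<^sup>2 / K * exp (2 * (\<Lambda> + \<eta> * K) * s) \<le> (w s \<bullet> e)\<^sup>2"
      by (rule tendsto_lowerbound[OF t2]) (use est[OF s] in \<open>auto elim: eventually_mono\<close>)
  qed
  have decay: "((\<lambda>s. K * (\<delta>\<^sup>2 * exp (\<mu> * s))) \<longlongrightarrow> 0) at_bot"
  proof -
    have "((\<lambda>s. exp (\<mu> * s)) \<longlongrightarrow> 0) at_bot"
      using \<mu> by real_asymp
    from tendsto_mult_left[OF tendsto_mult_left[OF this]] show ?thesis by simp
  qed
  have "\<forall>\<^sub>F s in at_bot. (norm (w s))\<^sup>2 \<le> K * (\<delta>\<^sup>2 * exp (\<mu> * s))"
    using eventually_le_at_bot[of "0::real"]
  proof eventually_elim
    case (elim s)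
    have "K * (w s \<bullet> e)\<^sup>2 \<le> K * (\<delta>\<^sup>2 * exp (\<mu> * s))"
      using lim(2)[OF elim] K(1) by (intro mult_left_mono) auto
    with lim(1)[OF elim] show ?case by (rule order_trans)
  qed
  with decay have "((\<lambda>s. (norm (w s))\<^sup>2) \<longlongrightarrow> 0) at_bot"
    by (intro tendsto_sandwich[OF always_eventually _ tendsto_const decay]) simp_all
  from tendsto_real_sqrt[OF this] have w0: "(w \<longlongrightarrow> 0) at_bot"
    by (simp add: tendsto_norm_zero_iff)
  \<comment> \<open>c = 1 and c = -1 give the two sign claims with the same constant.\<close>
  have ratio: "norm e1 / K \<le> c * (w s \<bullet> e1 / norm (w s))"
    if s: "s \<le> 0" and c1: "\<bar>c\<bar> = 1" and sgn: "\<forall>k. 0 < c * (u\<epsilon> (r k) 0 \<bullet> e1)" for s c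
  proof -
    have "0 < c * (u\<epsilon> (p k) 0 \<bullet> e)" for k
    proof -
      have "0 < norm e1 * (c * (u\<epsilon> (p k) 0 \<bullet> e))"
        using sgn by (simp add: p_def ie mult.left_commute)
      then show ?thesis using e1 by (simp add: zero_less_mult_iff)
    qed
    then have "\<forall>\<^sub>F k in sequentially. 0 \<le> c * (W k s \<bullet> e)"
      using est[OF s] by (auto elim!: eventually_mono intro: less_imp_le)
    moreover have "(\<lambda>k. c * (W k s \<bullet> e)) \<longlonglongrightarrow> c * (w s \<bullet> e)"
      by (intro tendsto_intros W)
    ultimately have "0 \<le> c * (w s \<bullet> e)"
      by (intro tendsto_lowerbound[of _ _ sequentially]) auto
    \<comment> \<open>The limit keeps only a weak sign; strictness comes from the cone and from the
      lower bound for v^2, which also makes \<open>norm (w s)\<close> a nonzero denominator.\<close>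
    then have cw: "c * (w s \<bullet> e) = \<bar>w s \<bullet> e\<bar>"
      using c1 by (metis abs_mult abs_of_nonneg mult_1)
    have "0 < \<delta>\<^sup>2 / K * exp (2 * (\<Lambda> + \<eta> * K) * s)"
      using \<delta> K(1) by simp
    with lim(3)[OF s] have "w s \<bullet> e \<noteq> 0" by auto
    then have pos: "norm (w s) > 0" by auto
    have "K * (w s \<bullet> e)\<^sup>2 \<le> (K * \<bar>w s \<bullet> e\<bar>)\<^sup>2"
      using K(1) unfolding power_mult_distrib power2_abs
      by (intro mult_right_mono) (auto simp: power2_eq_square)
    with lim(1)[OF s] have "(norm (w s))\<^sup>2 \<le> (K * \<bar>w s \<bullet> e\<bar>)\<^sup>2"
      by (rule order_trans)
    then have "norm (w s) \<le> K * \<bar>w s \<bullet> e\<bar>"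
      using K(1) by (simp add: power2_le_iff_abs_le)
    then have "norm e1 * norm (w s) \<le> norm e1 * (K * (c * (w s \<bullet> e)))"
      unfolding cw by (rule mult_left_mono) simp
    also have "\<dots> = K * (c * (w s \<bullet> e1))"
      by (simp add: ie)
    finally show ?thesis
      using pos K(1) by (simp add: field_simps)
  qed
  have "norm e1 / K > 0" using e1 K(1) by simp
  then have pos: "0 < ereal (norm e1 / K)" and neg: "ereal (- (norm e1 / K)) < 0" by simp_all
  show ?thesis
  proof (intro exI[of _ t] exI[of _ q] exI[of _ w] conjI impI)
    assume "\<forall>k. u\<epsilon> (r k) 0 \<bullet> e1 > 0"
    then have "ereal (norm e1 / K) \<le> ereal (w s \<bullet> e1 / norm (w s))" if "s \<le> 0" for s
      using ratio[of s 1] that by simp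
    then have "ereal (norm e1 / K) \<le> Liminf at_bot (\<lambda>s. ereal (w s \<bullet> e1 / norm (w s)))"
      by (intro Liminf_bounded eventually_mono[OF eventually_le_at_bot[of 0]]) auto
    with pos show "Liminf at_bot (\<lambda>s. ereal (w s \<bullet> e1 / norm (w s))) > 0"
      by (rule less_le_trans)
  next
    assume "\<forall>k. u\<epsilon> (r k) 0 \<bullet> e1 < 0"
    then have "ereal (w s \<bullet> e1 / norm (w s)) \<le> ereal (- (norm e1 / K))" if "s \<le> 0" for s
      using ratio[of s "- 1"] that by simp
    then have "Limsup at_bot (\<lambda>s. ereal (w s \<bullet> e1 / norm (w s))) \<le> ereal (- (norm e1 / K))"
      by (intro Limsup_bounded eventually_mono[OF eventually_le_at_bot[of 0]]) auto
    then show "Limsup at_bot (\<lambda>s. ereal (w s \<bullet> e1 / norm (w s))) < 0"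
      using neg by (rule le_less_trans)
  qed (use t q ul w' w0 in \<open>auto simp: ts_def\<close>)
qed

end
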